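(* Let $(K, \Lambda, Q, \tilde\Lambda_+, R_+, p, q, r, s)$ be a chopped and sliced cone such that the cone $C = \{x \in K_{\mathbf{R}} : r(x) \geq 0\} \subset K_{\mathbf{R}}$ is pointed. (1) There are free Abelian groups $X$ and $Y$ of finite rank, where $X$ is generated by a basis of a free Abelian monoid $X_+$, and homomorphisms $E : X \to Y$ with $\ker E \cap X_+ = \{0\}$ and $B : \Lambda \times Q \to Y$ such that $$|C^\lambda_\beta \cap K| = \Phi_E\bigl(B(\lambda, \beta)\bigr)$$ for all $\lambda \in \Lambda$ and $\beta \in Q$. (2) There is a fan $F$ in $\Lambda \times Q$ such that the function $\Lambda \times Q \to \mathbf{Z}_+$, $(\lambda, \beta) \mapsto |C^\lambda_\beta \cap K|$, is quasi-polynomial on each of the maximal cones of $F$ and vanishes at all points outside the union of the cones of $F$. The fan $F$ and the quasi-polynomials associated with its maximal cones are effectively computable.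
   Context: Chopped and sliced cones. Let $K$, $\Lambda$, $Q$ be free Abelian groups of finite rank, and let $\tilde\Lambda_+$, $R_+$ be free Abelian monoids of finite rank (i.e. isomorphic to $\mathbf{Z}_{\geq 0}^m$ for some $m$). Let $\tilde\Lambda$ and $R$ be the free Abelian groups generated by a basis of $\tilde\Lambda_+$ and $R_+$ respectively. On $\tilde\Lambda$ put the partial order $x \leq y$ iff $y - x \in \tilde\Lambda_+$, and similarly on $R$ (using $R_+$); these are extended to the real vector spaces $\tilde\Lambda_{\mathbf{R}}$, $R_{\mathbf{R}}$ as the componentwise orders with respect to the given bases. Here $K_{\mathbf{R}} = K \otimes_{\mathbf{Z}} \mathbf{R}$, and similarly for the other groups. Let $p : K \to \tilde\Lambda$, $q : K \to Q$, $r : K \to R$, $s : \Lambda \to \tilde\Lambda$ be group homomorphisms; their $\mathbf{R}$-linear extensions are denoted by the same symbols. The 9-tuple $(K, \Lambda, Q, \tilde\Lambda_+, R_+, p, q, r, s)$ is called a chopped and sliced cone if for every $\lambda \in \Lambda$ the set $$C^\lambda = \{ x \in K_{\mathbf{R}} : r(x) \geq 0,\ p(x) \leq s(\lambda) \}$$ is bounded. For $\lambda \in \Lambda$, $\beta \in Q$ put $C^\lambda_\beta = \{ x \in C^\lambda : q(x) = \beta \}$. A cone is pointed if it contains no line through the origin. Vector partition functions. Let $Y$ be a free Abelian group of finite rank, $X_+$ a free Abelian monoid of finite rank, $X$ the free Abelian group generated by a basis of $X_+$, and $E : X \to Y$ a homomorphism with $\ker E \cap X_+ = \{0\}$. The vector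 partition function $\Phi_E : Y \to \mathbf{Z}_+ = \mathbf{Z}_{\geq 0}$ is $\Phi_E(y) = |\{ x \in X_+ : Ex = y \}|$. Quasi-polynomials and fans. Let $Y$ be a free Abelian group of finite rank. A function $f$ on a subset $S \subset Y$ is called quasi-polynomial if there are a subgroup $Z \subset Y$ of finite index and a family $(f_{\bar y})_{\bar y \in Y/Z}$ of polynomial functions on $Y$ such that $f(y) = f_{\bar y}(y)$ for all $y \in S$, where $\bar y$ is the class of $y$. A function on $Y$ is quasi-polynomial on a cone $\mathfrak{c} \subset Y_{\mathbf{R}}$ if its restriction to $\mathfrak{c} \cap Y$ is quasi-polynomial. A fan in $Y$ is a set $F$ of rational convex polyhedral cones in $Y_{\mathbf{R}}$ such that any face of a cone in $F$ is in $F$ and the intersection of any two cones in $F$ is a face of both. Effectively computable means that there is an algorithm which, given the data of the chopped and sliced cone (integer matrices of $p,q,r,s$), outputs the fan as a finite list of cones together with the corresponding quasi-polynomials. *)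

theory Defs
  imports Complex_Main "HOL-Library.Nat_Bijection" "HOL-Algebra.Coset"
    "Jordan_Normal_Form.Matrix" "Jordan_Normal_Form.Matrix_Kernel"
begin

text \<open>
  A free Abelian group of rank \<open>n\<close> is represented, after the choice of a basis, by the integer
  vectors in \<open>carrier_vec n\<close>, and its realification by the real vectors in \<open>carrier_vec n\<close>;
  rank \<open>0\<close> is allowed.  Homomorphisms are integer matrices.  The submonoid generated by the basis
  is the set of nonnegative integer vectors, and the associated partial order is the componentwise
  order \<open>\<le>\<close> on vectors.  An element \<open>(\<lambda>, \<beta>)\<close> of a direct product is the vector
  \<open>\<lambda> @\<^sub>v \<beta>\<close>.
\<close>

abbreviation real_vec :: "int vec \<Rightarrow> real vec" where
  "real_vec \<equiv> map_vec real_of_int"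

abbreviation real_mat :: "int mat \<Rightarrow> real mat" where
  "real_mat \<equiv> map_mat real_of_int"

definition lattice_points :: "nat \<Rightarrow> real vec set" where
  "lattice_points n = real_vec ` carrier_vec n"


subsection \<open>Chopped and sliced cones\<close>

definition bounded_vecs :: "real vec set \<Rightarrow> bool" where
  "bounded_vecs S \<longleftrightarrow> (\<exists>M. \<forall>x\<in>S. \<forall>i<dim_vec x. \<bar>x $ i\<bar> \<le> M)"

definition pointed :: "nat \<Rightarrow> real vec set \<Rightarrow> bool" where
  "pointed n C \<longleftrightarrow> \<not> (\<exists>v\<in>carrier_vec n. v \<noteq> 0\<^sub>v n \<and> (\<forall>t. t \<cdot>\<^sub>v v \<in> C))"

definition unchopped_cone :: "int mat \<Rightarrow> real vec set" where
  "unchopped_cone r =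
     {x \<in> carrier_vec (dim_col r). 0\<^sub>v (dim_row r) \<le> real_mat r *\<^sub>v x}"

definition chopped_cone :: "int mat \<Rightarrow> int mat \<Rightarrow> int mat \<Rightarrow> int vec \<Rightarrow> real vec set" where
  "chopped_cone p r s lam =
     {x \<in> unchopped_cone r. real_mat p *\<^sub>v x \<le> real_vec (s *\<^sub>v lam)}"

definition sliced_cone ::
    "int mat \<Rightarrow> int mat \<Rightarrow> int mat \<Rightarrow> int mat \<Rightarrow> int vec \<Rightarrow> int vec \<Rightarrow> real vec set" where
  "sliced_cone p q r s lam bet =
     {x \<in> chopped_cone p r s lam. real_mat q *\<^sub>v x = real_vec bet}"

text \<open>
  The arguments \<open>nK\<close>, \<open>nL\<close>, \<open>nQ\<close>, \<open>nT\<close>, \<open>nR\<close> are the ranks of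
  \<open>K\<close>, \<open>\<Lambda>\<close>, \<open>Q\<close>, of the monoid in which \<open>p\<close> and \<open>s\<close> are
  compared, and of \<open>R\<^sub>+\<close>.
\<close>

definition chopped_and_sliced_cone ::
    "nat \<Rightarrow> nat \<Rightarrow> nat \<Rightarrow> nat \<Rightarrow> nat \<Rightarrow> int mat \<Rightarrow> int mat \<Rightarrow> int mat \<Rightarrow> int mat \<Rightarrow> bool" where
  "chopped_and_sliced_cone nK nL nQ nT nR p q r s \<longleftrightarrow>
     p \<in> carrier_mat nT nK \<and> q \<in> carrier_mat nQ nK \<and>
     r \<in> carrier_mat nR nK \<and> s \<in> carrier_mat nT nL \<and>
     (\<forall>lam\<in>carrier_vec nL. bounded_vecs (chopped_cone p r s lam))"

definition num_points ::
    "int mat \<Rightarrow> int mat \<Rightarrow> int mat \<Rightarrow> int mat \<Rightarrow> int vec \<Rightarrow> int vec \<Rightarrow> nat" where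
  "num_points p q r s lam bet =
     card (sliced_cone p q r s lam bet \<inter> lattice_points (dim_col r))"

definition vector_partition_fun :: "int mat \<Rightarrow> int vec \<Rightarrow> nat" where
  "vector_partition_fun E y =
     card {x \<in> carrier_vec (dim_col E). 0\<^sub>v (dim_col E) \<le> x \<and> E *\<^sub>v x = y}"


subsection \<open>Fans\<close>

text \<open>
  A rational cone is cut out by finitely many integral linear inequalities (the rows of \<open>A\<close>).
  Faces are cut out by supporting hyperplanes; \<open>u = 0\<close> gives the cone itself.
\<close>

definition rational_cone :: "int mat \<Rightarrow> real vec set" where
  "rational_cone A = {x \<in> carrier_vec (dim_col A). 0\<^sub>v (dim_row A) \<le> real_mat A *\<^sub>v x}"

definition is_rational_cone :: "nat \<Rightarrow> real vec set \<Rightarrow> bool" where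
  "is_rational_cone n c \<longleftrightarrow> (\<exists>A. dim_col A = n \<and> c = rational_cone A)"

definition is_face :: "nat \<Rightarrow> real vec set \<Rightarrow> real vec set \<Rightarrow> bool" where
  "is_face n d c \<longleftrightarrow>
     (\<exists>u\<in>carrier_vec n. (\<forall>x\<in>c. 0 \<le> u \<bullet> x) \<and> d = {x \<in> c. u \<bullet> x = 0})"

definition fan :: "nat \<Rightarrow> real vec set set \<Rightarrow> bool" where
  "fan n F \<longleftrightarrow>
     (\<forall>c\<in>F. is_rational_cone n c) \<and>
     (\<forall>c\<in>F. \<forall>d. is_face n d c \<longrightarrow> d \<in> F) \<and>
     (\<forall>c\<in>F. \<forall>d\<in>F. is_face n (c \<inter> d) c \<and> is_face n (c \<inter> d) d)"

definition maximal_cones :: "real vec set set \<Rightarrow> real vec set set" where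
  "maximal_cones F = {c \<in> F. \<forall>d\<in>F. c \<subseteq> d \<longrightarrow> d = c}"


subsection \<open>Quasi-polynomials\<close>

text \<open>
  A list of pairs \<open>(a, [e\<^sub>0, e\<^sub>1, \<dots>])\<close> stands for the sum of the monomials
  \<open>a * y\<^sub>0 ^ e\<^sub>0 * y\<^sub>1 ^ e\<^sub>1 * \<dots>\<close>; missing exponents count as \<open>0\<close>.
\<close>

type_synonym 'a mpoly_list = "('a \<times> nat list) list"

definition mpoly_eval :: "'a::comm_ring_1 mpoly_list \<Rightarrow> int vec \<Rightarrow> 'a" where
  "mpoly_eval P y =
     (\<Sum>(a, es)\<leftarrow>P. a * prod_list (map2 (\<lambda>t e. of_int t ^ e) (list_of_vec y) es))"

definition polynomial_fun :: "nat \<Rightarrow> (int vec \<Rightarrow> real) \<Rightarrow> bool" where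
  "polynomial_fun n g \<longleftrightarrow> (\<exists>P. \<forall>y\<in>carrier_vec n. g y = mpoly_eval P y)"

definition quasi_polynomial_on :: "nat \<Rightarrow> int vec set \<Rightarrow> (int vec \<Rightarrow> real) \<Rightarrow> bool" where
  "quasi_polynomial_on n S f \<longleftrightarrow>
     (\<exists>Z g. subgroup Z (monoid_vec TYPE(int) n) \<and>
            finite (rcosets\<^bsub>monoid_vec TYPE(int) n\<^esub> Z) \<and>
            (\<forall>c\<in>rcosets\<^bsub>monoid_vec TYPE(int) n\<^esub> Z. polynomial_fun n (g c)) \<and>
            (\<forall>y\<in>S. f y = g (Z #>\<^bsub>monoid_vec TYPE(int) n\<^esub> y) y))"

definition quasi_polynomial_on_cone :: "nat \<Rightarrow> real vec set \<Rightarrow> (int vec \<Rightarrow> real) \<Rightarrow> bool" where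
  "quasi_polynomial_on_cone n c f \<longleftrightarrow>
     quasi_polynomial_on n {y \<in> carrier_vec n. real_vec y \<in> c} f"

text \<open>
  Explicit form of a quasi-polynomial with rational coefficients: a period \<open>N > 0\<close> (the subgroup
  is \<open>N\<close> times the lattice) and a table assigning a polynomial to the residue vectors modulo
  \<open>N\<close>.  Every subgroup of finite index contains such a subgroup; residues missing from the table
  stand for the zero polynomial.
\<close>

type_synonym qpoly_table = "nat \<times> (int list \<times> rat mpoly_list) list"

fun qpoly_eval :: "qpoly_table \<Rightarrow> int vec \<Rightarrow> rat" where
  "qpoly_eval (N, tab) y =
     (case map_of tab (map (\<lambda>t. t mod int N) (list_of_vec y)) of
        None \<Rightarrow> 0
      | Some P \<Rightarrow> mpoly_eval P y)"


subsection \<open>Computability\<close>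

text \<open>
  Partial recursive functions: \<open>computes f xs y\<close> means that \<open>f\<close> halts on the arguments
  \<open>xs\<close> with value \<open>y\<close>.
\<close>

datatype recf = Zero | Succ | Proj nat | Comp recf "recf list" | PrimRec recf recf | Mu recf

inductive computes :: "recf \<Rightarrow> nat list \<Rightarrow> nat \<Rightarrow> bool" where
  zero: "computes Zero xs 0"
| succ: "computes Succ [x] (Suc x)"
| proj: "i < length xs \<Longrightarrow> computes (Proj i) xs (xs ! i)"
| comp: "list_all2 (\<lambda>g y. computes g xs y) gs ys \<Longrightarrow> computes f ys z \<Longrightarrow>
         computes (Comp f gs) xs z"
| primrec_0: "computes f xs y \<Longrightarrow> computes (PrimRec f g) (0 # xs) y"
| primrec_Suc: "computes (PrimRec f g) (n # xs) y \<Longrightarrow> computes g (y # n # xs) z \<Longrightarrow>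
         computes (PrimRec f g) (Suc n # xs) z"
| mu: "computes f (n # xs) 0 \<Longrightarrow> (\<And>i. i < n \<Longrightarrow> \<exists>y. computes f (i # xs) (Suc y)) \<Longrightarrow>
         computes (Mu f) xs n"

inductive_cases computes_elims:
  "computes Zero xs z"
  "computes Succ xs z"
  "computes (Proj i) xs z"
  "computes (Comp f gs) xs z"
  "computes (PrimRec f g) (0 # xs) z"
  "computes (PrimRec f g) (Suc n # xs) z"
  "computes (Mu f) xs z"

lemma computes_deterministic:
  assumes "computes f xs y" and "computes f xs z"
  shows "y = z"
  using assms
proof (induction arbitrary: z rule: computes.induct)
  case (zero xs)
  then show ?case by (rule computes_elims(1)) simp
next
  case (succ x)
  then show ?case by (rule computes_elims(2)) simp
next
  case (proj i xs)
  from proj.prems show ?case by (rule computes_elims(3)) simp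
next
  case (comp xs gs ys f w)
  from comp.prems obtain ys' where ys': "list_all2 (\<lambda>g y. computes g xs y) gs ys'"
    and z: "computes f ys' z"
    by (rule computes_elims(4))
  have "ys = ys'"
  proof (rule nth_equalityI)
    show "length ys = length ys'"
      using comp.IH(1) ys' by (simp add: list_all2_conv_all_nth)
  next
    fix i assume "i < length ys"
    then show "ys ! i = ys' ! i"
      using comp.IH(1) ys' by (simp add: list_all2_conv_all_nth)
  qed
  then show ?case using z comp.IH(2) by blast
next
  case (primrec_0 f xs y g)
  from primrec_0.prems have "computes f xs z" by (rule computes_elims(5))
  then show ?case by (rule primrec_0.IH)
next
  case (primrec_Suc f g n xs y w)
  from primrec_Suc.prems obtain y' where y': "computes (PrimRec f g) (n # xs) y'"
    and z: "computes g (y' # n # xs) z"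
    by (rule computes_elims(6))
  have "y = y'" using y' by (rule primrec_Suc.IH(1))
  with z show ?case by (simp add: primrec_Suc.IH(2))
next
  case (mu f n xs)
  from mu.prems have z: "computes f (z # xs) 0"
    and lt: "\<And>i. i < z \<Longrightarrow> \<exists>y. computes f (i # xs) (Suc y)"
    by (rule computes_elims(7), blast)+
  have "\<not> n < z"
  proof
    assume "n < z"
    from lt[OF this] obtain y where "computes f (n # xs) (Suc y)" by blast
    from mu.IH(1)[OF this] show False by simp
  qed
  moreover have "\<not> z < n"
  proof
    assume "z < n"
    from mu.IH(2)[OF this] z show False by blast
  qed
  ultimately show ?case by simp
qed

text \<open>
  Matrices are coded together with their dimensions, so that all ranks can be read off from the
  code of the input, also when some of them are \<open>0\<close>.
\<close>

definition code_mat :: "int mat \<Rightarrow> nat" where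
  "code_mat A = list_encode [dim_row A, dim_col A,
     list_encode (map (list_encode \<circ> map int_encode) (mat_to_list A))]"

definition code_rat :: "rat \<Rightarrow> nat" where
  "code_rat a = prod_encode (map_prod int_encode int_encode (quotient_of a))"

definition code_mpoly :: "rat mpoly_list \<Rightarrow> nat" where
  "code_mpoly P = list_encode (map (\<lambda>(a, es). prod_encode (code_rat a, list_encode es)) P)"

fun code_qpoly :: "qpoly_table \<Rightarrow> nat" where
  "code_qpoly (N, tab) = prod_encode (N, list_encode
     (map (\<lambda>(zs, P). prod_encode (list_encode (map int_encode zs), code_mpoly P)) tab))"

definition code_input :: "int mat \<Rightarrow> int mat \<Rightarrow> int mat \<Rightarrow> int mat \<Rightarrow> nat" where
  "code_input p q r s = list_encode [code_mat p, code_mat q, code_mat r, code_mat s]"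

definition code_output :: "int mat list \<Rightarrow> (int mat \<times> qpoly_table) list \<Rightarrow> nat" where
  "code_output cones pieces = prod_encode (
     list_encode (map code_mat cones),
     list_encode (map (\<lambda>(A, qp). prod_encode (code_mat A, code_qpoly qp)) pieces))"

text \<open>
  \<open>cones\<close> lists all cones of \<open>F\<close>, each given by integral inequalities, and \<open>pieces\<close>
  lists the maximal cones of \<open>F\<close>, each with a quasi-polynomial agreeing with \<open>f\<close> on it.
\<close>

definition describes ::
    "nat \<Rightarrow> int mat list \<Rightarrow> (int mat \<times> qpoly_table) list \<Rightarrow>
     real vec set set \<Rightarrow> (int vec \<Rightarrow> nat) \<Rightarrow> bool" where
  "describes n cones pieces F f \<longleftrightarrow>
     (\<forall>A\<in>set cones. dim_col A = n) \<and>
     F = rational_cone ` set cones \<and>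
     (\<forall>(A, qp)\<in>set pieces. dim_col A = n \<and> fst qp > 0 \<and>
        (\<forall>y\<in>carrier_vec n. real_vec y \<in> rational_cone A \<longrightarrow> of_nat (f y) = qpoly_eval qp y)) \<and>
     maximal_cones F = rational_cone ` fst ` set pieces"

end

theory Submission
  imports Defs
begin

text \<open>
  Let \<open>D\<close> be the cone of all \<open>(x, \<lambda>, \<beta>)\<close> with \<open>r x \<ge> 0\<close>, \<open>p x \<le> s \<lambda>\<close>, \<open>q x = \<beta>\<close>.  The number
  of lattice points is obtained from the indicator function of \<open>D\<close> by summing over the coordinates
  of \<open>x\<close>, one at a time.  Fourier--Motzkin elimination describes the projections of \<open>D\<close>; the pairwise
  resultants of the linear forms involved cut the remaining space into cells on which the end points
  of all ranges of summation are ordered in the same way.  On each closed cell the count is a sum of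
  terms \<open>\<Sum>t\<in>(\<lfloor>a\<rfloor>, \<lfloor>b\<rfloor>]. g t\<close> with \<open>a\<close>, \<open>b\<close> linear, and taking differences along a sufficiently
  divisible lattice shows that summation preserves quasi-polynomials and raises the degree by one.
  The cells contained in the projection of \<open>D\<close> form the fan.

  All of this is computable: each cell is represented by a sample point found by going through the
  roots coordinate by coordinate, the sum makes sense at every lattice point and extrapolates the
  count from the cell, and a table of polynomials with this extrapolation is found by unbounded
  search, since agreement on a large enough box implies agreement everywhere.

  For the vector partition function, pointedness bounds \<open>x\<close> linearly by \<open>r x\<close>, so that \<open>x\<close> plus a
  multiple of the sum of the entries of \<open>r x\<close> is nonnegative on the cone.
\<close>

subsection \<open>Recursive functions\<close>

text \<open>The formula for a cell has to hold on the whole closed cell, also on faces where roots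
  collide. Two choices deal with this: the ranges of summation are half open and the sums oriented,
  so a range that degenerates contributes nothing; and all branching is decided by the sample point,
  so for a fixed sample the formula is a single function on the lattice. Boundedness of the chopped
  cones is used at \<lambda> = 0 and \<beta> = 0, where it says that the only solution is 0; hence
  the ranges of summation have ends on both sides. Samples can be taken integral because cells are
  cones: multiplying a point by the leading coefficients turns every root above it into an integer,
  and an extra factor 2 makes the roots even, which leaves an integer between distinct ones. The
  same factors make up the period. Polynomials appear as functions killed by differences, as this
  class is visibly closed under summation with variable ends. Coefficients are produced only at the
  end, by interpolation, and merely their existence matters: it guarantees that the search
  stops.\<close>

definition recursive :: "nat \<Rightarrow> (nat list \<Rightarrow> nat) \<Rightarrow> bool" where
  "recursive k f \<longleftrightarrow> (\<exists>t. \<forall>xs. length xs = k \<longrightarrow> computes t xs (f xs))"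

definition rec1 :: "(nat \<Rightarrow> nat) \<Rightarrow> bool" where
  "rec1 f \<longleftrightarrow> recursive 1 (\<lambda>xs. f (xs ! 0))"

definition rec2 :: "(nat \<Rightarrow> nat \<Rightarrow> nat) \<Rightarrow> bool" where
  "rec2 f \<longleftrightarrow> recursive 2 (\<lambda>xs. f (xs ! 0) (xs ! 1))"

definition rec3 :: "(nat \<Rightarrow> nat \<Rightarrow> nat \<Rightarrow> nat) \<Rightarrow> bool" where
  "rec3 f \<longleftrightarrow> recursive 3 (\<lambda>xs. f (xs ! 0) (xs ! 1) (xs ! 2))"

lemmas rec_defs = rec1_def rec2_def rec3_def recursive_def

lemma rec_proj: "i < k \<Longrightarrow> recursive k (\<lambda>xs. xs ! i)"
  unfolding rec_defs by (intro exI[of _ "Proj i"]) (auto intro: computes.proj)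

lemma rec_app1:
  assumes "rec1 f" "recursive k g"
  shows "recursive k (\<lambda>xs. f (g xs))"
proof -
  obtain t s where t: "\<And>xs. length xs = 1 \<Longrightarrow> computes t xs (f (xs ! 0))"
    and s: "\<And>xs. length xs = k \<Longrightarrow> computes s xs (g xs)"
    using assms unfolding rec_defs by auto
  show ?thesis unfolding rec_defs
  proof (intro exI[of _ "Comp t [s]"] allI impI)
    fix xs :: "nat list" assume "length xs = k"
    then have "list_all2 (\<lambda>g y. computes g xs y) [s] [g xs]" using s by simp
    moreover have "computes t [g xs] (f (g xs))" using t[of "[g xs]"] by simp
    ultimately show "computes (Comp t [s]) xs (f (g xs))" by (rule computes.comp)
  qed
qed

lemma rec_app2:
  assumes "rec2 f" "recursive k g" "recursive k h"
  shows "recursive k (\<lambda>xs. f (g xs) (h xs))"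
proof -
  obtain t s u where t: "\<And>xs. length xs = 2 \<Longrightarrow> computes t xs (f (xs ! 0) (xs ! 1))"
    and s: "\<And>xs. length xs = k \<Longrightarrow> computes s xs (g xs)"
    and u: "\<And>xs. length xs = k \<Longrightarrow> computes u xs (h xs)"
    using assms unfolding rec_defs by auto
  show ?thesis unfolding rec_defs
  proof (intro exI[of _ "Comp t [s, u]"] allI impI)
    fix xs :: "nat list" assume "length xs = k"
    then have "list_all2 (\<lambda>g y. computes g xs y) [s, u] [g xs, h xs]" using s u by simp
    moreover have "computes t [g xs, h xs] (f (g xs) (h xs))" using t[of "[g xs, h xs]"] by simp
    ultimately show "computes (Comp t [s, u]) xs (f (g xs) (h xs))" by (rule computes.comp)
  qed
qed

lemma rec_zero: "recursive k (\<lambda>xs. 0)"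
  unfolding rec_defs by (intro exI[of _ Zero]) (auto intro: computes.zero)

lemma rec1_Suc: "rec1 Suc"
  unfolding rec_defs
proof (intro exI[of _ Succ] allI impI)
  fix xs :: "nat list" assume "length xs = 1"
  then obtain x where "xs = [x]" by (auto simp: length_Suc_conv)
  then show "computes Succ xs (Suc (xs ! 0))" by (auto intro: computes.succ)
qed

lemmas rec_Suc = rec_app1[OF rec1_Suc]

lemma rec_const: "recursive k (\<lambda>xs. c)"
  by (induction c) (auto intro: rec_zero rec_Suc)

text \<open>A single parameter \<open>x\<close> is enough, since contexts with several variables are
  later packed into one number.\<close>

lemma rec2_prim:
  assumes "rec1 b" "rec3 s"
  shows "rec2 (\<lambda>n x. rec_nat (b x) (\<lambda>m y. s y m x) n)"
proof -
  obtain t u where t: "\<And>xs. length xs = 1 \<Longrightarrow> computes t xs (b (xs ! 0))"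
    and u: "\<And>xs. length xs = 3 \<Longrightarrow> computes u xs (s (xs ! 0) (xs ! 1) (xs ! 2))"
    using assms unfolding rec_defs by auto
  have *: "computes (PrimRec t u) [n, x] (rec_nat (b x) (\<lambda>m y. s y m x) n)" for n x
  proof (induction n)
    case 0
    then show ?case using t[of "[x]"] by (auto intro: computes.primrec_0)
  next
    case (Suc n)
    then show ?case using u[of "[rec_nat (b x) (\<lambda>m y. s y m x) n, n, x]"]
      by (auto intro: computes.primrec_Suc)
  qed
  show ?thesis unfolding rec_defs
  proof (intro exI[of _ "PrimRec t u"] allI impI)
    fix xs :: "nat list" assume "length xs = 2"
    then obtain n x where "xs = [n, x]" by (auto simp: length_Suc_conv numeral_2_eq_2)
    then show "computes (PrimRec t u) xs
        (rec_nat (b (xs ! 1)) (\<lambda>m y. s y m (xs ! 1)) (xs ! 0))" using * by simp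
  qed
qed

lemma computes_Mu:
  assumes t: "\<And>n. computes t [n, x] (f n)" and ex: "\<exists>n. f n = (0::nat)"
  shows "computes (Mu t) [x] (LEAST n. f n = 0)"
proof (rule computes.mu)
  show "computes t [LEAST n. f n = 0, x] 0"
    using t[of "LEAST n. f n = 0"] LeastI_ex[OF ex] by simp
next
  fix i assume "i < (LEAST n. f n = 0)"
  then have "f i \<noteq> 0" using not_less_Least by blast
  then obtain y where "f i = Suc y" using not0_implies_Suc by blast
  then show "\<exists>y. computes t [i, x] (Suc y)" using t[of i] by metis
qed

lemma rec1_mu:
  assumes "rec2 f" and ex: "\<And>x. \<exists>n. f n x = 0"
  shows "rec1 (\<lambda>x. LEAST n. f n x = 0)"
proof -
  obtain t where t: "\<And>xs. length xs = 2 \<Longrightarrow> computes t xs (f (xs ! 0) (xs ! 1))"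
    using assms unfolding rec_defs by auto
  show ?thesis unfolding rec_defs
  proof (intro exI[of _ "Mu t"] allI impI)
    fix xs :: "nat list" assume "length xs = 1"
    then obtain x where x: "xs = [x]" by (auto simp: length_Suc_conv)
    show "computes (Mu t) xs (LEAST n. f n (xs ! 0) = 0)"
      unfolding x using computes_Mu[of t x "\<lambda>n. f n x"] t[of "[_, x]"] ex[of x] by simp
  qed
qed

subsection \<open>Arithmetic\<close>

lemmas rec_unfold = rec1_def rec2_def rec3_def

lemma rec1_id: "rec1 (\<lambda>x. x)"
  unfolding rec1_def by (rule rec_proj) simp

lemma rec2_add: "rec2 (+)"
proof -
  have "rec2 (\<lambda>n x. rec_nat x (\<lambda>m y. Suc y) n)"
    by (rule rec2_prim[of "\<lambda>x. x" "\<lambda>y m x. Suc y"]; unfold rec_unfold; intro rec_Suc rec_proj; simp)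
  moreover have "(\<lambda>n x. rec_nat x (\<lambda>m y. Suc y) n) = (+)"
    by (intro ext, induct_tac n) auto
  ultimately show ?thesis by simp
qed

lemma rec1_pred: "rec1 (\<lambda>x. x - 1)"
proof -
  have "rec2 (\<lambda>n x. rec_nat 0 (\<lambda>m y. m) n)"
    by (rule rec2_prim[of "\<lambda>x. 0" "\<lambda>y m x. m"]; unfold rec_unfold; intro rec_zero rec_proj; simp)
  moreover have "(\<lambda>n x. rec_nat 0 (\<lambda>m y. m) n) = (\<lambda>n (x::nat). n - 1)"
    by (intro ext, induct_tac n) auto
  ultimately have "rec2 (\<lambda>n x. n - 1)" by simp
  from rec_app2[OF this, of 1 "\<lambda>xs. xs ! 0" "\<lambda>xs. xs ! 0"] show ?thesis
    unfolding rec1_def by (simp add: rec_proj)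
qed

lemma rec2_diff: "rec2 (-)"
proof -
  have "rec2 (\<lambda>n x. rec_nat x (\<lambda>m y. y - 1) n)"
    by (rule rec2_prim[of "\<lambda>x. x" "\<lambda>y m x. y - 1"]; unfold rec_unfold;
        intro rec_app1[OF rec1_pred] rec_proj; simp)
  moreover have "(\<lambda>n x. rec_nat x (\<lambda>m y. y - 1) n) = (\<lambda>n (x::nat). x - n)"
    by (intro ext, induct_tac n) auto
  ultimately have "rec2 (\<lambda>n x. x - n)" by simp
  from rec_app2[OF this, of 2 "\<lambda>xs. xs ! 1" "\<lambda>xs. xs ! 0"] show ?thesis
    unfolding rec2_def by (simp add: rec_proj)
qed

lemma rec2_mult: "rec2 (*)"
proof -
  have "rec2 (\<lambda>n x. rec_nat 0 (\<lambda>m y. y + x) n)"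
    by (rule rec2_prim[of "\<lambda>x. 0" "\<lambda>y m x. y + x"]; unfold rec_unfold;
        intro rec_app2[OF rec2_add] rec_zero rec_proj; simp)
  moreover have "(\<lambda>n x. rec_nat 0 (\<lambda>m y. y + x) n) = (\<lambda>n x. n * x)"
    by (intro ext, induct_tac n) auto
  ultimately show ?thesis by simp
qed

lemma rec1_triangle: "rec1 triangle"
proof -
  have "rec2 (\<lambda>n x. rec_nat 0 (\<lambda>m y. y + Suc m) n)"
    by (rule rec2_prim[of "\<lambda>x. 0" "\<lambda>y m x. y + Suc m"]; unfold rec_unfold;
        intro rec_app2[OF rec2_add] rec_Suc rec_zero rec_proj; simp)
  moreover have "(\<lambda>n x. rec_nat 0 (\<lambda>m y. y + Suc m) n) = (\<lambda>n (x::nat). triangle n)"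
    by (intro ext, induct_tac n) auto
  ultimately have "rec2 (\<lambda>n x. triangle n)" by simp
  from rec_app2[OF this, of 1 "\<lambda>xs. xs ! 0" "\<lambda>xs. xs ! 0"] show ?thesis
    unfolding rec1_def by (simp add: rec_proj)
qed

lemma rec2_prod_encode: "rec2 (\<lambda>m n. prod_encode (m, n))"
  unfolding prod_encode_def prod.case rec2_def
  by (intro rec_app2[OF rec2_add] rec_app1[OF rec1_triangle] rec_proj; simp)

lemma triangle_mono: "m \<le> n \<Longrightarrow> triangle m \<le> triangle n"
  by (induction n) (auto simp: le_Suc_eq)

text \<open>The least \<open>s\<close> with \<open>x < triangle (Suc s)\<close> is the index
  \<open>m + n\<close> of the diagonal of the Cantor pairing on which \<open>x\<close> lies. The
  comparison is written with truncated subtraction because minimisation looks for a zero.\<close>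

lemma prod_decode_eq:
  "prod_decode x = (x - triangle (LEAST s. Suc x - triangle (Suc s) = 0),
     (LEAST s. Suc x - triangle (Suc s) = 0) - (x - triangle (LEAST s. Suc x - triangle (Suc s) = 0)))"
proof -
  obtain m n where mn: "prod_decode x = (m, n)" by fastforce
  then have x: "x = triangle (m + n) + m"
    using prod_decode_inverse[of x] by (simp add: prod_encode_def)
  have *: "(LEAST s. Suc x - triangle (Suc s) = 0) = m + n"
  proof (rule Least_equality)
    fix s assume "Suc x - triangle (Suc s) = 0"
    then have "triangle (m + n) < triangle (Suc s)" using x by linarith
    then have "m + n < Suc s" using triangle_mono[of "Suc s" "m + n"] by (meson leD le_less_linear)
    then show "m + n \<le> s" by simp
  qed (simp add: x)
  show ?thesis unfolding * mn using x by simp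
qed

lemma rec1_prod_decode: "rec1 (\<lambda>x. fst (prod_decode x))" "rec1 (\<lambda>x. snd (prod_decode x))"
proof -
  have S: "rec1 (\<lambda>x. LEAST s. Suc x - triangle (Suc s) = 0)"
  proof (rule rec1_mu)
    show "rec2 (\<lambda>n x. Suc x - triangle (Suc n))" unfolding rec2_def
      by (intro rec_app2[OF rec2_diff] rec_app1[OF rec1_triangle] rec_Suc rec_proj; simp)
    show "\<exists>n. Suc x - triangle (Suc n) = 0" for x by (rule exI[of _ x]) simp
  qed
  note I = rec_app2[OF rec2_diff] rec_app1[OF rec1_triangle] rec_app1[OF S] rec_proj
  show "rec1 (\<lambda>x. fst (prod_decode x))" "rec1 (\<lambda>x. snd (prod_decode x))"
    unfolding prod_decode_eq fst_conv snd_conv rec1_def by (intro I; simp)+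
qed

lemma rec1_app1: "rec1 f \<Longrightarrow> rec1 g \<Longrightarrow> rec1 (\<lambda>x. f (g x))"
  unfolding rec1_def[of g] rec1_def[of "\<lambda>x. f (g x)"] by (rule rec_app1)

lemma rec1_app2: "rec2 f \<Longrightarrow> rec1 g \<Longrightarrow> rec1 h \<Longrightarrow> rec1 (\<lambda>x. f (g x) (h x))"
  unfolding rec1_def by (rule rec_app2)

lemma rec1_const: "rec1 (\<lambda>x. c)"
  unfolding rec1_def by (rule rec_const)

subsection \<open>Computable functions on coded types\<close>

text \<open>Bijectivity, not just injectivity: every number is a code, so a computable function is
  the plain conjugate of a function on numbers, no validity test is ever needed, and search over the
  numbers is search over the type.\<close>

class coded =
  fixes enc :: "'a \<Rightarrow> nat"
  assumes bij_enc: "bij enc"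

definition dec :: "nat \<Rightarrow> 'a::coded" where
  "dec = inv_into UNIV enc"

lemma dec_enc [simp]: "dec (enc x) = x"
  unfolding dec_def by (simp add: bij_enc bij_is_inj)

lemma enc_dec [simp]: "enc (dec n :: 'a::coded) = n"
  unfolding dec_def by (simp add: bij_enc bij_is_surj surj_f_inv_f)

lemma enc_inject [simp]: "enc x = enc y \<longleftrightarrow> x = y"
  using inj_eq[OF bij_is_inj[OF bij_enc]] .

lemma bij_encI: "(\<And>x. g (f x) = x) \<Longrightarrow> (\<And>n. f (g n) = n) \<Longrightarrow> bij f"
  by (rule o_bij[of g]) auto

instantiation nat :: coded
begin
definition enc_nat :: "nat \<Rightarrow> nat" where "enc_nat x = x"
instance by standard (auto simp: enc_nat_def intro!: bij_encI)
end

instantiation int :: coded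
begin
definition enc_int :: "int \<Rightarrow> nat" where "enc_int = int_encode"
instance by standard (simp add: enc_int_def bij_int_encode)
end

instantiation prod :: (coded, coded) coded
begin
definition enc_prod :: "'a \<times> 'b \<Rightarrow> nat" where
  "enc_prod p = prod_encode (enc (fst p), enc (snd p))"
instance
  by standard (rule bij_encI[of "\<lambda>n. map_prod dec dec (prod_decode n)"], auto simp: enc_prod_def)
end

instantiation list :: (coded) coded
begin
definition enc_list :: "'a list \<Rightarrow> nat" where
  "enc_list xs = list_encode (map enc xs)"
instance
  by standard (rule bij_encI[of "\<lambda>n. map dec (list_decode n)"], auto simp: enc_list_def o_def)
end

lemma enc_Pair: "enc (a, b) = prod_encode (enc a, enc b)"
  by (simp add: enc_prod_def)

lemma enc_Nil: "enc [] = 0"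
  by (simp add: enc_list_def)

lemma enc_Cons: "enc (x # xs) = Suc (prod_encode (enc x, enc xs))"
  by (simp add: enc_list_def)

lemma dec_nat: "(dec :: nat \<Rightarrow> nat) = (\<lambda>n. n)"
  using dec_enc[where 'a = nat] by (simp add: enc_nat_def fun_eq_iff)

lemma dec_prod: "dec n = (dec (fst (prod_decode n)), dec (snd (prod_decode n)))"
proof -
  have "enc (dec n :: 'a \<times> 'b) = enc (dec (fst (prod_decode n)) :: 'a, dec (snd (prod_decode n)) :: 'b)"
    by (simp add: enc_Pair)
  then show ?thesis by (simp only: enc_inject)
qed

definition cmp :: "('a::coded \<Rightarrow> 'b::coded) \<Rightarrow> bool" where
  "cmp f \<longleftrightarrow> rec1 (\<lambda>n. enc (f (dec n)))"

definition cmpp :: "('a::coded \<Rightarrow> bool) \<Rightarrow> bool" where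
  "cmpp P \<longleftrightarrow> cmp (\<lambda>x. if P x then 1 else (0::nat))"

named_theorems cmpI

lemma cmp_app: "cmp f \<Longrightarrow> cmp g \<Longrightarrow> cmp (\<lambda>x. f (g x))"
  unfolding cmp_def using rec1_app1[of "\<lambda>n. enc (f (dec n))" "\<lambda>n. enc (g (dec n))"] by simp

lemma cmp_id [cmpI]: "cmp (\<lambda>x. x)"
  unfolding cmp_def by (simp add: rec1_id)

lemma cmp_const [cmpI]: "cmp (\<lambda>x. c)"
  unfolding cmp_def by (rule rec1_const)

lemma cmp_Pair [cmpI]: "cmp f \<Longrightarrow> cmp g \<Longrightarrow> cmp (\<lambda>x. (f x, g x))"
  unfolding cmp_def enc_Pair by (rule rec1_app2[OF rec2_prod_encode])

lemma cmp_fst [cmpI]: "cmp f \<Longrightarrow> cmp (\<lambda>x. fst (f x))"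
  by (rule cmp_app[of fst]) (simp_all add: cmp_def dec_prod rec1_prod_decode)

lemma cmp_snd [cmpI]: "cmp f \<Longrightarrow> cmp (\<lambda>x. snd (f x))"
  by (rule cmp_app[of snd]) (simp_all add: cmp_def dec_prod rec1_prod_decode)

text \<open>Bound variables are handled by pairing: under a binder the context \<open>x\<close> is
  extended by the bound values, and the body has to be computable as a function of the resulting
  tuple. The rules for \<open>let\<close>, iteration, folds and maps have the same shape, so that
  \<open>intro cmpI\<close> can work through nested binders.\<close>

lemma cmp_case_prod [cmpI]:
  assumes "cmp (\<lambda>p. h (fst p) (fst (snd p)) (snd (snd p)))" "cmp g"
  shows "cmp (\<lambda>x. case g x of (a, b) \<Rightarrow> h x a b)"
  using cmp_app[OF assms(1) cmp_Pair[OF cmp_id assms(2)]] by (simp add: case_prod_beta)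

lemma cmp_let [cmpI]:
  assumes "cmp (\<lambda>p. h (fst p) (snd p))" "cmp g"
  shows "cmp (\<lambda>x. let a = g x in h x a)"
  using cmp_app[OF assms(1) cmp_Pair[OF cmp_id assms(2)]] by simp

lemma cmp_nat2:
  assumes "rec2 f" "cmp g" "cmp h"
  shows "cmp (\<lambda>x. f (g x) (h x))"
  using assms(2,3) unfolding cmp_def enc_nat_def by (rule rec1_app2[OF assms(1)])

lemmas cmp_nat_arith [cmpI] =
  cmp_nat2[OF rec2_add] cmp_nat2[OF rec2_diff] cmp_nat2[OF rec2_mult]

lemma cmp_Suc [cmpI]: "cmp f \<Longrightarrow> cmp (\<lambda>x. Suc (f x))"
  unfolding cmp_def enc_nat_def by (rule rec1_app1[OF rec1_Suc])

lemma cmp_enc [cmpI]: "cmp f \<Longrightarrow> cmp (\<lambda>x. enc (f x))"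
  unfolding cmp_def enc_nat_def .

lemma cmp_dec [cmpI]: "cmp f \<Longrightarrow> cmp (\<lambda>x. dec (f x))"
  unfolding cmp_def enc_nat_def enc_dec .

lemma cmp_of_enc: "cmp (\<lambda>x. enc (f x)) \<Longrightarrow> cmp f"
  unfolding cmp_def enc_nat_def .

text \<open>Together with minimisation, iteration carries all later recursions: folds, list
  operations, the passage from level to level. The context enters the primitive recursion as the
  parameter \<open>z\<close>.\<close>

lemma cmp_funpow [cmpI]:
  fixes h :: "'a::coded \<Rightarrow> 'b::coded \<Rightarrow> 'b"
  assumes h: "cmp (\<lambda>p. h (fst p) (snd p))" and n: "cmp n" and g: "cmp g"
  shows "cmp (\<lambda>x. (h x ^^ n x) (g x))"
proof -
  define H where "H z = enc (h (dec (fst (prod_decode z))) (dec (snd (prod_decode z))))" for z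
  have H: "rec1 H" using h unfolding cmp_def H_def dec_prod fst_conv snd_conv .
  have g': "rec1 (\<lambda>z. enc (g (dec z)))" using g unfolding cmp_def .
  have "rec2 (\<lambda>k z. rec_nat (enc (g (dec z))) (\<lambda>m y. H (prod_encode (z, y))) k)"
    by (rule rec2_prim[OF g'], unfold rec3_def, intro rec_app1[OF H] rec_app2[OF rec2_prod_encode] rec_proj; simp)
  moreover have "rec_nat (enc (g (dec z))) (\<lambda>m y. H (prod_encode (z, y))) k =
      enc ((h (dec z) ^^ k) (g (dec z)))" for k z
    by (induction k) (auto simp: H_def)
  ultimately have R: "rec2 (\<lambda>k z. enc ((h (dec z) ^^ k) (g (dec z))))" by simp
  have n': "rec1 (\<lambda>z. n (dec z))" using n unfolding cmp_def enc_nat_def .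
  show ?thesis unfolding cmp_def by (rule rec1_app2[OF R n' rec1_id])
qed

text \<open>A conditional is an iteration performed once or not at all: it starts from the second
  branch, and a single step replaces this by the first.\<close>

lemma cmp_if [cmpI]:
  assumes "cmpp P" "cmp f" "cmp g"
  shows "cmp (\<lambda>x. if P x then f x else g x)"
proof -
  have "(\<lambda>x. if P x then f x else g x) =
      (\<lambda>x. ((\<lambda>_. f x) ^^ (if P x then 1 else 0)) (g x))" by auto
  moreover have "cmp \<dots>"
    using cmp_funpow[OF cmp_app[OF assms(2) cmp_fst[OF cmp_id]] assms(1)[unfolded cmpp_def] assms(3)] .
  ultimately show ?thesis by simp
qed

lemma cmpp_le [cmpI]:
  assumes "cmp f" "cmp g"
  shows "cmpp (\<lambda>x. f x \<le> (g x :: nat))"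
proof -
  have "(\<lambda>x. if f x \<le> g x then 1 else 0) = (\<lambda>x. 1 - (f x - g x))" by auto
  then show ?thesis unfolding cmpp_def by (simp, intro cmpI assms)
qed

lemma if_distrib_not: "(if \<not> b then x else y) = (if b then y else x)"
  by simp

lemma cmpp_not [cmpI]: "cmpp P \<Longrightarrow> cmpp (\<lambda>x. \<not> P x)"
  unfolding cmpp_def[of "\<lambda>x. \<not> P x"] if_distrib_not by (intro cmpI)

lemma cmpp_conj [cmpI]: "cmpp P \<Longrightarrow> cmpp Q \<Longrightarrow> cmpp (\<lambda>x. P x \<and> Q x)"
proof -
  assume "cmpp P" "cmpp Q"
  then have "cmp (\<lambda>x. if P x then (if Q x then 1 else 0::nat) else 0)" by (intro cmpI)
  moreover have "(\<lambda>x. if P x then (if Q x then 1 else 0::nat) else 0) =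
      (\<lambda>x. if P x \<and> Q x then 1 else 0)" by auto
  ultimately show ?thesis unfolding cmpp_def by simp
qed

lemma cmpp_disj [cmpI]:
  assumes "cmpp P" "cmpp Q"
  shows "cmpp (\<lambda>x. P x \<or> Q x)"
proof -
  have "cmpp (\<lambda>x. \<not> (\<not> P x \<and> \<not> Q x))" by (intro cmpp_not cmpp_conj assms)
  then show ?thesis by simp
qed

lemma cmpp_imp [cmpI]: "cmpp P \<Longrightarrow> cmpp Q \<Longrightarrow> cmpp (\<lambda>x. P x \<longrightarrow> Q x)"
  unfolding imp_conv_disj by (intro cmpp_disj cmpp_not)

lemma cmpp_app: "cmpp P \<Longrightarrow> cmp g \<Longrightarrow> cmpp (\<lambda>x. P (g x))"
  unfolding cmpp_def using cmp_app[of "\<lambda>x. if P x then 1 else (0::nat)" g] by simp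

lemma cmpp_eq [cmpI]:
  assumes "cmp f" "cmp g"
  shows "cmpp (\<lambda>x. f x = g x)"
proof -
  have "cmpp (\<lambda>x. enc (f x) \<le> enc (g x) \<and> enc (g x) \<le> enc (f x))"
    using assms by (intro cmpI)
  moreover have "(enc (f x) \<le> enc (g x) \<and> enc (g x) \<le> enc (f x)) = (f x = g x)" for x
    using enc_inject[of "f x" "g x"] by linarith
  ultimately show ?thesis by simp
qed

lemma cmpp_less [cmpI]: "cmp f \<Longrightarrow> cmp g \<Longrightarrow> cmpp (\<lambda>x. f x < (g x :: nat))"
  unfolding less_eq_Suc_le by (intro cmpI)

lemma cmpp_case_prod [cmpI]:
  assumes "cmpp (\<lambda>p. h (fst p) (fst (snd p)) (snd (snd p)))" "cmp g"
  shows "cmpp (\<lambda>x. case g x of (a, b) \<Rightarrow> h x a b)"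
  using cmpp_app[OF assms(1) cmp_Pair[OF cmp_id assms(2)]] by (simp add: case_prod_beta)

lemma cmpp_let [cmpI]:
  assumes "cmpp (\<lambda>p. h (fst p) (snd p))" "cmp g"
  shows "cmpp (\<lambda>x. let a = g x in h x a)"
  using cmpp_app[OF assms(1) cmp_Pair[OF cmp_id assms(2)]] by simp

lemma rec2_search:
  assumes "cmpp (\<lambda>p. P (fst p) (snd p :: nat))"
  shows "rec2 (\<lambda>n x. if P (dec x) n then 0 else 1)"
proof -
  have "cmp (\<lambda>p. if P (fst p) (snd p) then 0 else (1::nat))"
    by (intro cmp_if assms cmp_const)
  then have *: "rec1 (\<lambda>z. if P (dec (fst (prod_decode z))) (snd (prod_decode z)) then 0 else 1)"
    unfolding cmp_def enc_nat_def dec_prod dec_nat fst_conv snd_conv .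
  have "recursive 2 (\<lambda>xs. prod_encode (xs ! 1, xs ! 0))"
    by (intro rec_app2[OF rec2_prod_encode] rec_proj) auto
  from rec_app1[OF * this] show ?thesis unfolding rec2_def by simp
qed

lemma cmp_Least:
  assumes "cmpp (\<lambda>p. P (fst p) (snd p :: nat))" and ex: "\<And>x. \<exists>n. P x n"
  shows "cmp (\<lambda>x. LEAST n. P x n)"
proof -
  have *: "(if b then 0 else 1::nat) = 0 \<longleftrightarrow> b" for b by simp
  have "rec1 (\<lambda>x. LEAST n. (if P (dec x) n then 0 else 1::nat) = 0)"
    by (rule rec1_mu[OF rec2_search[OF assms(1)]]) (simp add: ex)
  then show ?thesis unfolding cmp_def enc_nat_def * .
qed

text \<open>Unlike in the previous lemma, the search is allowed to diverge on some arguments.\<close>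

lemma computes_search:
  assumes P: "cmpp (\<lambda>p. P (fst p) (snd p))" and g: "cmp (\<lambda>p. g (fst p) (snd p))"
  shows "\<exists>t. \<forall>x. (\<exists>y. P x y) \<longrightarrow> (\<exists>y. P x y \<and> computes t [enc x] (enc (g x y)))"
proof -
  have P': "cmpp (\<lambda>p. P (fst p) (dec (snd p)))"
    using cmpp_app[OF P cmp_Pair[OF cmp_fst[OF cmp_id] cmp_dec[OF cmp_snd[OF cmp_id]]]] by simp
  obtain t where t: "\<And>xs. length xs = 2 \<Longrightarrow> computes t xs
      (if P (dec (xs ! 1)) (dec (xs ! 0)) then 0 else 1)"
    using rec2_search[OF P'] unfolding rec_defs by auto
  obtain u where u: "\<And>xs. length xs = 1 \<Longrightarrow> computes u xs
      (enc (g (dec (fst (prod_decode (xs ! 0)))) (dec (snd (prod_decode (xs ! 0))))))"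
    using g unfolding cmp_def rec1_def recursive_def dec_prod fst_conv snd_conv by auto
  obtain v where v: "\<And>xs. length xs = 2 \<Longrightarrow> computes v xs (prod_encode (xs ! 0, xs ! 1))"
    using rec2_prod_encode unfolding rec_defs by auto
  show ?thesis
  proof (intro exI[of _ "Comp u [Comp v [Proj 0, Mu t]]"] allI impI)
    fix x assume ex: "\<exists>y. P x y"
    \<comment> \<open>\<open>Mu\<close> returns the least number that decodes to a witness; as every
      element has a code, such a number exists whenever a witness does.\<close>
    define y where "y = (LEAST n. P x (dec n))"
    have *: "(if b then 0 else 1::nat) = 0 \<longleftrightarrow> b" for b by simp
    from ex have ex': "\<exists>n. P x (dec n)" by (metis dec_enc)
    then have "P x (dec y)" unfolding y_def by (rule LeastI_ex)
    moreover have mu: "computes (Mu t) [enc x] y"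
      using computes_Mu[of t "enc x" "\<lambda>n. if P x (dec n) then 0 else 1"] t[of "[_, enc x]"] ex'
      unfolding * y_def by simp
    have "computes (Comp v [Proj 0, Mu t]) [enc x] (prod_encode (enc x, y))"
      by (rule computes.comp[where ys = "[enc x, y]"])
        (use mu v[of "[enc x, y]"] computes.proj[of 0 "[enc x]"] in auto)
    then have "computes (Comp u [Comp v [Proj 0, Mu t]]) [enc x] (enc (g x (dec y)))"
      by (intro computes.comp[where ys = "[prod_encode (enc x, y)]"])
        (use u[of "[prod_encode (enc x, y)]"] in auto)
    ultimately show "\<exists>y. P x y \<and> computes (Comp u [Comp v [Proj 0, Mu t]]) [enc x] (enc (g x y))"
      by blast
  qed
qed

lemma cmp_nat_div [cmpI]:
  assumes "cmp f" "cmp g"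
  shows "cmp (\<lambda>x. f x div g x :: nat)"
proof -
  \<comment> \<open>The disjunct \<open>g x = 0\<close> stops the search at \<open>0\<close>, in
    accordance with division by zero being \<open>0\<close>.\<close>
  have "cmp (\<lambda>x. LEAST q. g x = 0 \<or> f x < g x * Suc q)"
  proof (rule cmp_Least)
    show "cmpp (\<lambda>p. g (fst p) = 0 \<or> f (fst p) < g (fst p) * Suc (snd p))"
      by (intro cmpI cmp_app[OF assms(1)] cmp_app[OF assms(2)])
    show "\<exists>q. g x = 0 \<or> f x < g x * Suc q" for x
      by (rule exI[of _ "f x"]) (cases "g x", auto)
  qed
  moreover have "(LEAST q. m = 0 \<or> n < m * Suc q) = n div m" for m n :: nat
  proof (cases "m = 0")
    case True
    then show ?thesis by (simp add: Least_eq_0)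
  next
    case False
    show ?thesis
    proof (rule Least_equality)
      show "m = 0 \<or> n < m * Suc (n div m)" using False
        by (metis dividend_less_times_div neq0_conv mult_Suc_right)
      fix q assume "m = 0 \<or> n < m * Suc q"
      then show "n div m \<le> q" using False
        by (metis less_Suc_eq_le less_mult_imp_div_less mult.commute)
    qed
  qed
  ultimately show ?thesis by simp
qed

section \<open>Integer arithmetic on codes\<close>

lemma cmp_int [cmpI]: "cmp f \<Longrightarrow> cmp (\<lambda>x. int (f x))"
  by (rule cmp_of_enc) (simp add: enc_int_def int_encode_def sum_encode_def, intro cmpI)

lemma enc_int_eq: "enc i = (if 0 \<le> i then 2 * nat i else 2 * nat (- i - 1) + 1)"
  by (simp add: enc_int_def int_encode_def sum_encode_def)

text \<open>Even codes belong to the nonnegative integers, odd codes to the negative ones, and for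
  \<open>i > 0\<close> the numbers \<open>i\<close> and \<open>- i\<close> have the adjacent codes
  \<open>2 * i\<close> and \<open>2 * i - 1\<close>.\<close>

lemma cmp_uminus [cmpI]:
  assumes "cmp f"
  shows "cmp (\<lambda>x. - f x :: int)"
proof (rule cmp_of_enc)
  have "enc (- i) = (if enc i = 0 then 0 else if 2 * (enc i div 2) = enc i then enc i - 1
      else Suc (enc i))" for i :: int
    unfolding enc_int_eq by (auto; presburger)
  then show "cmp (\<lambda>x. enc (- f x))" by (simp only:) (intro cmpI assms)
qed

lemma cmp_nat [cmpI]:
  assumes "cmp f"
  shows "cmp (\<lambda>x. nat (f x))"
proof -
  have "nat i = (if 2 * (enc i div 2) = enc i then enc i div 2 else 0)" for i
    unfolding enc_int_eq by (auto; presburger)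
  then show ?thesis by (simp only:) (intro cmpI assms)
qed

lemma cmpp_int_nonneg [cmpI]:
  assumes "cmp f"
  shows "cmpp (\<lambda>x. 0 \<le> (f x :: int))"
proof -
  have "0 \<le> i \<longleftrightarrow> int (nat i) = i" for i by auto
  then show ?thesis by (simp only:) (intro cmpI assms)
qed

lemma cmp_int_diff_nat:
  assumes "cmp f" "cmp g"
  shows "cmp (\<lambda>x. int (f x) - int (g x))"
proof -
  have "int a - int b = (if b \<le> a then int (a - b) else - int (b - a))" for a b by auto
  then show ?thesis by (simp only:) (intro cmpI assms)
qed

lemma cmp_int_add [cmpI]:
  assumes "cmp f" "cmp g"
  shows "cmp (\<lambda>x. f x + g x :: int)"
proof -
  have "i + j = int (nat i + nat j) - int (nat (- i) + nat (- j))" for i j :: int by auto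
  then show ?thesis by (simp only:) (intro cmp_int_diff_nat cmpI assms)
qed

lemma cmp_int_diff [cmpI]: "cmp f \<Longrightarrow> cmp g \<Longrightarrow> cmp (\<lambda>x. f x - g x :: int)"
  unfolding diff_conv_add_uminus by (intro cmpI)

lemma cmp_int_mult [cmpI]:
  assumes "cmp f" "cmp g"
  shows "cmp (\<lambda>x. f x * g x :: int)"
proof -
  have *: "i * j = int (nat i * nat j + nat (- i) * nat (- j)) -
      int (nat i * nat (- j) + nat (- i) * nat j)" for i j :: int
    by (cases "0 \<le> i"; cases "0 \<le> j") (auto simp: nat_mult_distrib)
  show ?thesis by (subst *) (intro cmp_int_diff_nat cmpI assms)
qed

lemma cmpp_int_le [cmpI]: "cmp f \<Longrightarrow> cmp g \<Longrightarrow> cmpp (\<lambda>x. f x \<le> (g x :: int))"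
  using cmpp_int_nonneg[OF cmp_int_diff, of g f] by simp

lemma cmpp_int_less [cmpI]: "cmp f \<Longrightarrow> cmp g \<Longrightarrow> cmpp (\<lambda>x. f x < (g x :: int))"
  unfolding not_le[symmetric] by (intro cmpI)

lemma cmp_abs [cmpI]: "cmp f \<Longrightarrow> cmp (\<lambda>x. \<bar>f x :: int\<bar>)"
  unfolding abs_if by (intro cmpI)

lemma cmp_int_div [cmpI]:
  assumes "cmp f" "cmp g"
  shows "cmp (\<lambda>x. f x div g x :: int)"
proof -
  \<comment> \<open>Adding the multiple \<open>\<bar>i\<bar> * j\<close> of the divisor makes the
    dividend nonnegative and raises the quotient by \<open>\<bar>i\<bar>\<close>, which leaves a
    division of natural numbers.\<close>
  have pos: "i div j = int (nat (i + \<bar>i\<bar> * j) div nat j) - \<bar>i\<bar>" if "0 < j" for i j :: int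
  proof -
    have "\<bar>i\<bar> * 1 \<le> \<bar>i\<bar> * j" using that by (intro mult_left_mono) auto
    then have "0 \<le> i + \<bar>i\<bar> * j" by linarith
    then have "int (nat (i + \<bar>i\<bar> * j) div nat j) = (i + \<bar>i\<bar> * j) div j"
      using that by (simp add: zdiv_int)
    also have "\<dots> = i div j + \<bar>i\<bar>" using that by simp
    finally show ?thesis by simp
  qed
  have *: "i div j = (if 0 < j then int (nat (i + \<bar>i\<bar> * j) div nat j) - \<bar>i\<bar> else if j = 0 then 0
      else int (nat (- i + \<bar>- i\<bar> * (- j)) div nat (- j)) - \<bar>- i\<bar>)" for i j :: int
    using pos[of j i] pos[of "- j" "- i"] by (cases j "0 :: int" rule: linorder_cases) simp_all
  show ?thesis by (subst *) (intro cmpI assms)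
qed

lemma cmp_int_mod [cmpI]: "cmp f \<Longrightarrow> cmp g \<Longrightarrow> cmp (\<lambda>x. f x mod g x :: int)"
  unfolding minus_mult_div_eq_mod[symmetric] by (intro cmpI)

lemma cmpp_int_dvd [cmpI]: "cmp f \<Longrightarrow> cmp g \<Longrightarrow> cmpp (\<lambda>x. f x dvd (g x :: int))"
  unfolding dvd_eq_mod_eq_0 by (intro cmpI)

lemma cmp_int_power [cmpI]:
  assumes "cmp f" "cmp g"
  shows "cmp (\<lambda>x. (f x :: int) ^ g x)"
proof -
  have *: "i ^ n = (((\<lambda>k. i * k) ^^ n) 1)" for i :: int and n by (induction n) auto
  show ?thesis by (subst *) (intro cmpI assms cmp_app[OF assms(1)])
qed

subsection \<open>Lists\<close>

text \<open>With the default \<open>dec 0\<close>, the code of the head is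
  \<open>fst (prod_decode (enc xs - 1))\<close> for the empty list too, as
  \<open>prod_decode 0 = (0, 0)\<close>.\<close>

definition hdd :: "'a::coded list \<Rightarrow> 'a" where
  "hdd xs = (case xs of [] \<Rightarrow> dec 0 | x # _ \<Rightarrow> x)"

lemma hdd_Cons [simp]: "hdd (x # xs) = x"
  by (simp add: hdd_def)

lemma prod_decode_0: "prod_decode 0 = (0, 0)"
  using prod_encode_inverse[of "(0, 0)"] by (simp add: prod_encode_def)

lemma enc_hdd: "enc (hdd xs) = fst (prod_decode (enc xs - 1))"
  by (cases xs) (simp_all add: enc_Nil enc_Cons hdd_def prod_decode_0)

lemma enc_tl: "enc (tl xs) = snd (prod_decode (enc xs - 1))"
  by (cases xs) (simp_all add: enc_Nil enc_Cons prod_decode_0)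

lemma cmp_hdd [cmpI]: "cmp f \<Longrightarrow> cmp (\<lambda>x. hdd (f x))"
  unfolding cmp_def enc_hdd
  using rec1_app1[OF rec1_prod_decode(1) rec1_app1[OF rec1_pred]] by blast

lemma cmp_tl [cmpI]: "cmp f \<Longrightarrow> cmp (\<lambda>x. tl (f x))"
  unfolding cmp_def enc_tl
  using rec1_app1[OF rec1_prod_decode(2) rec1_app1[OF rec1_pred]] by blast

lemma cmp_Cons [cmpI]: "cmp f \<Longrightarrow> cmp g \<Longrightarrow> cmp (\<lambda>x. f x # g x)"
  unfolding cmp_def enc_Cons
  by (intro rec1_app1[OF rec1_Suc] rec1_app2[OF rec2_prod_encode])

lemma cmp_case_list [cmpI]:
  assumes "cmp (\<lambda>p. h (fst p) (fst (snd p)) (snd (snd p)))" "cmp f" "cmp g"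
  shows "cmp (\<lambda>x. case g x of [] \<Rightarrow> f x | a # as \<Rightarrow> h x a as)"
proof -
  have *: "(\<lambda>x. case g x of [] \<Rightarrow> f x | a # as \<Rightarrow> h x a as) =
      (\<lambda>x. if g x = [] then f x else h x (hdd (g x)) (tl (g x)))"
    by (auto split: list.split)
  have "cmp (\<lambda>x. h x (hdd (g x)) (tl (g x)))"
    using cmp_app[OF assms(1) cmp_Pair[OF cmp_id cmp_Pair[OF cmp_hdd[OF assms(3)] cmp_tl[OF assms(3)]]]]
    by simp
  with * show ?thesis by (simp only:) (intro cmpI assms)
qed

lemma length_le_list_encode: "length xs \<le> list_encode xs"
proof (induction xs)
  case (Cons x xs)
  then show ?case using le_prod_encode_2[of "list_encode xs" x] by simp
qed simp

lemma length_le_enc: "length xs \<le> enc xs"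
  using length_le_list_encode[of "map enc xs"] by (simp add: enc_list_def)

text \<open>A fold becomes an iteration on pairs of remaining list and state. Steps after the list
  is exhausted change nothing, so any bound on the length may serve as number of steps; the code of
  the list is such a bound.\<close>

lemma fold_funpow:
  assumes "length xs \<le> n"
  shows "((\<lambda>(l, s). if l = [] then (l, s) else (tl l, h (hdd l) s)) ^^ n) (xs, s) = ([], fold h xs s)"
  using assms
proof (induction n arbitrary: xs s)
  case (Suc n)
  then show ?case by (cases xs) (auto simp: funpow_swap1[symmetric] funpow_Suc_right simp del: funpow.simps)
qed simp

lemma cmp_app2:
  "cmp (\<lambda>p. h (fst p) (snd p)) \<Longrightarrow> cmp a \<Longrightarrow> cmp b \<Longrightarrow> cmp (\<lambda>x. h (a x) (b x))"
  using cmp_app[of "\<lambda>p. h (fst p) (snd p)" "\<lambda>x. (a x, b x)"] cmp_Pair[of a b] by simp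

lemma cmp_app3:
  "cmp (\<lambda>p. h (fst p) (fst (snd p)) (snd (snd p))) \<Longrightarrow> cmp a \<Longrightarrow> cmp b \<Longrightarrow> cmp c \<Longrightarrow>
    cmp (\<lambda>x. h (a x) (b x) (c x))"
  using cmp_app[of "\<lambda>p. h (fst p) (fst (snd p)) (snd (snd p))" "\<lambda>x. (a x, b x, c x)"]
    cmp_Pair[OF _ cmp_Pair, of a b c] by simp

lemma cmp_fold [cmpI]:
  assumes h: "cmp (\<lambda>p. h (fst p) (fst (snd p)) (snd (snd p)))" and "cmp l" "cmp g"
  shows "cmp (\<lambda>x. fold (h x) (l x) (g x))"
proof -
  have "cmp (\<lambda>x. snd (((\<lambda>(l, s). if l = [] then (l, s) else (tl l, h x (hdd l) s)) ^^ enc (l x)) (l x, g x)))"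
    by (intro cmpI assms(2,3) cmp_app3[OF h])
  then show ?thesis by (simp add: fold_funpow length_le_enc)
qed

lemma cmp_rev [cmpI]: "cmp l \<Longrightarrow> cmp (\<lambda>x. rev (l x))"
  unfolding rev_conv_fold by (intro cmpI)

lemma cmp_foldr [cmpI]:
  assumes h: "cmp (\<lambda>p. h (fst p) (fst (snd p)) (snd (snd p)))" and "cmp l" "cmp g"
  shows "cmp (\<lambda>x. foldr (h x) (l x) (g x))"
  unfolding foldr_conv_fold by (intro cmpI assms)

lemma cmp_append [cmpI]: "cmp f \<Longrightarrow> cmp g \<Longrightarrow> cmp (\<lambda>x. f x @ g x)"
proof -
  assume "cmp f" "cmp g"
  have "xs @ ys = foldr (\<lambda>a s. a # s) xs ys" for xs ys :: "'b list" by (induction xs) auto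
  then show ?thesis by (simp only:) (intro cmpI \<open>cmp f\<close> \<open>cmp g\<close>)
qed

lemma cmp_map [cmpI]:
  assumes "cmp (\<lambda>p. h (fst p) (snd p))" "cmp l"
  shows "cmp (\<lambda>x. map (h x) (l x))"
proof -
  have "map f xs = foldr (\<lambda>a s. f a # s) xs []" for f :: "'b \<Rightarrow> 'c" and xs by (induction xs) auto
  then show ?thesis by (simp only:) (intro cmpI assms cmp_app2[OF assms(1)])
qed

lemma cmp_filter [cmpI]:
  assumes "cmpp (\<lambda>p. P (fst p) (snd p))" "cmp l"
  shows "cmp (\<lambda>x. filter (P x) (l x))"
proof -
  have P: "cmpp (\<lambda>p. P (fst p) (fst (snd p)))"
    using cmpp_app[OF assms(1) cmp_Pair[OF cmp_fst[OF cmp_id] cmp_fst[OF cmp_snd[OF cmp_id]]]] by simp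
  have "filter f xs = foldr (\<lambda>a s. if f a then a # s else s) xs []" for f :: "'b \<Rightarrow> bool" and xs
    by (induction xs) auto
  then show ?thesis by (simp only:) (intro cmpI assms P)
qed

lemma cmpp_list_all [cmpI]:
  assumes "cmpp (\<lambda>p. P (fst p) (snd p))" "cmp l"
  shows "cmpp (\<lambda>x. \<forall>a\<in>set (l x). P x a)"
proof -
  have "(\<forall>a\<in>set xs. Q a) \<longleftrightarrow> filter (\<lambda>a. \<not> Q a) xs = []" for Q :: "'b \<Rightarrow> bool" and xs
    by (simp add: filter_empty_conv)
  then show ?thesis by (simp only:) (intro cmpI assms)
qed

lemma cmp_concat [cmpI]: "cmp l \<Longrightarrow> cmp (\<lambda>x. concat (l x))"
  unfolding concat_conv_foldr by (intro cmpI)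

lemma cmp_length [cmpI]: "cmp l \<Longrightarrow> cmp (\<lambda>x. length (l x))"
proof -
  assume "cmp l"
  have "length xs = foldr (\<lambda>_ n. Suc n) xs 0" for xs :: "'b list" by (induction xs) auto
  then show ?thesis by (simp only:) (intro cmpI \<open>cmp l\<close>)
qed

lemma cmp_sum_list_nat [cmpI]: "cmp l \<Longrightarrow> cmp (\<lambda>x. sum_list (l x) :: nat)"
  unfolding sum_list.eq_foldr by (intro cmpI)

lemma cmp_sum_list_int [cmpI]: "cmp l \<Longrightarrow> cmp (\<lambda>x. sum_list (l x) :: int)"
  unfolding sum_list.eq_foldr by (intro cmpI)

lemma cmp_prod_list_int [cmpI]: "cmp l \<Longrightarrow> cmp (\<lambda>x. prod_list (l x) :: int)"
  unfolding prod_list.eq_foldr by (intro cmpI)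

lemma cmp_upt [cmpI]:
  assumes "cmp f"
  shows "cmp (\<lambda>x. [0..<f x])"
proof -
  have "((\<lambda>l. l @ [length l]) ^^ n) [] = [0..<n]" for n by (induction n) auto
  then have *: "[0..<n] = ((\<lambda>l. l @ [length l]) ^^ n) []" for n by simp
  show ?thesis by (subst *) (intro cmpI assms)
qed

lemma cmp_upto [cmpI]:
  assumes "cmp f" "cmp g"
  shows "cmp (\<lambda>x. [f x..g x])"
proof -
  have *: "[i..j] = map (\<lambda>k. i + int k) [0..<nat (j - i + 1)]" for i j
    by (rule nth_equalityI) auto
  show ?thesis by (subst *) (intro cmpI assms cmp_app[OF assms(1)])
qed

lemma cmp_replicate [cmpI]:
  assumes "cmp f" "cmp g"
  shows "cmp (\<lambda>x. replicate (f x) (g x))"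
proof -
  have *: "replicate n a = ((\<lambda>l. a # l) ^^ n) []" for n and a :: 'b by (induction n) auto
  show ?thesis by (subst *) (intro cmpI assms cmp_app[OF assms(2)])
qed

definition nthd :: "'a::coded list \<Rightarrow> nat \<Rightarrow> 'a" where
  "nthd xs i = hdd ((tl ^^ i) xs)"

lemma nthd_nth: "i < length xs \<Longrightarrow> nthd xs i = xs ! i"
proof (induction i arbitrary: xs)
  case 0
  then show ?case by (cases xs) (auto simp: nthd_def)
next
  case (Suc i)
  then show ?case by (cases xs) (auto simp: nthd_def funpow_Suc_right simp del: funpow.simps(2))
qed

lemma cmp_nthd [cmpI]: "cmp f \<Longrightarrow> cmp g \<Longrightarrow> cmp (\<lambda>x. nthd (f x) (g x))"
  unfolding nthd_def by (intro cmpI)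

lemma cmp_zip [cmpI]:
  assumes "cmp f" "cmp g"
  shows "cmp (\<lambda>x. zip (f x) (g x))"
proof -
  have *: "zip xs ys = map (\<lambda>i. (nthd xs i, nthd ys i))
      [0..<(if length xs \<le> length ys then length xs else length ys)]"
    for xs :: "'b list" and ys :: "'c list"
    by (rule nth_equalityI) (auto simp: nthd_nth)
  show ?thesis by (subst *) (intro cmpI assms cmp_app[OF assms(1)] cmp_app[OF assms(2)])
qed

subsection \<open>Polynomials as functions with vanishing differences\<close>

text \<open>All \<open>d\<close>-fold differences along the shifts in \<open>S\<close> vanish on \<open>X\<close>: on integer vectors these are
  the functions that are polynomial of degree less than \<open>d\<close> on every orbit of the shifts.\<close>

primrec dpol :: "'x set \<Rightarrow> ('x \<Rightarrow> 'x) set \<Rightarrow> nat \<Rightarrow> ('x \<Rightarrow> 'b::ab_group_add) \<Rightarrow> bool" where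
  "dpol X S 0 f \<longleftrightarrow> (\<forall>x\<in>X. f x = 0)"
| "dpol X S (Suc d) f \<longleftrightarrow> (\<forall>s\<in>S. dpol X S d (\<lambda>x. f (s x) - f x))"

definition acts :: "('x \<Rightarrow> 'x) set \<Rightarrow> 'x set \<Rightarrow> bool" where
  "acts S X \<longleftrightarrow> (\<forall>s\<in>S. \<forall>x\<in>X. s x \<in> X)"

lemma dpol_cong:
  assumes "acts S X" "\<And>x. x \<in> X \<Longrightarrow> f x = g x" "dpol X S d f"
  shows "dpol X S d g"
  using assms(2,3)
proof (induction d arbitrary: f g)
  case (Suc d)
  have "dpol X S d (\<lambda>x. g (s x) - g x)" if "s \<in> S" for s
    by (rule Suc.IH[of "\<lambda>x. f (s x) - f x"]) (use Suc.prems assms(1) that in \<open>auto simp: acts_def\<close>)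
  then show ?case by simp
qed auto

lemma dpol_zero: "dpol X S d (\<lambda>_. 0)"
  by (induction d) auto

lemma dpol_Suc: "acts S X \<Longrightarrow> dpol X S d f \<Longrightarrow> dpol X S (Suc d) f"
proof (induction d arbitrary: f)
  case (Suc d)
  have "dpol X S (Suc d) (\<lambda>x. f (s x) - f x)" if "s \<in> S" for s
    by (rule Suc.IH) (use Suc.prems that in auto)
  then show ?case by simp
qed (auto simp: acts_def)

lemma dpol_mono: "acts S X \<Longrightarrow> dpol X S d f \<Longrightarrow> d \<le> e \<Longrightarrow> dpol X S e f"
  by (induction e) (auto simp: le_Suc_eq intro: dpol_Suc simp del: dpol.simps(2))

lemma dpol_add: "dpol X S d f \<Longrightarrow> dpol X S d g \<Longrightarrow> dpol X S d (\<lambda>x. f x + g x)"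
proof (induction d arbitrary: f g)
  case (Suc d)
  have "dpol X S d (\<lambda>x. (f (s x) - f x) + (g (s x) - g x))" if "s \<in> S" for s
    by (rule Suc.IH) (use Suc.prems that in auto)
  then show ?case by (simp add: algebra_simps)
qed auto

lemma dpol_uminus: "dpol X S d f \<Longrightarrow> dpol X S d (\<lambda>x. - f x)"
proof (induction d arbitrary: f)
  case (Suc d)
  have "dpol X S d (\<lambda>x. - (f (s x) - f x))" if "s \<in> S" for s
    by (rule Suc.IH) (use Suc.prems that in auto)
  then show ?case by (simp add: algebra_simps)
qed auto

lemma dpol_diff: "dpol X S d f \<Longrightarrow> dpol X S d g \<Longrightarrow> dpol X S d (\<lambda>x. f x - g x)"
  using dpol_add[OF _ dpol_uminus, of X S d f g] by simp

lemma dpol_sum: "(\<And>i. i \<in> A \<Longrightarrow> dpol X S d (f i)) \<Longrightarrow> dpol X S d (\<lambda>x. \<Sum>i\<in>A. f i x)"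
  by (induction A rule: infinite_finite_induct) (auto intro: dpol_zero dpol_add)

lemma dpol_sum_list:
  "(\<And>i. i \<in> set l \<Longrightarrow> dpol X S d (f i)) \<Longrightarrow> dpol X S d (\<lambda>x. \<Sum>i\<leftarrow>l. f i x)"
  by (induction l) (auto intro: dpol_zero dpol_add)

text \<open>Substituting a map that turns each shift in \<open>S'\<close> into a shift in
  \<open>S\<close> commutes with taking differences. Change of period, fixing a coordinate,
  translation and restriction to a line are all instances.\<close>

lemma dpol_comp:
  assumes "acts S' X'" "\<And>x. x \<in> X' \<Longrightarrow> \<phi> x \<in> X"
    and "\<And>s'. s' \<in> S' \<Longrightarrow> \<exists>s\<in>S. \<forall>x\<in>X'. \<phi> (s' x) = s (\<phi> x)" and "dpol X S d f"
  shows "dpol X' S' d (\<lambda>x. f (\<phi> x))"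
  using assms(4)
proof (induction d arbitrary: f)
  case (Suc d)
  have "dpol X' S' d (\<lambda>x. f (\<phi> (s' x)) - f (\<phi> x))" if s': "s' \<in> S'" for s'
  proof -
    obtain s where s: "s \<in> S" "\<forall>x\<in>X'. \<phi> (s' x) = s (\<phi> x)" using assms(3)[OF s'] by blast
    have "dpol X' S' d (\<lambda>x. f (s (\<phi> x)) - f (\<phi> x))"
      using Suc.IH[of "\<lambda>x. f (s x) - f x"] Suc.prems s(1) by simp
    then show ?thesis by (rule dpol_cong[OF assms(1), rotated]) (use s(2) in auto)
  qed
  then show ?case by simp
qed (use assms(2) in auto)

lemma dpol_of_int:
  "dpol X S d f \<Longrightarrow> dpol X S d (\<lambda>x. of_int (f x) :: 'b::ring_1)"
proof (induction d arbitrary: f)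
  case (Suc d)
  have "dpol X S d (\<lambda>x. of_int (f (s x) - f x) :: 'b)" if "s \<in> S" for s
    by (rule Suc.IH) (use Suc.prems that in auto)
  then show ?case by simp
qed auto

lemma dpol_const: "dpol X S (Suc 0) (\<lambda>_. c)"
  by simp

text \<open>Discrete Leibniz rule: the difference of the product is
  \<open>?Df x * g (s x) + f x * ?Dg x\<close>, and in each product one factor has lost a degree. If
  that factor had degree \<open>0\<close>, its difference vanishes on \<open>X\<close>.\<close>

lemma dpol_mult:
  fixes f g :: "'x \<Rightarrow> 'b::comm_ring_1"
  assumes S: "acts S X" and "dpol X S (Suc d) f" "dpol X S (Suc e) g"
  shows "dpol X S (Suc (d + e)) (\<lambda>x. f x * g x)"
  using assms(2,3)
proof (induction "d + e" arbitrary: d e f g rule: less_induct)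
  case less
  have "dpol X S (d + e) (\<lambda>x. f (s x) * g (s x) - f x * g x)" if s: "s \<in> S" for s
  proof -
    let ?Df = "\<lambda>x. f (s x) - f x" and ?Dg = "\<lambda>x. g (s x) - g x"
    have D: "dpol X S d ?Df" "dpol X S e ?Dg" using less.prems s by auto
    have "dpol X S (Suc e) (\<lambda>x. g x + ?Dg x)"
      by (rule dpol_add[OF less.prems(2) dpol_Suc[OF S D(2)]])
    then have gs: "dpol X S (Suc e) (\<lambda>x. g (s x))" by simp
    have "dpol X S (d + e) (\<lambda>x. ?Df x * g (s x))"
    proof (cases d)
      case 0
      then show ?thesis by (intro dpol_cong[OF S _ dpol_zero]) (use D in auto)
    next
      case (Suc d')
      then show ?thesis using less.hyps[OF _ _ gs, of d'] D by simp
    qed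
    moreover have "dpol X S (d + e) (\<lambda>x. f x * ?Dg x)"
    proof (cases e)
      case 0
      then show ?thesis by (intro dpol_cong[OF S _ dpol_zero]) (use D in auto)
    next
      case (Suc e')
      then show ?thesis using less.hyps[OF _ less.prems(1), of e'] D by simp
    qed
    ultimately have "dpol X S (d + e) (\<lambda>x. ?Df x * g (s x) + f x * ?Dg x)"
      by (rule dpol_add)
    then show ?thesis by (simp add: algebra_simps)
  qed
  then show ?case by simp
qed

lemma dpol_prod:
  fixes f :: "'i \<Rightarrow> 'x \<Rightarrow> 'b::comm_ring_1"
  assumes S: "acts S X" and "finite A" "\<And>i. i \<in> A \<Longrightarrow> dpol X S (Suc (Suc 0)) (f i)"
  shows "dpol X S (Suc (card A)) (\<lambda>x. \<Prod>i\<in>A. f i x)"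
  using assms(2,3)
proof (induction A rule: finite_induct)
  case (insert a A)
  then show ?case using dpol_mult[OF S, of 1 "f a" "card A"] by simp
qed simp

lemma dpol_power:
  fixes f :: "'x \<Rightarrow> 'b::comm_ring_1"
  assumes S: "acts S X" and "dpol X S (Suc (Suc 0)) f"
  shows "dpol X S (Suc e) (\<lambda>x. f x ^ e)"
  using dpol_prod[OF S, of "{..<e}" "\<lambda>_. f"] assms(2) by simp

subsection \<open>Difference polynomials on integer vectors\<close>

definition vadd :: "int list \<Rightarrow> int list \<Rightarrow> int list" where
  "vadd u v = map2 (+) u v"

definition vscale :: "int \<Rightarrow> int list \<Rightarrow> int list" where
  "vscale c v = map ((*) c) v"

definition vecs :: "nat \<Rightarrow> int list set" where
  "vecs n = {v. length v = n}"

definition shifts :: "int \<Rightarrow> nat \<Rightarrow> (int list \<Rightarrow> int list) set" where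
  "shifts N n = {\<lambda>v. vadd v (vscale N u) |u. u \<in> vecs n}"

text \<open>For \<open>N > 0\<close> these functions are polynomial of degree below \<open>d\<close>
  on each residue class modulo \<open>N\<close>: quasi-polynomials of period
  \<open>N\<close>.\<close>

abbreviation vpol :: "int \<Rightarrow> nat \<Rightarrow> nat \<Rightarrow> (int list \<Rightarrow> 'b::ab_group_add) \<Rightarrow> bool" where
  "vpol N n \<equiv> dpol (vecs n) (shifts N n)"

lemma vadd_simps [simp]: "vadd [] v = []" "vadd u [] = []" "vadd (x # u) (y # v) = (x + y) # vadd u v"
  by (auto simp: vadd_def)

lemma vscale_simps [simp]: "vscale c [] = []" "vscale c (x # u) = (c * x) # vscale c u"
  by (auto simp: vscale_def)

lemma length_vadd [simp]: "length (vadd u v) = min (length u) (length v)"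
  by (simp add: vadd_def)

lemma length_vscale [simp]: "length (vscale c v) = length v"
  by (simp add: vscale_def)

lemma vscale_vscale: "vscale a (vscale b v) = vscale (a * b) v"
  by (simp add: vscale_def)

lemma vscale_1 [simp]: "vscale 1 v = v"
  by (induction v) auto

lemma vadd_commute: "vadd u v = vadd v u"
  by (induction u v rule: list_induct2') auto

lemma vadd_assoc: "vadd (vadd u v) w = vadd u (vadd v w)"
proof (induction u arbitrary: v w)
  case (Cons a u)
  then show ?case by (cases v; cases w) auto
qed auto

lemma vadd_vscale_0: "length u = length v \<Longrightarrow> vadd v (vscale 0 u) = v"
  by (induction u v rule: list_induct2) auto

lemma acts_shifts [simp]: "acts (shifts N n) (vecs n)"
  by (auto simp: acts_def shifts_def vecs_def)

lemma shiftsI: "length u = n \<Longrightarrow> (\<lambda>v. vadd v (vscale N u)) \<in> shifts N n"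
  by (auto simp: shifts_def vecs_def)

lemma vpol_period:
  assumes "vpol N n d f"
  shows "vpol (N * k) n d f"
proof (rule dpol_comp[OF acts_shifts _ _ assms])
  fix s' assume "s' \<in> shifts (N * k) n"
  then obtain u where u: "length u = n" "s' = (\<lambda>v. vadd v (vscale N (vscale k u)))"
    by (auto simp: shifts_def vecs_def vscale_vscale)
  then show "\<exists>s\<in>shifts N n. \<forall>v\<in>vecs n. s' v = s v"
    by (intro bexI[OF _ shiftsI[of "vscale k u"]]) auto
qed

lemma vpol_Cons:
  assumes "vpol N (Suc n) d f"
  shows "vpol N n d (\<lambda>v. f (t # v))"
proof (rule dpol_comp[OF acts_shifts _ _ assms])
  fix s' assume "s' \<in> shifts N n"
  then obtain u where u: "u \<in> vecs n" "s' = (\<lambda>v. vadd v (vscale N u))" by (auto simp: shifts_def)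
  show "\<exists>s\<in>shifts N (Suc n). \<forall>v\<in>vecs n. t # s' v = s (t # v)"
    by (rule bexI[of _ "\<lambda>v. vadd v (vscale N (0 # u))"])
      (use u in \<open>auto simp: shifts_def vecs_def intro!: exI[of _ "0 # u"]\<close>)
qed (auto simp: vecs_def)

lemma vpol_shift:
  assumes "vpol N n d f" "length u = n"
  shows "vpol N n d (\<lambda>v. f (vadd v u))"
proof (rule dpol_comp[OF acts_shifts _ _ assms(1)])
  fix s' assume "s' \<in> shifts N n"
  then obtain w where w: "w \<in> vecs n" "s' = (\<lambda>v. vadd v (vscale N w))" by (auto simp: shifts_def)
  show "\<exists>s\<in>shifts N n. \<forall>v\<in>vecs n. vadd (s' v) u = s (vadd v u)"
    by (rule bexI[of _ "\<lambda>v. vadd v (vscale N w)"])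
      (use w in \<open>auto simp: shifts_def vecs_def vadd_assoc vadd_commute[of u]\<close>)
qed (use assms(2) in \<open>auto simp: vecs_def\<close>)

lemma vpol_line:
  assumes "vpol N (Suc n) d f" "length v = n"
  shows "dpol UNIV {\<lambda>j::int. j + 1} d (\<lambda>j. f ((x + N * j) # v))"
proof (rule dpol_comp[OF _ _ _ assms(1)])
  have "vadd ((x + N * j) # v) (vscale N (1 # replicate n 0)) = (x + N * (j + 1)) # v" for j
    using assms(2) vadd_vscale_0[of "replicate n 0" v]
    by (simp add: vscale_def map_replicate_const algebra_simps)
  then show "\<exists>s\<in>shifts N (Suc n). \<forall>j\<in>UNIV. (x + N * s' j) # v = s ((x + N * j) # v)"
    if "s' \<in> {\<lambda>j::int. j + 1}" for s' :: "int \<Rightarrow> int"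
    using that by (intro bexI[OF _ shiftsI[of "1 # replicate n 0"]]) auto
qed (use assms(2) in \<open>auto simp: vecs_def acts_def\<close>)

subsection \<open>Summation\<close>

text \<open>An oriented sum, like an integral: exchanging the end points changes the sign. Hence
  \<open>ssum_join\<close> holds for end points in any order, also outside the cell on which they
  are ordered.\<close>

definition ssum :: "int \<Rightarrow> int \<Rightarrow> (int \<Rightarrow> 'b::ab_group_add) \<Rightarrow> 'b" where
  "ssum a b g = (\<Sum>t\<in>{a<..b}. g t) - (\<Sum>t\<in>{b<..a}. g t)"

lemma sum_ivl_join:
  fixes a b c :: int
  shows "a \<le> b \<Longrightarrow> b \<le> c \<Longrightarrow> (\<Sum>t\<in>{a<..b}. g t) + (\<Sum>t\<in>{b<..c}. g t) = (\<Sum>t\<in>{a<..c}. g t)"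
  by (subst sum.union_disjoint[symmetric]) (auto intro!: sum.cong)

lemma ssum_join: "ssum a b g + ssum b c g = ssum a c g"
proof -
  have "a \<le> b \<and> b \<le> c \<or> a \<le> c \<and> c \<le> b \<or> b \<le> a \<and> a \<le> c \<or> b \<le> c \<and> c \<le> a
      \<or> c \<le> a \<and> a \<le> b \<or> c \<le> b \<and> b \<le> a" by linarith
  then show ?thesis
    using sum_ivl_join[of a b c g] sum_ivl_join[of a c b g] sum_ivl_join[of b a c g]
      sum_ivl_join[of b c a g] sum_ivl_join[of c a b g] sum_ivl_join[of c b a g]
    by (auto simp: ssum_def algebra_simps)
qed

lemma ssum_shift: "ssum (a + k) (b + k) g = ssum a b (\<lambda>t. g (t + k))"
proof -
  have "(\<Sum>t\<in>{a + k<..b + k}. g t) = (\<Sum>t\<in>{a<..b}. g (t + k))" for a b :: int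
    by (rule sum.reindex_bij_witness[of _ "\<lambda>t. t + k" "\<lambda>t. t - k"]) auto
  then show ?thesis by (simp add: ssum_def)
qed

lemma ssum_diff: "ssum a b (\<lambda>t. f t - g t) = ssum a b f - ssum a b g"
  by (simp add: ssum_def sum_subtractf)

text \<open>Shifting \<open>v\<close> moves the upper end by a multiple \<open>N * b\<close>.
  Substituting \<open>t + N * b\<close> for \<open>t\<close> splits the difference into a sum over
  the fixed range from \<open>0\<close> to \<open>N * b\<close>, whose terms have the degree of
  \<open>q\<close>, and a sum of the original kind for a difference \<open>q'\<close> of
  \<open>q\<close>, to which induction on the degree applies. The factor \<open>k\<close> in the
  period is what makes the end move by multiples of \<open>N\<close>.\<close>

lemma vpol_ssum:
  assumes "vpol N (Suc n) d q"
    and hi: "\<And>u. length u = n \<Longrightarrow>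
      \<exists>b. \<forall>v\<in>vecs n. hi (vadd v (vscale (N * k) u)) = hi v + N * b"
  shows "vpol (N * k) n (Suc d) (\<lambda>v. ssum 0 (hi v) (\<lambda>t. q (t # v)))"
  using assms(1)
proof (induction d arbitrary: q)
  case 0
  show ?case
    by (rule dpol_cong[OF acts_shifts _ dpol_zero]) (use 0 in \<open>auto simp: ssum_def vecs_def\<close>)
next
  case (Suc d)
  have "vpol (N * k) n (Suc d) (\<lambda>v. ssum 0 (hi (s v)) (\<lambda>t. q (t # s v)) - ssum 0 (hi v) (\<lambda>t. q (t # v)))"
    if sS: "s \<in> shifts (N * k) n" for s
  proof -
    obtain u where u: "length u = n" and s: "s = (\<lambda>v. vadd v (vscale (N * k) u))"
      using sS by (auto simp: shifts_def vecs_def)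
    obtain b where b: "\<forall>v\<in>vecs n. hi (s v) = hi v + N * b" using hi[OF u] s by blast
    define w where "w = b # vscale k u"
    have w: "length w = Suc n" using u by (simp add: w_def)
    define q' where "q' v = q (vadd v (vscale N w)) - q v" for v
    have q': "vpol N (Suc n) d q'" unfolding q'_def
      using Suc.prems w by (auto simp: shifts_def vecs_def)
    have eq: "ssum 0 (hi (s v)) (\<lambda>t. q (t # s v)) - ssum 0 (hi v) (\<lambda>t. q (t # v)) =
        ssum 0 (N * b) (\<lambda>t. q (t # s v)) + ssum 0 (hi v) (\<lambda>t. q' (t # v))" if v: "v \<in> vecs n" for v
    proof -
      have "ssum 0 (hi (s v)) (\<lambda>t. q (t # s v)) =
          ssum 0 (N * b) (\<lambda>t. q (t # s v)) + ssum (0 + N * b) (hi v + N * b) (\<lambda>t. q (t # s v))"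
        using b v by (simp add: ssum_join)
      moreover have "ssum (0 + N * b) (hi v + N * b) (\<lambda>t. q (t # s v)) - ssum 0 (hi v) (\<lambda>t. q (t # v))
          = ssum 0 (hi v) (\<lambda>t. q' (t # v))"
        unfolding ssum_shift ssum_diff[symmetric] q'_def w_def s by (simp add: vscale_vscale)
      ultimately show ?thesis by (simp add: algebra_simps)
    qed
    have "vpol (N * k) n (Suc d) (\<lambda>v. q (t # s v))" for t
      unfolding s using vpol_shift[OF vpol_period[OF vpol_Cons[OF Suc.prems, of t], of k], of "vscale (N * k) u"] u
      by simp
    then have "vpol (N * k) n (Suc d) (\<lambda>v. ssum 0 (N * b) (\<lambda>t. q (t # s v)))"
      unfolding ssum_def by (intro dpol_diff dpol_sum)
    from dpol_add[OF this Suc.IH[OF q']] show ?thesis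
      by (rule dpol_cong[OF acts_shifts, rotated]) (simp add: eq)
  qed
  then show ?case by simp
qed

subsection \<open>Uniqueness and interpolation\<close>

text \<open>The difference of \<open>F\<close> vanishes at one point less and has one degree less,
  so it is zero by induction; thus \<open>F\<close> is constant in both directions from
  \<open>F 0 = 0\<close>.\<close>

lemma dpol_line_unique:
  assumes "dpol UNIV {\<lambda>j::int. j + 1} d F" "\<And>j. 0 \<le> j \<Longrightarrow> j < int d \<Longrightarrow> F j = 0"
  shows "F j = 0"
  using assms
proof (induction d arbitrary: F j)
  case (Suc d)
  have D: "F (j + 1) - F j = 0" for j
    by (rule Suc.IH[of "\<lambda>j. F (j + 1) - F j"]) (use Suc.prems in auto)
  show ?case
  proof (induction j rule: int_induct[of _ 0])
    case base
    show ?case using Suc.prems(2)[of 0] by simp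
  next
    case (step1 i)
    then show ?case using D[of i] by simp
  next
    case (step2 i)
    then show ?case using D[of "i - 1"] by simp
  qed
qed simp

text \<open>On a line parallel to a coordinate axis, each residue class modulo \<open>N\<close>
  meets the box in \<open>e\<close> consecutive points of the class, and \<open>e \<ge> d\<close>
  zeros kill a polynomial of degree below \<open>d\<close>. The coordinates are treated one by
  one.\<close>

lemma vpol_unique:
  assumes "vpol N n d f" "0 < N" "d \<le> e" "0 < e"
    and "\<And>v. length v = n \<Longrightarrow> (\<forall>x\<in>set v. 0 \<le> x \<and> x < N * int e) \<Longrightarrow> f v = 0"
    and "length v = n"
  shows "f v = 0"
  using assms(1,5,6)
proof (induction n arbitrary: f v)
  case (Suc n)
  obtain x y where v: "v = x # y" "length y = n" using Suc.prems(3) by (cases v) auto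
  have *: "f (x' # y) = 0" if "0 \<le> x'" "x' < N * int e" for x'
    by (rule Suc.IH[OF vpol_Cons[OF Suc.prems(1)]]) (use Suc.prems(2) that v in auto)
  have "f ((x mod N + N * (x div N)) # y) = 0"
  proof (rule dpol_line_unique[OF vpol_line[OF Suc.prems(1) v(2)]])
    fix j assume j: "0 \<le> j" "j < int d"
    have "N * (j + 1) \<le> N * int e" using j assms(2,3) by (intro mult_left_mono) auto
    moreover have "0 \<le> x mod N" "x mod N < N" "0 \<le> N * j" using assms(2) j by auto
    ultimately have "0 \<le> x mod N + N * j" "x mod N + N * j < N * int e"
      unfolding distrib_left by linarith+
    then show "f ((x mod N + N * j) # y) = 0" by (rule *)
  qed
  then show ?case using v by simp
qed simp

section \<open>Explicit polynomials and interpolation\<close>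

definition leval :: "rat mpoly_list \<Rightarrow> int list \<Rightarrow> rat" where
  "leval P y = (\<Sum>(a, es)\<leftarrow>P. a * prod_list (map2 (\<lambda>t e. of_int t ^ e) y es))"

lemma leval_Nil [simp]: "leval [] y = 0"
  by (simp add: leval_def)

lemma leval_append [simp]: "leval (P @ Q) y = leval P y + leval Q y"
  by (simp add: leval_def)

lemma leval_Cons [simp]:
  "leval ((a, es) # P) y = a * prod_list (map2 (\<lambda>t e. of_int t ^ e) y es) + leval P y"
  by (simp add: leval_def)

lemma leval_mult_poly:
  "leval (concat (map (\<lambda>(a, es). map (\<lambda>i. (a * coeff p i, i # es)) [0..<Suc (degree p)]) P)) (x # y) =
    poly p (of_int x) * leval P y"
proof (induction P)
  case (Cons m P)
  obtain a es where m: "m = (a, es)" by fastforce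
  let ?M = "prod_list (map2 (\<lambda>t e. of_int t ^ e) y es) :: rat"
  have "leval (map (\<lambda>i. (a * coeff p i, i # es)) [0..<k]) (x # y) =
      (\<Sum>i<k. coeff p i * of_int x ^ i) * (a * ?M)" for k
    by (induction k) (auto simp: algebra_simps)
  then show ?case using Cons.IH
    by (simp add: m poly_altdef lessThan_Suc_atMost algebra_simps del: upt_Suc)
qed simp

text \<open>The Lagrange basis polynomial in \<open>j\<close> for the nodes
  \<open>0, ..., d - 1\<close>, rewritten in the variable \<open>x = z + N * j\<close> by means of
  \<open>j = (x - z) / N\<close>.\<close>

lemma lagrange_basis:
  assumes "0 < N"
  shows "\<exists>p :: rat poly. \<forall>j. poly p (of_int (z + N * j)) =
    (\<Prod>i\<in>{..<d} - {k}. (of_int j - of_nat i) / (of_nat k - of_nat i))"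
proof (intro exI allI)
  fix j
  let ?p = "\<Prod>i\<in>{..<d} - {k}. Polynomial.smult (1 / (of_int N * (of_nat k - of_nat i)))
      [: - of_int z - of_int N * of_nat i, 1 :] :: rat poly"
  show "poly ?p (of_int (z + N * j)) = (\<Prod>i\<in>{..<d} - {k}. (of_int j - of_nat i) / (of_nat k - of_nat i))"
    unfolding poly_prod
  proof (rule prod.cong[OF refl])
    fix i
    have "- of_int z - of_int N * of_nat i + of_int (z + N * j) = of_int N * (of_int j - of_nat i :: rat)"
      by (simp add: algebra_simps)
    moreover have "poly (Polynomial.smult a [:b, 1:]) c = a * (b + c)" for a b c :: rat
      by (simp add: algebra_simps)
    moreover have "c \<noteq> 0 \<Longrightarrow> 1 / (c * b) * (c * a) = a / b" for a b c :: rat by simp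
    moreover have "of_int N \<noteq> (0 :: rat)" using assms by simp
    ultimately show "poly (Polynomial.smult (1 / (of_int N * (of_nat k - of_nat i)))
        [: - of_int z - of_int N * of_nat i, 1 :]) (of_int (z + N * j)) =
        (of_int j - of_nat i) / (of_nat k - of_nat i :: rat)"
      by (simp only:)
  qed
qed

lemma dpol_lagrange:
  fixes F :: "int \<Rightarrow> rat"
  assumes F: "dpol UNIV {\<lambda>j::int. j + 1} d F"
  shows "F j = (\<Sum>k<d. F (int k) * (\<Prod>i\<in>{..<d} - {k}. (of_int j - of_nat i) / (of_nat k - of_nat i)))"
    (is "_ = (\<Sum>k<d. F (int k) * ?L k j)")
proof -
  have act: "acts {\<lambda>j::int. j + 1} UNIV" by (simp add: acts_def)
  have "dpol UNIV {\<lambda>j::int. j + 1} (Suc (Suc 0)) (\<lambda>j. (of_int j - a) / b)" for a b :: rat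
    by (simp add: diff_divide_distrib add_divide_distrib)
  then have "dpol UNIV {\<lambda>j::int. j + 1} (Suc (card ({..<d} - {k}))) (?L k)" for k
    by (intro dpol_prod[OF act]) auto
  note L' = dpol_mult[OF act dpol_const this]
  have L: "dpol UNIV {\<lambda>j::int. j + 1} d (\<lambda>j. F (int k) * ?L k j)" if "k < d" for k
  proof -
    have "Suc (0 + card ({..<d} - {k})) = d" using that by simp
    then show ?thesis using L'[of k "F (int k)"] by (simp only:)
  qed
  have "F j - (\<Sum>k<d. F (int k) * ?L k j) = 0"
  proof (rule dpol_line_unique[of d "\<lambda>j. F j - (\<Sum>k<d. F (int k) * ?L k j)"])
    show "dpol UNIV {\<lambda>j. j + 1} d (\<lambda>j. F j - (\<Sum>k<d. F (int k) * ?L k j))"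
      by (intro dpol_diff F dpol_sum L) auto
  next
    fix j :: int assume j: "0 \<le> j" "j < int d"
    have "?L k j = (if int k = j then 1 else 0)" if "k < d" for k
    proof (cases "int k = j")
      case True
      then show ?thesis by (auto intro!: prod.neutral split: if_splits)
    next
      case False
      then have "nat j \<in> {..<d} - {k}" using j by auto
      then have "?L k j = 0" using j by (intro prod_zero) (auto intro!: bexI[of _ "nat j"])
      then show ?thesis using False by simp
    qed
    then have "(\<Sum>k<d. F (int k) * ?L k j) = (\<Sum>k<d. if nat j = k then F j else 0)"
      using j by (intro sum.cong) auto
    also have "\<dots> = F j" using j by simp
    finally show "F j - (\<Sum>k<d. F (int k) * ?L k j) = 0" by simp
  qed
  then show ?thesis by simp
qed

text \<open>On the class of \<open>z\<close> the first coordinate runs through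
  \<open>z0 + N * j\<close>, and in \<open>j\<close> the function is interpolated at the nodes
  \<open>0, ..., d - 1\<close>. Its value at a node is a function of the other coordinates, hence
  given by a polynomial by induction.\<close>

lemma vpol_interpolation:
  fixes f :: "int list \<Rightarrow> rat"
  assumes "vpol N n d f" "0 < N"
  shows "\<exists>P. \<forall>y. length y = n \<longrightarrow> map (\<lambda>t. t mod N) y = z \<longrightarrow> f y = leval P y"
  using assms(1)
proof (induction n arbitrary: f z)
  case 0
  show ?case by (rule exI[of _ "[(f [], [])]"]) auto
next
  case (Suc n)
  show ?case
  proof (cases z)
    case Nil
    then show ?thesis by auto
  next
    case (Cons z0 z')
    have "\<forall>k. \<exists>P. \<forall>y. length y = n \<longrightarrow> map (\<lambda>t. t mod N) y = z' \<longrightarrow>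
        f ((z0 + N * int k) # y) = leval P y"
      by (intro allI Suc.IH[OF vpol_Cons[OF Suc.prems]])
    from choice[OF this] obtain P where P: "\<And>k y. length y = n \<Longrightarrow>
        map (\<lambda>t. t mod N) y = z' \<Longrightarrow> f ((z0 + N * int k) # y) = leval (P k) y"
      by blast
    have "\<forall>k. \<exists>p :: rat poly. \<forall>j. poly p (of_int (z0 + N * j)) =
        (\<Prod>i\<in>{..<d} - {k}. (of_int j - of_nat i) / (of_nat k - of_nat i))"
      by (intro allI lagrange_basis[OF assms(2)])
    from choice[OF this] obtain p :: "nat \<Rightarrow> rat poly" where p: "\<And>k j. poly (p k) (of_int (z0 + N * j)) =
        (\<Prod>i\<in>{..<d} - {k}. (of_int j - of_nat i) / (of_nat k - of_nat i))"
      by blast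
    define R where "R k = concat (map (\<lambda>(a, es). map (\<lambda>i. (a * coeff (p k) i, i # es))
        [0..<Suc (degree (p k))]) (P k))" for k
    have R: "leval (R k) (x # y) = poly (p k) (of_int x) * leval (P k) y" for k x y
      unfolding R_def by (rule leval_mult_poly)
    have sum: "leval (concat (map R [0..<m])) y = (\<Sum>k<m. leval (R k) y)" for m y
      by (induction m) auto
    show ?thesis
    proof (intro exI[of _ "concat (map R [0..<d])"] allI impI)
      fix v assume v: "length v = Suc n" "map (\<lambda>t. t mod N) v = z"
      obtain x y where xy: "v = x # y" "length y = n" "x mod N = z0" "map (\<lambda>t. t mod N) y = z'"
        using v Cons by (cases v) auto
      have x: "x = z0 + N * (x div N)" using mod_mult_div_eq[of x N] xy(3) by simp
      have "f (x # y) = f ((z0 + N * (x div N)) # y)" by (simp only: x[symmetric])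
      also have "\<dots> = (\<Sum>k<d. leval (P k) y * poly (p k) (of_int x))"
        using dpol_lagrange[OF vpol_line[OF Suc.prems xy(2), of z0], of "x div N"]
        unfolding P[OF xy(2,4)] p[symmetric] x[symmetric] .
      finally show "f v = leval (concat (map R [0..<d])) v"
        by (simp add: sum R xy(1) mult.commute)
    qed
  qed
qed

lemma vpol_tl:
  assumes "vpol N n d f"
  shows "vpol N (Suc n) d (\<lambda>v. f (tl v))"
proof (rule dpol_comp[OF acts_shifts _ _ assms])
  fix s' assume "s' \<in> shifts N (Suc n)"
  then obtain u where u: "length u = Suc n" "s' = (\<lambda>v. vadd v (vscale N u))"
    by (auto simp: shifts_def vecs_def)
  show "\<exists>s\<in>shifts N n. \<forall>v\<in>vecs (Suc n). tl (s' v) = s (tl v)"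
    by (rule bexI[OF _ shiftsI[of "tl u"]]) (use u in \<open>auto simp: vecs_def length_Suc_conv\<close>)
qed (auto simp: vecs_def)

lemma vpol_hd: "vpol N (Suc n) (Suc (Suc 0)) (\<lambda>v. of_int (hd v) :: 'b::ring_1)"
proof -
  have "vpol N (Suc n) (Suc 0) (\<lambda>v. of_int (hd (s v)) - of_int (hd v) :: 'b)"
    if sS: "s \<in> shifts N (Suc n)" for s
  proof -
    obtain u where u: "length u = Suc n" "s = (\<lambda>v. vadd v (vscale N u))"
      using sS by (auto simp: shifts_def vecs_def)
    show ?thesis
      by (rule dpol_cong[OF acts_shifts _ dpol_const[of _ _ "of_int (N * hd u)"]])
        (use u in \<open>auto simp: vecs_def length_Suc_conv\<close>)
  qed
  then show ?thesis by simp
qed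

lemma vpol_monomial:
  "vpol N n (Suc (sum_list es)) (\<lambda>v. prod_list (map2 (\<lambda>t e. of_int t ^ e) v es) :: rat)"
proof (induction es arbitrary: n)
  case (Cons e es)
  show ?case
  proof (cases n)
    case 0
    then show ?thesis by (intro dpol_mono[OF acts_shifts dpol_cong[OF acts_shifts _ dpol_const[of _ _ 1]]])
      (auto simp: vecs_def)
  next
    case (Suc n')
    have "vpol N n (Suc (e + sum_list es))
        (\<lambda>v. of_int (hd v) ^ e * prod_list (map2 (\<lambda>t e. of_int t ^ e) (tl v) es) :: rat)"
      unfolding Suc by (intro dpol_mult acts_shifts dpol_power vpol_hd vpol_tl Cons.IH)
    then have "vpol N n (Suc (e + sum_list es))
        (\<lambda>v. prod_list (map2 (\<lambda>t e. of_int t ^ e) v (e # es)) :: rat)"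
      by (rule dpol_cong[OF acts_shifts, rotated]) (auto simp: Suc vecs_def length_Suc_conv)
    then show ?thesis by simp
  qed
qed simp

lemma vpol_leval:
  assumes "\<And>a es. (a, es) \<in> set P \<Longrightarrow> sum_list es < d"
  shows "vpol N n d (leval P)"
  using assms
proof (induction P)
  case Nil
  then show ?case using dpol_zero by (simp add: leval_def[abs_def])
next
  case (Cons m P)
  obtain a es where m: "m = (a, es)" by fastforce
  have "vpol N n (Suc (0 + sum_list es)) (\<lambda>v. a * prod_list (map2 (\<lambda>t e. of_int t ^ e) v es) :: rat)"
    by (rule dpol_mult[OF acts_shifts dpol_const vpol_monomial])
  then have "vpol N n d (\<lambda>v. a * prod_list (map2 (\<lambda>t e. of_int t ^ e) v es) :: rat)"
    by (rule dpol_mono[OF acts_shifts]) (use Cons.prems[of a es] m in simp)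
  moreover have "vpol N n d (leval P)" using Cons by auto
  ultimately have "vpol N n d (\<lambda>v. a * prod_list (map2 (\<lambda>t e. of_int t ^ e) v es) + leval P v)"
    by (rule dpol_add)
  then show ?case by (simp add: m)
qed

text \<open>The shifts preserve residues modulo \<open>N\<close>, so choosing the function according
  to the residue class commutes with differences.\<close>

lemma vpol_residues:
  assumes "\<And>z. vpol N n d (g z)"
  shows "vpol N n d (\<lambda>v. g (map (\<lambda>t. t mod N) v) v)"
  using assms
proof (induction d arbitrary: g)
  case 0
  then show ?case by auto
next
  case (Suc d)
  have "vpol N n d (\<lambda>v. g (map (\<lambda>t. t mod N) (s v)) (s v) - g (map (\<lambda>t. t mod N) v) v)"
    if sS: "s \<in> shifts N n" for s
  proof -
    obtain u where u: "length u = n" "s = (\<lambda>v. vadd v (vscale N u))"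
      using sS by (auto simp: shifts_def vecs_def)
    have res: "map (\<lambda>t. t mod N) (s v) = map (\<lambda>t. t mod N) v" if "v \<in> vecs n" for v
    proof -
      have "map (\<lambda>t. t mod N) (vadd v (vscale N u)) = map (\<lambda>t. t mod N) v" if "length v = length u" for v u
        using that by (induction v u rule: list_induct2) auto
      then show ?thesis using that u by (simp add: vecs_def)
    qed
    have "vpol N n d (\<lambda>v. g (map (\<lambda>t. t mod N) v) (s v) - g (map (\<lambda>t. t mod N) v) v)"
      by (rule Suc.IH[of "\<lambda>z v. g z (s v) - g z v"]) (use Suc.prems sS in auto)
    then show ?thesis by (rule dpol_cong[OF acts_shifts, rotated]) (simp add: res)
  qed
  then show ?case by simp
qed

subsection \<open>Linear forms and cells\<close>

text \<open>The values are left polymorphic, as the same integral forms are evaluated at integral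
  sample points and at real points of the cells.\<close>

definition ldot :: "int list \<Rightarrow> 'a::linordered_idom list \<Rightarrow> 'a" where
  "ldot a v = sum_list (map2 (\<lambda>x t. of_int x * t) a v)"

definition incone :: "int list list \<Rightarrow> 'a::linordered_idom list \<Rightarrow> bool" where
  "incone P v \<longleftrightarrow> (\<forall>a\<in>set P. 0 \<le> ldot a v)"

text \<open>\<open>y\<close> lies in the smallest closed cell, containing \<open>w\<close>, of the arrangement of hyperplanes
  orthogonal to the elements of \<open>M\<close>.\<close>

definition incell :: "int list list \<Rightarrow> int list \<Rightarrow> 'a::linordered_idom list \<Rightarrow> bool" where
  "incell M w y \<longleftrightarrow> (\<forall>a\<in>set M. (0 \<le> ldot a w \<longrightarrow> 0 \<le> ldot a y) \<and> (ldot a w \<le> 0 \<longrightarrow> ldot a y \<le> 0))"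

text \<open>Equality of sign vectors: \<open>y\<close> lies in the same relatively open cell as
  \<open>w\<close>.\<close>

definition same_signs :: "int list list \<Rightarrow> int list \<Rightarrow> 'a::linordered_idom list \<Rightarrow> bool" where
  "same_signs M w y \<longleftrightarrow> (\<forall>a\<in>set M. (0 < ldot a w \<longleftrightarrow> 0 < ldot a y) \<and> (ldot a w < 0 \<longleftrightarrow> ldot a y < 0))"

lemma ldot_simps [simp]: "ldot [] v = 0" "ldot a [] = 0"
  "ldot (x # a) (t # v) = of_int x * t + ldot a v"
  by (simp_all add: ldot_def)

lemma ldot_append: "length a = length u \<Longrightarrow> ldot (a @ b) (u @ v) = ldot a u + ldot b v"
  by (induction a u rule: list_induct2) (simp_all add: algebra_simps)

lemma ldot_vscale [simp]: "ldot a (vscale c v) = c * ldot a v"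
  by (induction a v rule: list_induct2') (simp_all add: algebra_simps)

lemma ldot_vadd: "length u = length v \<Longrightarrow> ldot a (vadd u v) = ldot a u + ldot a v"
proof (induction u v arbitrary: a rule: list_induct2)
  case (Cons x u y v)
  then show ?case by (cases a) (simp_all add: algebra_simps)
qed simp

lemma ldot_of_int [simp]: "ldot a (map of_int v) = of_int (ldot a v)"
  by (induction a v rule: list_induct2') simp_all

lemma ldot_zero [simp]: "ldot a (replicate n 0) = 0"
proof (induction n arbitrary: a)
  case (Suc n)
  then show ?case by (cases a) simp_all
qed simp

lemma ldot_uminus [simp]: "ldot (map uminus a) v = - ldot a v"
  by (induction a v rule: list_induct2') simp_all

lemma ldot_zero_left [simp]: "ldot (replicate n 0) v = 0"
proof (induction n arbitrary: v)
  case (Suc n)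
  then show ?case by (cases v) simp_all
qed simp

lemma same_signs_incell: "same_signs M w y \<Longrightarrow> incell M w y"
  unfolding same_signs_def incell_def by (metis linorder_not_less)

lemma incell_of_int [simp]: "incell M w (map of_int y) \<longleftrightarrow> incell M w y"
  by (simp add: incell_def)

lemma incell_vscale: "0 < k \<Longrightarrow> incell M (vscale k w) y \<longleftrightarrow> incell M w y"
  by (simp add: incell_def zero_le_mult_iff mult_le_0_iff)

subsection \<open>Projection along the first coordinate\<close>

text \<open>The resultant of two forms with respect to the first variable, that is, the combination
  in which this variable cancels. Up to the sign of the product of the leading coefficients, its
  sign at \<open>v\<close> tells which of the two roots above \<open>v\<close> is larger.\<close>

definition comb :: "int list \<Rightarrow> int list \<Rightarrow> int list" where
  "comb a b = map2 (\<lambda>x y. hdd a * y - hdd b * x) (tl a) (tl b)"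

definition proj :: "int list list \<Rightarrow> int list list" where
  "proj M = map tl M @ concat (map (\<lambda>a. map (comb a) M) M)"

text \<open>One step of Fourier--Motzkin elimination.\<close>

definition fm :: "int list list \<Rightarrow> int list list" where
  "fm P = map tl (filter (\<lambda>a. hdd a = 0) P) @
     concat (map (\<lambda>a. map (comb a) (filter (\<lambda>b. hdd b < 0) P)) (filter (\<lambda>a. 0 < hdd a) P))"

text \<open>All nonzero leading coefficients divide it, so above a point multiplied by it every root
  is an integer; the factor \<open>2\<close> makes these integers even. Being positive, it does not
  move a point out of its cell.\<close>

definition kscale :: "int list list \<Rightarrow> int" where
  "kscale M = 2 * prod_list (map (\<lambda>a. if hdd a = 0 then 1 else \<bar>hdd a\<bar>) M)"

text \<open>The first coordinate at which the form \<open>a\<close> vanishes above \<open>v\<close>, exact over a field and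
  rounded down over the integers.\<close>

definition rho :: "int list \<Rightarrow> 'a::linordered_field list \<Rightarrow> 'a" where
  "rho a v = - ldot (tl a) v / of_int (hdd a)"

definition rt :: "int list \<Rightarrow> int list \<Rightarrow> int" where
  "rt a v = (- ldot (tl a) v) div hdd a"

lemma set_proj: "set (proj M) = tl ` set M \<union> (\<Union>a\<in>set M. comb a ` set M)"
  by (auto simp: proj_def)

lemma set_fm: "set (fm P) = tl ` {a\<in>set P. hdd a = 0} \<union>
    (\<Union>a\<in>{a\<in>set P. 0 < hdd a}. comb a ` {b\<in>set P. hdd b < 0})"
  by (auto simp: fm_def)

lemma length_proj: "\<forall>a\<in>set M. length a = Suc n \<Longrightarrow> \<forall>a\<in>set (proj M). length a = n"
  by (auto simp: set_proj comb_def)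

lemma fm_subset_proj: "set P \<subseteq> set M \<Longrightarrow> set (fm P) \<subseteq> set (proj M)"
  unfolding set_proj set_fm by blast

lemma kscale_pos: "0 < kscale M"
  unfolding kscale_def by (induction M) auto

lemma kscale_dvd: "a \<in> set M \<Longrightarrow> hdd a \<noteq> 0 \<Longrightarrow> 2 * hdd a dvd kscale M"
  unfolding kscale_def by (induction M) (auto intro: dvd_mult)

lemma ldot_comb:
  assumes "length a = Suc (length v)" "length b = Suc (length v)"
  shows "ldot (comb a b) v = of_int (hdd a) * ldot (tl b) v - of_int (hdd b) * ldot (tl a) v"
proof -
  have "ldot (map2 (\<lambda>x y. p * y - q * x) a b) v = of_int p * ldot b v - of_int q * ldot a v"
    if "length a = length b" "length b = length v" for a b p q
    using that by (induction a b v rule: list_induct3) (simp_all add: algebra_simps)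
  then show ?thesis using assms by (simp add: comb_def)
qed

lemma ldot_rho: "length a = Suc (length v) \<Longrightarrow> hdd a \<noteq> 0 \<Longrightarrow>
    ldot a (t # v) = of_int (hdd a) * (t - rho a v)"
  by (cases a) (simp_all add: rho_def field_simps)

lemma ldot_hdd_0: "length a = Suc (length v) \<Longrightarrow> hdd a = 0 \<Longrightarrow> ldot a (t # v) = ldot (tl a) v"
  by (cases a) simp_all

lemma ldot_comb_rho:
  assumes "length a = Suc (length v)" "length b = Suc (length v)" "hdd a \<noteq> 0" "hdd b \<noteq> 0"
  shows "ldot (comb a b) v = of_int (hdd a) * of_int (hdd b) * (rho a v - rho b v)"
  unfolding ldot_comb[OF assms(1,2)] rho_def using assms(3,4) by (simp add: field_simps)

lemma floor_rho: "\<lfloor>rho a (map real_of_int v)\<rfloor> = rt a v"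
  using floor_divide_of_int_eq[of "- ldot (tl a) v" "hdd a", where 'a = real]
  by (simp add: rho_def rt_def)

lemma rt_exact:
  assumes "hdd a dvd ldot (tl a) v"
  shows "real_of_int (rt a v) = rho a (map real_of_int v)"
  using assms by (simp add: rho_def rt_def real_of_int_div)

lemma rt_scaled:
  assumes "a \<in> set M" "hdd a \<noteq> 0"
  shows "real_of_int (rt a (vscale (kscale M) w)) = rho a (map real_of_int (vscale (kscale M) w))"
    and "even (rt a (vscale (kscale M) w))"
proof -
  obtain c where c: "kscale M = 2 * hdd a * c" using kscale_dvd[OF assms] by (auto simp: dvd_def)
  show "real_of_int (rt a (vscale (kscale M) w)) = rho a (map real_of_int (vscale (kscale M) w))"
    by (rule rt_exact) (simp add: c)
  have "- ldot (tl a) (vscale (kscale M) w) = hdd a * (2 * (- c * ldot (tl a) w))" by (simp add: c)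
  then have "rt a (vscale (kscale M) w) = 2 * (- c * ldot (tl a) w)"
    unfolding rt_def using assms(2) by (metis nonzero_mult_div_cancel_left)
  then show "even (rt a (vscale (kscale M) w))" by simp
qed

text \<open>The order of the roots above \<open>y\<close> is read off from the signs of the projected forms.\<close>

lemma incell_rho_le:
  fixes y :: "'a::linordered_field list"
  assumes M: "\<forall>a\<in>set M. length a = Suc n" and len: "length w = n" "length y = n"
    and cell: "incell (proj M) w y"
    and ab: "a \<in> set M" "b \<in> set M" "hdd a \<noteq> 0" "hdd b \<noteq> 0"
    and le: "rho a (map real_of_int w) \<le> rho b (map real_of_int w)"
  shows "rho a y \<le> rho b y"
proof -
  have lens: "length a = Suc n" "length b = Suc n" using M ab by auto
  have mem: "comb a b \<in> set (proj M)" "comb b a \<in> set (proj M)" using ab by (auto simp: set_proj)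
  define c where "c = hdd a * hdd b"
  have w: "real_of_int (ldot (comb a b) w) = of_int c *
      (rho a (map real_of_int w) - rho b (map real_of_int w))"
    using ldot_comb_rho[of a "map real_of_int w" b] lens len ab by (simp add: c_def)
  have y: "ldot (comb a b) y = of_int c * (rho a y - rho b y)"
    using ldot_comb_rho[of a y b] lens len ab by (simp add: c_def)
  consider "0 < c" | "c < 0" unfolding c_def using ab by (meson linorder_neqE mult_eq_0_iff)
  then show ?thesis
  proof cases
    case 1
    then have "real_of_int (ldot (comb a b) w) \<le> 0" unfolding w using le
      by (intro mult_nonneg_nonpos) auto
    then have "ldot (comb a b) y \<le> 0" using cell mem by (simp add: incell_def)
    moreover have "0 < (of_int c :: 'a)" using 1 by simp
    ultimately show ?thesis unfolding y mult_le_0_iff by auto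
  next
    case 2
    then have "0 \<le> real_of_int (ldot (comb a b) w)" unfolding w using le
      by (intro mult_nonpos_nonpos) auto
    then have "0 \<le> ldot (comb a b) y" using cell mem by (simp add: incell_def)
    moreover have "(of_int c :: 'a) < 0" using 2 by simp
    ultimately show ?thesis unfolding y zero_le_mult_iff by auto
  qed
qed

lemma same_signs_rho_less:
  fixes y :: "'a::linordered_field list"
  assumes M: "\<forall>a\<in>set M. length a = Suc n" and len: "length w = n" "length y = n"
    and same: "same_signs (proj M) w y"
    and ab: "a \<in> set M" "b \<in> set M" "hdd a \<noteq> 0" "hdd b \<noteq> 0"
  shows "rho a (map real_of_int w) < rho b (map real_of_int w) \<longleftrightarrow> rho a y < rho b y"
proof -
  have lens: "length a = Suc n" "length b = Suc n" using M ab by auto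
  have "comb a b \<in> set (proj M)" using ab by (auto simp: set_proj)
  then have s: "0 < ldot (comb a b) w \<longleftrightarrow> 0 < ldot (comb a b) y"
      "ldot (comb a b) w < 0 \<longleftrightarrow> ldot (comb a b) y < 0"
    using same by (auto simp: same_signs_def)
  define c where "c = hdd a * hdd b"
  have w: "real_of_int (ldot (comb a b) w) = of_int c *
      (rho a (map real_of_int w) - rho b (map real_of_int w))"
    using ldot_comb_rho[of a "map real_of_int w" b] lens len ab by (simp add: c_def)
  have y: "ldot (comb a b) y = of_int c * (rho a y - rho b y)"
    using ldot_comb_rho[of a y b] lens len ab by (simp add: c_def)
  have sw: "0 < ldot (comb a b) w \<longleftrightarrow> 0 < real_of_int (ldot (comb a b) w)"
      "ldot (comb a b) w < 0 \<longleftrightarrow> real_of_int (ldot (comb a b) w) < 0" by simp_all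
  consider "0 < c" | "c < 0" unfolding c_def using ab by (meson linorder_neqE mult_eq_0_iff)
  then show ?thesis
  proof cases
    case 1
    then have "0 < (of_int c :: 'a)" "0 < (of_int c :: real)"
      by simp_all
    then show ?thesis using s(2) unfolding sw w y mult_less_0_iff by auto
  next
    case 2
    then have "(of_int c :: 'a) < 0" "(of_int c :: real) < 0"
      by simp_all
    then show ?thesis using s(1) unfolding sw w y zero_less_mult_iff by auto
  qed
qed

subsection \<open>Sample points of all cells\<close>

definition lifts :: "int list list \<Rightarrow> int list \<Rightarrow> int list list" where
  "lifts M w = (let w' = vscale (kscale M) w in
     (0 # w') # concat (map (\<lambda>a. [rt a w' # w', (rt a w' + 1) # w', (rt a w' - 1) # w']) M))"

text \<open>The last projection is lifted first. The recursion meant is \<open>samples_Suc\<close>;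
  the folded form fits the rules for computability.\<close>

definition samples :: "nat \<Rightarrow> int list list \<Rightarrow> int list list" where
  "samples n M = foldr (\<lambda>L acc. concat (map (lifts L) acc)) (map (\<lambda>i. (proj ^^ i) M) [0..<n]) [[]]"

lemma samples_0 [simp]: "samples 0 M = [[]]"
  by (simp add: samples_def)

lemma samples_Suc: "samples (Suc n) M = concat (map (lifts M) (samples n (proj M)))"
proof -
  have "map (\<lambda>i. (proj ^^ i) M) [0..<Suc n] = M # map (\<lambda>i. (proj ^^ i) (proj M)) [0..<n]"
    by (rule nth_equalityI) (auto simp: nth_Cons funpow_swap1 split: nat.split simp del: upt_Suc)
  then show ?thesis by (simp add: samples_def del: upt_Suc)
qed

lemma length_samples: "w \<in> set (samples n M) \<Longrightarrow> length w = n"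
  by (induction n arbitrary: M w) (auto simp: samples_Suc lifts_def Let_def)

text \<open>Distinct even integers leave room for an integer between them.\<close>

lemma separate_roots:
  fixes r :: "'i \<Rightarrow> int" and \<rho> :: "'i \<Rightarrow> real"
  assumes A: "finite A" and even: "\<And>a. a \<in> A \<Longrightarrow> even (r a)"
    and ord: "\<And>a b. a \<in> A \<Longrightarrow> b \<in> A \<Longrightarrow> r a < r b \<longleftrightarrow> \<rho> a < \<rho> b"
  shows "\<exists>t'\<in>{0} \<union> (\<Union>a\<in>A. {r a, r a + 1, r a - 1}).
    \<forall>a\<in>A. (r a < t' \<longleftrightarrow> \<rho> a < t) \<and> (t' < r a \<longleftrightarrow> t < \<rho> a)"
proof -
  have gap: "r a + 1 < r b" if "a \<in> A" "b \<in> A" "\<rho> a < \<rho> b" for a b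
  proof -
    have "r a < r b" "even (r a)" "even (r b)" using ord even that by auto
    then show ?thesis by presburger
  qed
  have le: "r a \<le> r b \<longleftrightarrow> \<rho> a \<le> \<rho> b" if "a \<in> A" "b \<in> A" for a b
    using ord[OF that(2,1)] by linarith
  \<comment> \<open>The point \<open>t\<close> will be replaced by a root, by one more than the
    largest root below it, or, if it is below all roots, by one less than the smallest.\<close>
  consider (root) a where "a \<in> A" "\<rho> a = t"
    | (above) "\<forall>a\<in>A. \<rho> a \<noteq> t" "\<exists>a\<in>A. \<rho> a < t"
    | (below) "\<forall>a\<in>A. t < \<rho> a" "A \<noteq> {}"
    | (empty) "A = {}"
    by (metis equals0I linorder_less_linear)
  then show ?thesis
  proof cases
    case (root a)
    then show ?thesis using ord by (intro bexI[of _ "r a"]) auto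
  next
    case above
    let ?L = "{a\<in>A. \<rho> a < t}"
    have "finite (\<rho> ` ?L)" "\<rho> ` ?L \<noteq> {}" using A above by auto
    from Max_in[OF this] obtain a where a: "a \<in> A" "\<rho> a < t" "\<rho> a = Max (\<rho> ` ?L)" by auto
    have max: "\<rho> b \<le> \<rho> a" if "b \<in> A" "\<rho> b < t" for b
      unfolding a(3) using A that by (intro Max_ge) auto
    have "(r b < r a + 1 \<longleftrightarrow> \<rho> b < t) \<and> (r a + 1 < r b \<longleftrightarrow> t < \<rho> b)" if b: "b \<in> A" for b
    proof (cases "\<rho> b < t")
      case True
      then show ?thesis using le[OF b a(1)] max[OF b] by auto
    next
      case False
      then have "t < \<rho> b" using above(1) b by force
      then show ?thesis using gap[OF a(1) b] a(2) by auto
    qed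
    then show ?thesis using a(1) by (intro bexI[of _ "r a + 1"]) auto
  next
    case below
    have "finite (\<rho> ` A)" "\<rho> ` A \<noteq> {}" using A below by auto
    from Min_in[OF this] obtain a where a: "a \<in> A" "\<rho> a = Min (\<rho> ` A)" by auto
    have min: "\<rho> a \<le> \<rho> b" if "b \<in> A" for b
      unfolding a(2) using A that by (intro Min_le) auto
    have "(r b < r a - 1 \<longleftrightarrow> \<rho> b < t) \<and> (r a - 1 < r b \<longleftrightarrow> t < \<rho> b)" if b: "b \<in> A" for b
      using le[OF a(1) b] min[OF b] below b by force
    then show ?thesis using a(1) by (intro bexI[of _ "r a - 1"]) auto
  qed auto
qed

text \<open>Cylindrical decomposition. The roots above the sample found for the projection are
  ordered like those above \<open>y\<close>, so \<open>t\<close> can be replaced by an integer in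
  the same position among them. The position determines the signs of all forms with nonzero leading
  coefficient; the other forms are among the projected ones.\<close>

lemma samples_complete:
  fixes v :: "real list"
  assumes "\<forall>a\<in>set M. length a = n" "length v = n"
  shows "\<exists>w\<in>set (samples n M). same_signs M w v"
  using assms
proof (induction n arbitrary: M v)
  case 0
  then show ?case by (auto simp: same_signs_def)
next
  case (Suc n)
  obtain t y where v: "v = t # y" "length y = n" using Suc.prems(2) by (cases v) auto
  obtain w where w: "w \<in> set (samples n (proj M))" "same_signs (proj M) w y"
    using Suc.IH[OF length_proj[OF Suc.prems(1)] v(2)] by blast
  define w' where "w' = vscale (kscale M) w"
  have lw: "length w' = n" using length_samples[OF w(1)] by (simp add: w'_def)
  have same: "same_signs (proj M) w' y"
    using w(2) kscale_pos[of M] by (auto simp: same_signs_def w'_def zero_less_mult_iff mult_less_0_iff)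
  define A where "A = {a\<in>set M. hdd a \<noteq> 0}"
  have rt: "real_of_int (rt a w') = rho a (map real_of_int w')" "even (rt a w')" if "a \<in> A" for a
    using rt_scaled[of a M w] that by (auto simp: A_def w'_def)
  have ord: "rt a w' < rt b w' \<longleftrightarrow> rho a y < rho b y" if "a \<in> A" "b \<in> A" for a b
    using same_signs_rho_less[OF Suc.prems(1) lw v(2) same, of a b] rt[OF that(1)] rt[OF that(2)] that
    by (auto simp: A_def simp flip: of_int_less_iff[where 'a = real])
  have "\<exists>t'\<in>{0} \<union> (\<Union>a\<in>A. {rt a w', rt a w' + 1, rt a w' - 1}).
      \<forall>a\<in>A. (rt a w' < t' \<longleftrightarrow> rho a y < t) \<and> (t' < rt a w' \<longleftrightarrow> t < rho a y)"
    by (rule separate_roots[OF _ rt(2) ord]) (auto simp: A_def)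
  then obtain t' where t': "t' \<in> {0} \<union> (\<Union>a\<in>A. {rt a w', rt a w' + 1, rt a w' - 1})"
    and s: "\<And>a. a \<in> A \<Longrightarrow> (rt a w' < t' \<longleftrightarrow> rho a y < t) \<and> (t' < rt a w' \<longleftrightarrow> t < rho a y)"
    by blast
  have "t' # w' \<in> set (lifts M w)"
    using t' by (auto simp: lifts_def A_def w'_def[symmetric] Let_def)
  then have "t' # w' \<in> set (samples (Suc n) M)" using w(1) by (auto simp: samples_Suc)
  moreover have "same_signs M (t' # w') v"
    unfolding same_signs_def
  proof
    fix a assume a: "a \<in> set M"
    then have la: "length a = Suc n" using Suc.prems(1) by simp
    show "(0 < ldot a (t' # w')) = (0 < ldot a v) \<and> (ldot a (t' # w') < 0) = (ldot a v < 0)"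
    proof (cases "hdd a = 0")
      case True
      have "tl a \<in> set (proj M)" using a by (auto simp: set_proj)
      then show ?thesis using same True la lw v
        by (simp add: same_signs_def ldot_hdd_0)
    next
      case False
      then have aA: "a \<in> A" using a by (simp add: A_def)
      have "real_of_int (ldot a (t' # w')) = of_int (hdd a) * (of_int t' - of_int (rt a w'))"
        using ldot_rho[of a "map real_of_int w'" "of_int t'"] la lw False rt(1)[OF aA]
        by (simp flip: ldot_of_int)
      then have 1: "ldot a (t' # w') = hdd a * (t' - rt a w')"
        by (simp flip: of_int_diff of_int_mult)
      have 2: "ldot a v = of_int (hdd a) * (t - rho a y)"
        using ldot_rho[of a y t] la v False by simp
      show ?thesis unfolding 1 2 zero_less_mult_iff mult_less_0_iff using s[OF aA] by auto
    qed
  qed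
  ultimately show ?case by blast
qed

subsection \<open>Fourier--Motzkin elimination\<close>

lemma fm_sound:
  assumes P: "\<forall>a\<in>set P. length a = Suc (length y)" and "incone P (t # y)"
  shows "incone (fm P) (y :: int list)"
  unfolding incone_def
proof
  fix c assume "c \<in> set (fm P)"
  then consider a where "a \<in> set P" "hdd a = 0" "c = tl a"
    | a b where "a \<in> set P" "b \<in> set P" "0 < hdd a" "hdd b < 0" "c = comb a b"
    by (auto simp: set_fm)
  then show "0 \<le> ldot c y"
  proof cases
    case 1
    then show ?thesis using assms by (auto simp: incone_def ldot_hdd_0[of a y t])
  next
    case 2
    have l: "length a = Suc (length y)" "length b = Suc (length y)" using P 2 by auto
    have *: "ldot a (t # y) = hdd a * t + ldot (tl a) y" "ldot b (t # y) = hdd b * t + ldot (tl b) y"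
      using l by (cases a; simp; fail) (use l in \<open>cases b; simp\<close>)
    have "0 \<le> ldot a (t # y)" "0 \<le> ldot b (t # y)" using assms(2) 2 by (auto simp: incone_def)
    then have "0 \<le> (- hdd b) * ldot a (t # y) + hdd a * ldot b (t # y)"
      using 2 by (intro add_nonneg_nonneg mult_nonneg_nonneg) auto
    then show ?thesis using 2 by (simp add: ldot_comb[OF l] * algebra_simps)
  qed
qed

text \<open>Above the scaled point all roots are integers, so the largest lower bound, or the
  smallest upper bound if there is no lower one, is an admissible integer \<open>t\<close>.\<close>

lemma fm_complete:
  assumes P: "\<forall>a\<in>set P. length a = Suc (length y)" and cone: "incone (fm P) y"
  shows "\<exists>t. incone P (t # vscale (kscale P) y)"
proof -
  define w where "w = vscale (kscale P) y"
  define A where "A = {a\<in>set P. 0 < hdd a}"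
  define B where "B = {b\<in>set P. hdd b < 0}"
  have AB: "finite A" "finite B" by (auto simp: A_def B_def)
  have lw: "length w = length y" by (simp add: w_def)
  have conew: "incone (fm P) w" using cone kscale_pos[of P] by (auto simp: incone_def w_def)
  have form: "ldot a (t # w) = hdd a * (t - rt a w)" if "a \<in> set P" "hdd a \<noteq> 0" for a t
  proof -
    have "real_of_int (ldot a (t # w)) = of_int (hdd a) * (of_int t - of_int (rt a w))"
      using ldot_rho[of a "map real_of_int w" "of_int t"] P that rt_scaled(1)[OF that, of y] lw
      by (simp add: w_def flip: ldot_of_int)
    then show ?thesis by (simp flip: of_int_diff of_int_mult)
  qed
  have le: "rt a w \<le> rt b w" if "a \<in> A" "b \<in> B" for a b
  proof -
    have a: "a \<in> set P" "0 < hdd a" and b: "b \<in> set P" "hdd b < 0" using that by (auto simp: A_def B_def)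
    have "comb a b \<in> set (fm P)" using a b by (auto simp: set_fm)
    then have "0 \<le> ldot (comb a b) w" using conew by (simp add: incone_def)
    also have "\<dots> = hdd a * ldot (tl b) w - hdd b * ldot (tl a) w"
      using ldot_comb[of a w b] P a b lw by simp
    also have "ldot (tl b) w = - hdd b * rt b w"
      using form[of b 0] P b lw by (cases b) auto
    also have "ldot (tl a) w = - hdd a * rt a w"
      using form[of a 0] P a lw by (cases a) auto
    finally have "0 \<le> (hdd a * - hdd b) * (rt b w - rt a w)" by (simp add: algebra_simps)
    moreover have "0 < hdd a * - hdd b" using a b by (intro mult_pos_pos) auto
    ultimately show ?thesis by (simp only: zero_le_mult_iff) linarith
  qed
  have "\<exists>t. (\<forall>a\<in>A. rt a w \<le> t) \<and> (\<forall>b\<in>B. t \<le> rt b w)"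
  proof (cases "A = {}")
    case False
    let ?m = "Max ((\<lambda>a. rt a w) ` A)"
    have "?m \<in> (\<lambda>a. rt a w) ` A" using False AB by (intro Max_in) auto
    then obtain a where a: "a \<in> A" "rt a w = ?m" by force
    have "\<forall>b\<in>B. ?m \<le> rt b w" using le[OF a(1)] unfolding a(2) by blast
    moreover have "\<forall>a\<in>A. rt a w \<le> ?m" using AB by auto
    ultimately show ?thesis by blast
  next
    case True
    show ?thesis
    proof (cases "B = {}")
      case False
      then show ?thesis using True AB by (intro exI[of _ "Min ((\<lambda>a. rt a w) ` B)"]) auto
    qed (use True in auto)
  qed
  then obtain t where t: "\<forall>a\<in>A. rt a w \<le> t" "\<forall>b\<in>B. t \<le> rt b w" by blast
  have "0 \<le> ldot a (t # w)" if a: "a \<in> set P" for a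
  proof -
    consider "a \<in> A" | "a \<in> B" | "hdd a = 0"
      using a by (cases "hdd a" "0::int" rule: linorder_cases) (auto simp: A_def B_def)
    then show ?thesis
    proof cases
      case 1
      then show ?thesis using form[OF a, of t] t by (auto simp: A_def)
    next
      case 2
      then show ?thesis using form[OF a, of t] t by (auto simp: B_def mult_nonpos_nonpos)
    next
      case 3
      then have "tl a \<in> set (fm P)" using a by (auto simp: set_fm)
      then show ?thesis using conew 3 P a lw by (simp add: incone_def ldot_hdd_0)
    qed
  qed
  then show ?thesis by (auto simp: incone_def w_def)
qed

subsection \<open>Counting by iterated summation\<close>

text \<open>Insertion by two filters, so that sorting uses only operations with computability
  rules.\<close>

definition insert_by :: "('a \<Rightarrow> int) \<Rightarrow> 'a \<Rightarrow> 'a list \<Rightarrow> 'a list" where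
  "insert_by f x ys = filter (\<lambda>y. f y < f x) ys @ x # filter (\<lambda>y. f x \<le> f y) ys"

definition sort_by :: "('a \<Rightarrow> int) \<Rightarrow> 'a list \<Rightarrow> 'a list" where
  "sort_by f xs = foldr (insert_by f) xs []"

lemma set_sort_by [simp]: "set (sort_by f xs) = set xs"
  unfolding sort_by_def by (induction xs) (auto simp: insert_by_def)

lemma sorted_sort_by: "sorted (map f (sort_by f xs))"
proof (induction xs)
  case (Cons x xs)
  then show ?case
    by (auto simp: sort_by_def insert_by_def sorted_append sorted_wrt_map sorted_wrt_filter
        intro: order.strict_implies_order)
qed (simp add: sort_by_def)

text \<open>Only roots inside the cone of \<open>P\<close> are kept. If \<open>P\<close> is
  contained in \<open>M\<close> and bounds the fibre on both sides, the end points of the fibre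
  above a scaled sample are roots of forms of \<open>P\<close>, so they are the first and the last
  root in the list.\<close>

definition roots :: "int list list \<Rightarrow> int list list \<Rightarrow> int list \<Rightarrow> int list list" where
  "roots P M w = sort_by (\<lambda>a. rt a w) (filter (\<lambda>a. hdd a \<noteq> 0 \<and> incone P (rt a w # w)) M)"

text \<open>An entry consists of a sign, a sample for the next cell and a lattice point with one
  more coordinate. The second list covers reversed end points, in agreement with
  \<open>ssum\<close>.\<close>

definition seg :: "int \<Rightarrow> int \<Rightarrow> int list \<Rightarrow> int list \<Rightarrow> int \<Rightarrow> (int \<times> int list \<times> int list) list" where
  "seg lo hi w y sg =
     map (\<lambda>t. (sg, w, t # y)) [lo + 1..hi] @ map (\<lambda>t. (- sg, w, t # y)) [hi + 1..lo]"

text \<open>The fibre above \<open>y\<close> is cut at the roots \<open>r\<^sub>1 \<le> r\<^sub>2 \<le> \<dots>\<close> into \<open>[r\<^sub>1, r\<^sub>1]\<close>, \<open>(r\<^sub>1, r\<^sub>2]\<close>,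
  \<open>\<dots>\<close>.  Unlike open intervals, these never produce the count \<open>-1\<close> when two roots coincide, so the
  polynomial formula for the count stays valid on the boundary of the cell.\<close>

definition expand :: "int list list \<times> int list list \<Rightarrow> int \<times> int list \<times> int list \<Rightarrow>
    (int \<times> int list \<times> int list) list" where
  "expand L x = (case L of (P, M) \<Rightarrow> case x of (sg, w, y) \<Rightarrow>
     let w' = vscale (kscale M) w; R = roots P M w' in
     case R of [] \<Rightarrow> []
     | a # as \<Rightarrow> seg (- (ldot (tl a) y div hdd a) - 1) (rt a y) (rt a w' # w') y sg @
         concat (map (\<lambda>(a, b). seg (rt a y) (rt b y) ((rt b w' - 1) # w') y sg) (zip R (tl R))))"

text \<open>A signed count of the leaves of the summation, extrapolated from the cell of \<open>w\<close>.\<close>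

definition qval :: "(int list list \<times> int list list) list \<Rightarrow> int list \<Rightarrow> int list \<Rightarrow> int" where
  "qval Ls w y = sum_list (map fst (fold (\<lambda>L acc. concat (map (expand L) acc)) Ls [(1, w, y)]))"

lemma qval_Nil [simp]: "qval [] w y = 1"
  by (simp add: qval_def)

lemma seg_sign: "seg lo hi w y sg = map (\<lambda>(s, z). (sg * s, z)) (seg lo hi w y 1)"
  by (simp add: seg_def)

lemma expand_sign: "expand L (sg, z) = map (\<lambda>(s, z). (sg * s, z)) (expand L (1, z))"
proof -
  obtain w y where z: "z = (w, y)" by fastforce
  show ?thesis
    unfolding expand_def z Let_def prod.case
    by (subst (1 2) seg_sign) (auto split: list.split prod.split simp: map_concat o_def case_prod_unfold)
qed

lemma sum_list_concat_map: "sum_list (map g (concat (map f xs))) = (\<Sum>x\<leftarrow>xs. \<Sum>y\<leftarrow>f x. (g y :: int))"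
  by (induction xs) simp_all

lemma qval_worklist:
  "sum_list (map fst (fold (\<lambda>L acc. concat (map (expand L) acc)) Ls acc)) =
    (\<Sum>(sg, w, y)\<leftarrow>acc. sg * qval Ls w y)"
proof (induction Ls arbitrary: acc)
  case Nil
  then show ?case by (simp add: case_prod_beta')
next
  case (Cons L Ls)
  let ?g = "\<lambda>(sg, w, y). sg * qval Ls w y"
  have step: "qval (L # Ls) w y = (\<Sum>x\<leftarrow>expand L (1, w, y). ?g x)" for w y
    by (simp add: qval_def[of "L # Ls"] Cons.IH)
  have "(\<Sum>x\<leftarrow>expand L (sg, w, y). ?g x) = sg * qval (L # Ls) w y" for sg w y
    unfolding step by (subst expand_sign)
      (simp add: o_def case_prod_beta' mult.assoc sum_list_const_mult)
  then have "(\<Sum>x\<leftarrow>expand L x. ?g x) = (\<lambda>(sg, w, y). sg * qval (L # Ls) w y) x" for x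
    by (cases x) auto
  then show ?case by (simp add: Cons.IH sum_list_concat_map)
qed

lemma sum_list_upto: "(\<Sum>t\<leftarrow>[a + 1..b]. f t) = (\<Sum>t\<in>{a<..b}. f t :: int)"
  by (simp add: sum_list_distinct_conv_sum_set atLeastPlusOneAtMost_greaterThanAtMost_int)

lemma sum_seg:
  "(\<Sum>(s, w', y')\<leftarrow>seg lo hi w y 1. s * g w' y') = ssum lo hi (\<lambda>t. g w (t # y))"
  by (simp add: seg_def ssum_def o_def sum_list_upto sum_negf)

text \<open>The recursion that the worklist flattens. Which summands occur and which samples they
  use depends on \<open>w\<close> alone; \<open>y\<close> enters only through end points and
  arguments.\<close>

lemma qval_Cons:
  assumes "w' = vscale (kscale M) w"
  shows "qval ((P, M) # Ls) w y = (case roots P M w' of [] \<Rightarrow> 0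
    | a # as \<Rightarrow> ssum (- (ldot (tl a) y div hdd a) - 1) (rt a y) (\<lambda>t. qval Ls (rt a w' # w') (t # y)) +
        (\<Sum>(a, b)\<leftarrow>zip (a # as) as. ssum (rt a y) (rt b y) (\<lambda>t. qval Ls ((rt b w' - 1) # w') (t # y))))"
proof -
  let ?g = "\<lambda>(sg, w, y). sg * qval Ls w y"
  have "qval ((P, M) # Ls) w y = (\<Sum>x\<leftarrow>expand (P, M) (1, w, y). ?g x)"
    by (simp add: qval_def[of "_ # Ls"] qval_worklist)
  also have "\<dots> = (case roots P M w' of [] \<Rightarrow> 0
    | a # as \<Rightarrow> ssum (- (ldot (tl a) y div hdd a) - 1) (rt a y) (\<lambda>t. qval Ls (rt a w' # w') (t # y)) +
        (\<Sum>(a, b)\<leftarrow>zip (a # as) as. ssum (rt a y) (rt b y) (\<lambda>t. qval Ls ((rt b w' - 1) # w') (t # y))))"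
    unfolding expand_def assms[symmetric] Let_def prod.case
    by (auto split: list.split simp: sum_list_concat_map sum_seg case_prod_beta' sum_seg[unfolded case_prod_beta'])
  finally show ?thesis .
qed

subsection \<open>Quasi-polynomiality of the count\<close>

fun levels_ok :: "nat \<Rightarrow> (int list list \<times> int list list) list \<Rightarrow> bool" where
  "levels_ok n [] \<longleftrightarrow> True"
| "levels_ok n ((P, M) # Ls) \<longleftrightarrow> (\<forall>a\<in>set M. length a = Suc n) \<and> levels_ok (Suc n) Ls"

text \<open>Each summation multiplies the period by the scale factor of its level.\<close>

definition period :: "(int list list \<times> int list list) list \<Rightarrow> int" where
  "period Ls = prod_list (map (\<lambda>L. kscale (snd L)) Ls)"

lemma period_pos: "0 < period Ls"
  unfolding period_def by (induction Ls) (auto simp: kscale_pos)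

text \<open>Since \<open>hdd a\<close> divides \<open>kscale M\<close>, the shift changes
  \<open>ldot (tl a) v\<close> by a multiple of \<open>N * hdd a\<close>; so the quotients, although
  rounded, move by an exact multiple of \<open>N\<close>.\<close>

lemma rt_shift:
  assumes "a \<in> set M" "hdd a \<noteq> 0" "length u = length v"
  shows "\<exists>c. \<forall>v. length v = length u \<longrightarrow>
      rt a (vadd v (vscale (N * kscale M) u)) = rt a v + N * c \<and>
      ldot (tl a) (vadd v (vscale (N * kscale M) u)) div hdd a = ldot (tl a) v div hdd a - N * c"
proof -
  obtain k where k: "kscale M = 2 * hdd a * k" using kscale_dvd[OF assms(1,2)] by (auto simp: dvd_def)
  show ?thesis
  proof (intro exI[of _ "- 2 * k * ldot (tl a) u"] allI impI conjI)
    fix v :: "int list" assume "length v = length u"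
    then have 1: "ldot (tl a) (vadd v (vscale (N * kscale M) u)) =
        ldot (tl a) v + hdd a * (N * 2 * k * ldot (tl a) u)"
      by (simp add: ldot_vadd k)
    then have 2: "- ldot (tl a) (vadd v (vscale (N * kscale M) u)) =
        - ldot (tl a) v + hdd a * (- (N * 2 * k * ldot (tl a) u))" by simp
    show "rt a (vadd v (vscale (N * kscale M) u)) = rt a v + N * (- 2 * k * ldot (tl a) u)"
      unfolding rt_def 2 using assms(2) by (subst div_mult_self2) auto
    show "ldot (tl a) (vadd v (vscale (N * kscale M) u)) div hdd a =
        ldot (tl a) v div hdd a - N * (- 2 * k * ldot (tl a) u)"
      unfolding 1 using assms(2) by (subst div_mult_self2) auto
  qed
qed

text \<open>For a fixed sample the branching is fixed, so \<open>qval Ls w\<close> is one sum of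
  terms accessible to \<open>vpol_ssum\<close>, an oriented sum between two variable ends being a
  difference of sums that start at \<open>0\<close>. Every level raises the degree by one.\<close>

lemma qval_vpol:
  assumes "levels_ok n Ls"
  shows "vpol (period Ls) n (Suc (length Ls)) (qval Ls w)"
  using assms
proof (induction Ls arbitrary: n w)
  case Nil
  have "qval [] w = (\<lambda>_. 1)" by (rule ext) simp
  then show ?case by simp
next
  case (Cons L Ls)
  obtain P M where L: "L = (P, M)" by fastforce
  define w' where w': "w' = vscale (kscale M) w"
  let ?N = "period Ls" and ?d = "Suc (length Ls)"
  have per: "period (L # Ls) = ?N * kscale M" by (simp add: period_def L)
  have IH: "vpol ?N (Suc n) ?d (qval Ls u)" for u using Cons.IH[of "Suc n"] Cons.prems L by simp
  have mem: "a \<in> set M" "hdd a \<noteq> 0" if "a \<in> set (roots P M w')" for a using that by (auto simp: roots_def)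
  have S: "vpol (?N * kscale M) n (Suc ?d) (\<lambda>y. ssum (lo y) (hi y) (\<lambda>t. qval Ls u (t # y)))"
    if lo: "\<And>u. length u = n \<Longrightarrow> \<exists>c. \<forall>v\<in>vecs n. lo (vadd v (vscale (?N * kscale M) u)) = lo v + ?N * c"
    and hi: "\<And>u. length u = n \<Longrightarrow> \<exists>c. \<forall>v\<in>vecs n. hi (vadd v (vscale (?N * kscale M) u)) = hi v + ?N * c"
    for lo hi u
  proof -
    have "vpol (?N * kscale M) n (Suc ?d) (\<lambda>y. ssum 0 (hi y) (\<lambda>t. qval Ls u (t # y)) -
        ssum 0 (lo y) (\<lambda>t. qval Ls u (t # y)))"
      by (rule dpol_diff[OF vpol_ssum[OF IH hi] vpol_ssum[OF IH lo]])
    moreover have "ssum 0 b g - ssum 0 a g = ssum a b g" for a b and g :: "int \<Rightarrow> int"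
      using ssum_join[of 0 a g b] by linarith
    ultimately show ?thesis by simp
  qed
  have rt: "\<exists>c. \<forall>v\<in>vecs n. rt a (vadd v (vscale (?N * kscale M) u)) = rt a v + ?N * c"
    if "a \<in> set (roots P M w')" "length u = n" for a u
    using rt_shift[OF mem[OF that(1)], of u u ?N] that(2) by (auto simp: vecs_def)
  have div: "\<exists>c. \<forall>v\<in>vecs n. - (ldot (tl a) (vadd v (vscale (?N * kscale M) u)) div hdd a) - 1 =
      - (ldot (tl a) v div hdd a) - 1 + ?N * c"
    if a: "a \<in> set (roots P M w')" and u: "length u = n" for a u
  proof -
    obtain c where "\<forall>v. length v = length u \<longrightarrow>
        ldot (tl a) (vadd v (vscale (?N * kscale M) u)) div hdd a = ldot (tl a) v div hdd a - ?N * c"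
      using rt_shift[OF mem[OF a], of u u ?N] by blast
    then show ?thesis using u by (intro exI[of _ c]) (simp add: vecs_def)
  qed
  show ?case
  proof (cases "roots P M w'")
    case Nil
    then have "qval (L # Ls) w = (\<lambda>_. 0)" by (intro ext) (simp add: L qval_Cons[OF w'])
    then show ?thesis by (simp only: dpol_zero)
  next
    case (Cons a as)
    have mem_zip: "fst p \<in> set (roots P M w')" "snd p \<in> set (roots P M w')"
      if "p \<in> set (zip (a # as) as)" for p
      using that set_zip_leftD[of "fst p" "snd p" "a # as" as]
        set_zip_rightD[of "fst p" "snd p" "a # as" as] Cons by auto
    have a_mem: "a \<in> set (roots P M w')" using Cons by simp
    have "vpol (?N * kscale M) n (Suc ?d) (\<lambda>y. ssum (- (ldot (tl a) y div hdd a) - 1) (rt a y)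
          (\<lambda>t. qval Ls (rt a w' # w') (t # y)) +
        (\<Sum>x\<leftarrow>zip (a # as) as. ssum (rt (fst x) y) (rt (snd x) y)
          (\<lambda>t. qval Ls ((rt (snd x) w' - 1) # w') (t # y))))"
      by (intro dpol_add dpol_sum_list S rt div mem_zip a_mem)
    moreover have "qval (L # Ls) w = (\<lambda>y. ssum (- (ldot (tl a) y div hdd a) - 1) (rt a y)
          (\<lambda>t. qval Ls (rt a w' # w') (t # y)) +
        (\<Sum>x\<leftarrow>zip (a # as) as. ssum (rt (fst x) y) (rt (snd x) y)
          (\<lambda>t. qval Ls ((rt (snd x) w' - 1) # w') (t # y))))"
      by (intro ext) (simp add: L qval_Cons[OF w'] Cons case_prod_beta')
    ultimately show ?thesis unfolding per by simp
  qed
qed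

subsection \<open>The count agrees with its extrapolation on every closed cell\<close>

text \<open>Two systems carried along together: the inequalities of the projected cone, and the
  larger system of forms whose cells refine it.\<close>

definition level :: "int list list \<Rightarrow> nat \<Rightarrow> int list list \<times> int list list" where
  "level D j = ((\<lambda>(P, M). (fm P, proj M)) ^^ j) (D, D)"

text \<open>Reversed, because the coordinate eliminated last is the first to be summed over.\<close>

definition levels :: "int list list \<Rightarrow> nat \<Rightarrow> (int list list \<times> int list list) list" where
  "levels D j = map (level D) (rev [0..<j])"

definition sols :: "int list list \<Rightarrow> nat \<Rightarrow> int list \<Rightarrow> int list set" where
  "sols D j v = {xs. length xs = j \<and> incone D (xs @ v)}"

lemma level_0 [simp]: "level D 0 = (D, D)"
  by (simp add: level_def)

lemma level_Suc: "level D (Suc j) = (fm (fst (level D j)), proj (snd (level D j)))"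
  by (simp add: level_def case_prod_unfold)

lemma levels_0 [simp]: "levels D 0 = []"
  by (simp add: levels_def)

lemma levels_Suc: "levels D (Suc j) = level D j # levels D j"
  by (simp add: levels_def)

lemma level_subset: "set (fst (level D j)) \<subseteq> set (snd (level D j))"
  by (induction j) (simp_all add: level_Suc fm_subset_proj)

lemma level_length:
  assumes "\<forall>a\<in>set D. length a = j + n"
  shows "\<forall>a\<in>set (snd (level D j)). length a = n"
  using assms
proof (induction j arbitrary: n)
  case (Suc j)
  then show ?case unfolding level_Suc snd_conv by (intro length_proj) auto
qed simp

lemma levels_ok_levels: "\<forall>a\<in>set D. length a = j + n \<Longrightarrow> levels_ok n (levels D j)"
proof (induction j arbitrary: n)
  case (Suc j)
  obtain P M where PM: "level D j = (P, M)" by fastforce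
  show ?case using Suc.IH[of "Suc n"] Suc.prems level_length[of D j "Suc n"] by (simp add: levels_Suc PM)
qed simp

lemma sols_Suc: "sols D (Suc j) v = (\<Union>t. (\<lambda>xs. xs @ [t]) ` sols D j (t # v))"
proof -
  have "xs \<in> (\<Union>t. (\<lambda>xs. xs @ [t]) ` sols D j (t # v))" if "xs \<in> sols D (Suc j) v" for xs
    using that by (cases xs rule: rev_cases) (auto simp: sols_def)
  then show ?thesis by (auto simp: sols_def)
qed

lemma sols_level:
  assumes "\<forall>a\<in>set D. length a = j + length v" "xs \<in> sols D j v"
  shows "incone (fst (level D j)) v"
  using assms
proof (induction j arbitrary: v xs)
  case 0
  then show ?case by (auto simp: sols_def)
next
  case (Suc j)
  obtain t ys where "ys \<in> sols D j (t # v)" using Suc.prems(2) by (auto simp: sols_Suc)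
  then have "incone (fst (level D j)) (t # v)" using Suc.IH[of "t # v"] Suc.prems(1) by auto
  moreover have "\<forall>a\<in>set (fst (level D j)). length a = Suc (length v)"
    using level_length[of D j "Suc (length v)"] level_subset[of D j] Suc.prems(1) by auto
  ultimately show ?case unfolding level_Suc fst_conv by (intro fm_sound)
qed

text \<open>Converse of \<open>sols_level\<close> up to a positive multiple: each step back through
  the elimination lifts an integral point after scaling by \<open>kscale\<close>.\<close>

lemma level_sols:
  assumes "\<forall>a\<in>set D. length a = j + length v" "incone (fst (level D j)) v"
  shows "\<exists>k xs. 0 < k \<and> xs \<in> sols D j (vscale k v)"
  using assms
proof (induction j arbitrary: v)
  case 0
  then show ?case by (intro exI[of _ 1]) (auto simp: sols_def)
next
  case (Suc j)
  let ?P = "fst (level D j)"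
  have "\<forall>a\<in>set ?P. length a = Suc (length v)"
    using level_length[of D j "Suc (length v)"] level_subset[of D j] Suc.prems(1) by auto
  from fm_complete[OF this] obtain t where t: "incone ?P (t # vscale (kscale ?P) v)"
    using Suc.prems(2) by (auto simp: level_Suc)
  from Suc.IH[OF _ this] Suc.prems(1) obtain k xs where k: "0 < k"
      "xs \<in> sols D j (vscale k (t # vscale (kscale ?P) v))" by auto
  then have "xs @ [k * t] \<in> sols D (Suc j) (vscale (k * kscale ?P) v)"
    by (auto simp: sols_Suc vscale_vscale)
  then show ?case using k(1) kscale_pos[of ?P] by (intro exI[of _ "k * kscale ?P"]) auto
qed

text \<open>If no form at level \<open>j\<close> has a leading coefficient of sign \<open>s\<close>,
  then the vector with first coordinate \<open>- s\<close> and all others \<open>0\<close> lies in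
  the projected cone. A multiple of it lifts to a nonzero solution over the zero parameters, against
  boundedness.\<close>

lemma two_sided:
  assumes D: "\<forall>a\<in>set D. length a = d + n" and j: "j < d"
    and bd: "\<And>xs. xs \<in> sols D d (replicate n 0) \<Longrightarrow> set xs \<subseteq> {0}"
    and s: "s = 1 \<or> s = -1"
  shows "\<exists>a\<in>set (fst (level D j)). 0 < s * hdd a"
proof (rule ccontr)
  assume neg: "\<not> ?thesis"
  define m where "m = d - Suc j"
  have m: "d = Suc (j + m)" using j by (simp add: m_def)
  let ?v = "(- s) # replicate (m + n) 0"
  have "incone (fst (level D j)) ?v"
    unfolding incone_def
  proof
    fix a assume a: "a \<in> set (fst (level D j))"
    then have "length a = Suc (m + n)"
      using level_length[of D j "Suc (m + n)"] level_subset[of D j] D m by auto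
    moreover have "s * hdd a \<le> 0" using neg a by force
    ultimately show "0 \<le> ldot a ?v" by (cases a) (auto simp: algebra_simps)
  qed
  from level_sols[OF _ this] D m obtain k xs where k: "0 < k" "xs \<in> sols D j (vscale k ?v)" by auto
  have "vscale k ?v = (- k * s) # replicate m 0 @ replicate n 0"
    by (simp add: vscale_def map_replicate_const replicate_add)
  then have "xs @ [- k * s] @ replicate m 0 \<in> sols D d (replicate n 0)"
    using k(2) by (simp add: sols_def m)
  from bd[OF this] show False using k(1) s by auto
qed

lemma ssum_chain:
  "ssum lo (f a) g + (\<Sum>(a, b)\<leftarrow>zip (a # as) as. ssum (f a) (f b) g) = ssum lo (f (last (a # as))) g"
proof (induction as arbitrary: lo a)
  case (Cons b as)
  have "ssum lo (f a) g + (\<Sum>(a, b)\<leftarrow>zip (a # b # as) (b # as). ssum (f a) (f b) g) =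
      ssum lo (f b) g + (\<Sum>(a, b)\<leftarrow>zip (b # as) as. ssum (f a) (f b) g)"
    by (simp add: ssum_join flip: add.assoc)
  then show ?case using Cons.IH[of lo b] by simp
qed simp

lemma ssum_cong: "lo \<le> hi \<Longrightarrow> (\<And>t. lo < t \<Longrightarrow> t \<le> hi \<Longrightarrow> f t = g t) \<Longrightarrow> ssum lo hi f = ssum lo hi g"
  by (auto simp: ssum_def)

lemma sorted_map_nth: "sorted (map f R) \<Longrightarrow> i \<le> j \<Longrightarrow> j < length R \<Longrightarrow> f (R ! i) \<le> f (R ! j)"
  using sorted_nth_mono[of "map f R" i j] by simp

lemma sorted_zip_tl:
  assumes "sorted (map f (a # as))" "(x, y) \<in> set (zip (a # as) as)" "c \<in> set (a # as)"
  shows "f c \<le> f x \<or> f y \<le> f c"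
proof -
  let ?R = "a # as"
  obtain i where i: "i < length as" "x = ?R ! i" "y = ?R ! Suc i"
    using assms(2) by (auto simp: in_set_zip)
  obtain k where k: "k < length ?R" "c = ?R ! k" using assms(3) by (metis in_set_conv_nth)
  have mono: "f (?R ! i) \<le> f (?R ! j)" if "i \<le> j" "j < length ?R" for i j
    using sorted_map_nth[OF assms(1)] that by blast
  show ?thesis
    using mono[of k i] mono[of "Suc i" k] i k by (cases "k \<le> i") auto
qed

lemma sorted_zip_tl_le:
  assumes "sorted (map f (a # as))" "(x, y) \<in> set (zip (a # as) as)"
  shows "f x \<le> f y"
  using assms by (induction as arbitrary: a) auto

text \<open>Summation over one coordinate. For \<open>y\<close> in the closed cell of
  \<open>w\<close>, the roots above \<open>y\<close> are ordered as above \<open>w'\<close>, except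
  that some may coincide. They cut the fibre into the first root and half-open intervals up to the
  following roots. A lattice point in such a piece lies in the closed cell of the sample chosen for
  the piece, where the summand is known by assumption \<open>F\<close>.\<close>

lemma fiber_sum:
  assumes M: "\<forall>a\<in>set M. length a = Suc n" and PM: "set P \<subseteq> set M"
    and sided: "\<exists>a\<in>set P. 0 < hdd a" "\<exists>a\<in>set P. hdd a < 0"
    and len: "length w = n" "length y = n"
    and conew: "incone (fm P) w" and cell: "incell (proj M) w y"
    and F0: "\<And>t. \<not> incone P (t # y) \<Longrightarrow> F t = 0"
    and F: "\<And>u t. length u = Suc n \<Longrightarrow> incone P u \<Longrightarrow> incell M u (t # y) \<Longrightarrow> F t = qval Ls u (t # y)"
  shows "finite {t. incone P (t # y)}"
    and "(\<Sum>t | incone P (t # y). F t) = qval ((P, M) # Ls) w y"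
proof -
  define w' where "w' = vscale (kscale M) w"
  define r where "r a = rt a w'" for a
  define \<rho> where "\<rho> a = rho a (map real_of_int y)" for a
  have lw: "length w' = n" using len by (simp add: w'_def)
  have conew': "incone (fm P) w'" using conew kscale_pos[of M] by (auto simp: incone_def w'_def)
  have cell': "incell (proj M) w' y" using cell kscale_pos[of M] by (simp add: incell_vscale w'_def)
  have coney: "incone (fm P) y"
    using conew' cell' fm_subset_proj[OF PM] by (auto simp: incone_def incell_def)
  have r: "real_of_int (r a) = rho a (map real_of_int w')" "even (r a)" if "a \<in> set M" "hdd a \<noteq> 0" for a
    using rt_scaled[OF that, of w] by (simp_all add: r_def w'_def)
  have ord: "\<rho> a \<le> \<rho> b" if "a \<in> set M" "b \<in> set M" "hdd a \<noteq> 0" "hdd b \<noteq> 0" "r a \<le> r b" for a b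
    unfolding \<rho>_def
    using incell_rho_le[OF M lw _ _ that(1-4), of "map real_of_int y"] len cell' that(5)
      r(1)[OF that(1,3), symmetric] r(1)[OF that(2,4), symmetric] by simp
  have formw: "ldot a (x # w') = hdd a * (x - r a)" if "a \<in> set M" "hdd a \<noteq> 0" for a x
  proof -
    have "real_of_int (ldot a (x # w')) = of_int (hdd a) * (of_int x - of_int (r a))"
      using ldot_rho[of a "map real_of_int w'" "of_int x"] M that r(1)[OF that] lw
      by (simp flip: ldot_of_int)
    then show ?thesis by (simp flip: of_int_diff of_int_mult)
  qed
  have formy: "real_of_int (ldot a (t # y)) = of_int (hdd a) * (of_int t - \<rho> a)"
    if "a \<in> set M" "hdd a \<noteq> 0" for a t
    using ldot_rho[of a "map real_of_int y" "of_int t"] M that len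
    by (simp add: \<rho>_def flip: ldot_of_int)
  have flat: "ldot a (x # w') = ldot (tl a) w'" "ldot a (t # y) = ldot (tl a) y" "tl a \<in> set (proj M)"
    if "a \<in> set M" "hdd a = 0" for a x t
    using M that lw len by (auto simp: ldot_hdd_0 set_proj)
  define R where "R = roots P M w'"
  have R: "a \<in> set R \<longleftrightarrow> a \<in> set M \<and> hdd a \<noteq> 0 \<and> incone P (r a # w')" for a
    by (auto simp: R_def roots_def r_def)
  have sorted: "sorted (map r R)"
    unfolding R_def roots_def r_def by (rule sorted_sort_by)
  have fm_le: "r p \<le> r q" if p: "p \<in> set P" "0 < hdd p" and q: "q \<in> set P" "hdd q < 0" for p q
  proof -
    have pq: "p \<in> set M" "q \<in> set M" using PM p q by auto
    have "comb p q \<in> set (fm P)" using p q by (auto simp: set_fm)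
    then have "0 \<le> real_of_int (ldot (comb p q) w')" using conew' by (simp add: incone_def)
    also have "\<dots> = of_int (hdd p) * of_int (hdd q) * (of_int (r p) - of_int (r q))"
      using ldot_comb_rho[of p "map real_of_int w'" q] M pq p q lw r by simp
    finally have "0 \<le> (hdd p * hdd q) * (r p - r q)"
      by (simp flip: of_int_diff of_int_mult)
    moreover have "hdd p * hdd q < 0" using p q by (simp add: mult_pos_neg)
    moreover have "c * x < 0" if "c < 0" "0 < x" for c x :: int
      using that by (rule mult_neg_pos)
    ultimately show ?thesis by (meson diff_gt_0_iff_gt not_le)
  qed
  \<comment> \<open>By \<open>fm_le\<close>, the largest root of a lower bound above
    \<open>w'\<close> satisfies all inequalities of \<open>P\<close>, so it is among the roots in
    \<open>R\<close>; \<open>up\<close> is the mirror image.\<close>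
  have low: "\<exists>p\<in>set P. 0 < hdd p \<and> p \<in> set R"
  proof -
    let ?A = "{a\<in>set P. 0 < hdd a}"
    have A: "finite (r ` ?A)" "r ` ?A \<noteq> {}" using sided(1) by auto
    from Max_in[OF this] obtain p where p: "p \<in> set P" "0 < hdd p" "r p = Max (r ` ?A)" by force
    have "0 \<le> ldot q (r p # w')" if q: "q \<in> set P" for q
    proof (cases "hdd q" "0::int" rule: linorder_cases)
      case less
      then show ?thesis using formw[of q "r p"] fm_le[OF p(1,2) q less] q PM
        by (auto simp: mult_nonpos_nonpos)
    next
      case equal
      then have "tl q \<in> set (fm P)" using q by (auto simp: set_fm)
      then show ?thesis using flat(1)[of q "r p"] equal q PM conew' by (auto simp: incone_def)
    next
      case greater
      then have "r q \<le> r p" unfolding p(3) using A(1) q by (intro Max_ge) auto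
      then show ?thesis using formw[of q "r p"] greater q PM by auto
    qed
    then show ?thesis using p PM by (intro bexI[of _ p]) (auto simp: R incone_def)
  qed
  have up: "\<exists>p\<in>set P. hdd p < 0 \<and> p \<in> set R"
  proof -
    let ?A = "{a\<in>set P. hdd a < 0}"
    have A: "finite (r ` ?A)" "r ` ?A \<noteq> {}" using sided(2) by auto
    from Min_in[OF this] obtain p where p: "p \<in> set P" "hdd p < 0" "r p = Min (r ` ?A)" by force
    have "0 \<le> ldot q (r p # w')" if q: "q \<in> set P" for q
    proof (cases "hdd q" "0::int" rule: linorder_cases)
      case greater
      then show ?thesis using formw[of q "r p"] fm_le[OF q greater p(1,2)] q PM by auto
    next
      case equal
      then have "tl q \<in> set (fm P)" using q by (auto simp: set_fm)
      then show ?thesis using flat(1)[of q "r p"] equal q PM conew' by (auto simp: incone_def)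
    next
      case less
      then have "r p \<le> r q" unfolding p(3) using A(1) q by (intro Min_le) auto
      then show ?thesis using formw[of q "r p"] less q PM by (auto simp: mult_nonpos_nonpos)
    qed
    then show ?thesis using p PM by (intro bexI[of _ p]) (auto simp: R incone_def)
  qed
  obtain a as where Ra: "R = a # as" using low by (cases R) auto
  define z where "z = last R"
  have az: "a \<in> set R" "z \<in> set R" using Ra by (auto simp: z_def)
  have a_le: "r a \<le> r c" if "c \<in> set R" for c
    using sorted that Ra by auto
  have le_z: "r c \<le> r z" if c: "c \<in> set R" for c
  proof -
    obtain k where k: "k < length R" "c = R ! k" using c by (metis in_set_conv_nth)
    have "R \<noteq> []" using Ra by simp
    then have "z = R ! (length R - 1)" by (simp add: z_def last_conv_nth)
    then show ?thesis using sorted_map_nth[OF sorted, of k "length R - 1"] k by simp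
  qed
  \<comment> \<open>Above \<open>w'\<close> the roots of lower bounds are at most \<open>r a\<close>
    and those of upper bounds at least \<open>r z\<close>, with equality attained;
    \<open>ord\<close> transports these comparisons to \<open>y\<close>.\<close>
  have T: "incone P (t # y) \<longleftrightarrow> \<rho> a \<le> of_int t \<and> of_int t \<le> \<rho> z" for t
  proof
    assume cone: "incone P (t # y)"
    obtain p where p: "p \<in> set P" "0 < hdd p" "p \<in> set R" using low by blast
    have "0 \<le> real_of_int (ldot p (t # y))" using cone p by (simp add: incone_def)
    also have "\<dots> = of_int (hdd p) * (of_int t - \<rho> p)" using p by (intro formy) (auto simp: R)
    finally have 1: "\<rho> p \<le> of_int t" using p by (auto simp: zero_le_mult_iff)
    obtain q where q: "q \<in> set P" "hdd q < 0" "q \<in> set R" using up by blast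
    have "0 \<le> real_of_int (ldot q (t # y))" using cone q by (simp add: incone_def)
    also have "\<dots> = of_int (hdd q) * (of_int t - \<rho> q)" using q by (intro formy) (auto simp: R)
    finally have 2: "of_int t \<le> \<rho> q" using q by (auto simp: zero_le_mult_iff)
    have "\<rho> a \<le> \<rho> p" "\<rho> q \<le> \<rho> z" using ord a_le[OF p(3)] le_z[OF q(3)] az p q by (auto simp: R)
    then show "\<rho> a \<le> of_int t \<and> of_int t \<le> \<rho> z" using 1 2 by linarith
  next
    assume t: "\<rho> a \<le> of_int t \<and> of_int t \<le> \<rho> z"
    have "0 \<le> ldot p (t # y)" if p: "p \<in> set P" for p
    proof (cases "hdd p" "0::int" rule: linorder_cases)
      case equal
      then have "tl p \<in> set (fm P)" using p by (auto simp: set_fm)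
      then show ?thesis using flat(2)[of p t] equal p PM coney by (auto simp: incone_def)
    next
      case greater
      have "0 \<le> ldot p (r a # w')" using az(1) p by (auto simp: R incone_def)
      then have "r p \<le> r a" using formw[of p "r a"] p PM greater by (auto simp: zero_le_mult_iff)
      then have "\<rho> p \<le> \<rho> a" using ord[of p a] az p PM greater by (auto simp: R)
      then have "0 \<le> of_int (hdd p) * (of_int t - \<rho> p)"
        using greater t by (intro mult_nonneg_nonneg) auto
      also have "\<dots> = real_of_int (ldot p (t # y))" using p PM greater by (intro formy[symmetric]) auto
      finally show ?thesis by simp
    next
      case less
      have "0 \<le> ldot p (r z # w')" using az(2) p by (auto simp: R incone_def)
      then have "r z \<le> r p" using formw[of p "r z"] p PM less by (auto simp: zero_le_mult_iff)
      then have "\<rho> z \<le> \<rho> p" using ord[of z p] az p PM less by (auto simp: R)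
      then have "0 \<le> of_int (hdd p) * (of_int t - \<rho> p)"
        using less t by (intro mult_nonpos_nonpos) auto
      also have "\<dots> = real_of_int (ldot p (t # y))" using p PM less by (intro formy[symmetric]) auto
      finally show ?thesis by simp
    qed
    then show "incone P (t # y)" by (simp add: incone_def)
  qed
  \<comment> \<open>One less than the root of \<open>a\<close> rounded up: the range from
    \<open>lo\<close> to \<open>rt a y\<close> contains just the root if that is an integer, and is
    empty otherwise.\<close>
  define lo where "lo = - (ldot (tl a) y div hdd a) - 1"
  have "ldot (tl a) y div hdd a = \<lfloor>- \<rho> a\<rfloor>"
    using floor_divide_of_int_eq[of "ldot (tl a) y" "hdd a", where 'a = real]
    by (simp add: \<rho>_def rho_def)
  then have lo: "lo = - \<lfloor>- \<rho> a\<rfloor> - 1" by (simp add: lo_def)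
  have lo_less: "lo < t \<longleftrightarrow> \<rho> a \<le> of_int t" for t unfolding lo by linarith
  have le_rt: "t \<le> rt c y \<longleftrightarrow> of_int t \<le> \<rho> c" for t c
    unfolding floor_rho[symmetric] \<rho>_def by (simp add: le_floor_iff)
  have set_T: "{t. incone P (t # y)} = {lo<..rt z y}"
    using T lo_less le_rt by auto
  then show "finite {t. incone P (t # y)}" by simp
  have lo_le: "lo \<le> rt a y" unfolding le_rt lo by linarith
  have "lo \<le> rt z y" unfolding le_rt lo using ord[of a z] a_le az by (auto simp: R) linarith
  then have "(\<Sum>t | incone P (t # y). F t) = ssum lo (rt z y) F"
    unfolding set_T by (simp add: ssum_def)
  also have "\<dots> = ssum lo (rt a y) F + (\<Sum>(b, c)\<leftarrow>zip (a # as) as. ssum (rt b y) (rt c y) F)"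
    using ssum_chain[of lo "\<lambda>a. rt a y" a F as] by (simp add: z_def Ra)
  also have "ssum lo (rt a y) F = ssum lo (rt a y) (\<lambda>t. qval Ls (r a # w') (t # y))"
  proof (rule ssum_cong[OF lo_le])
    fix t assume "lo < t" "t \<le> rt a y"
    then have t: "of_int t = \<rho> a" using lo_less le_rt by force
    show "F t = qval Ls (r a # w') (t # y)"
    proof (rule F)
      show "incell M (r a # w') (t # y)" unfolding incell_def
      proof
        fix c assume c: "c \<in> set M"
        show "(0 \<le> ldot c (r a # w') \<longrightarrow> 0 \<le> ldot c (t # y)) \<and> (ldot c (r a # w') \<le> 0 \<longrightarrow> ldot c (t # y) \<le> 0)"
        proof (cases "hdd c = 0")
          case True
          then show ?thesis using flat[OF c] cell' by (simp add: incell_def)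
        next
          case False
          have "r c \<le> r a \<Longrightarrow> \<rho> c \<le> \<rho> a" "r a \<le> r c \<Longrightarrow> \<rho> a \<le> \<rho> c"
            using ord c False az by (auto simp: R)
          then have "(0 \<le> hdd c * (r a - r c) \<longrightarrow> 0 \<le> real_of_int (ldot c (t # y))) \<and>
              (hdd c * (r a - r c) \<le> 0 \<longrightarrow> real_of_int (ldot c (t # y)) \<le> 0)"
            unfolding formy[OF c False] t zero_le_mult_iff mult_le_0_iff using False by auto
          then show ?thesis unfolding formw[OF c False] by simp
        qed
      qed
    qed (use az lw in \<open>auto simp: R\<close>)
  qed
  also have "(\<Sum>(b, c)\<leftarrow>zip (a # as) as. ssum (rt b y) (rt c y) F) =
      (\<Sum>(b, c)\<leftarrow>zip (a # as) as. ssum (rt b y) (rt c y) (\<lambda>t. qval Ls ((r c - 1) # w') (t # y)))"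
  proof (intro arg_cong[of _ _ sum_list] map_cong refl, clarify)
    fix b c assume bc: "(b, c) \<in> set (zip (a # as) as)"
    have bcR: "b \<in> set R" "c \<in> set R" using set_zip_leftD[OF bc] set_zip_rightD[OF bc] Ra by auto
    then have bM: "b \<in> set M" "hdd b \<noteq> 0" "incone P (r b # w')"
      and cM: "c \<in> set M" "hdd c \<noteq> 0" "incone P (r c # w')" by (auto simp: R)
    have rbc: "r b \<le> r c" using sorted_zip_tl_le[OF _ bc, of r] sorted Ra by simp
    show "ssum (rt b y) (rt c y) F = ssum (rt b y) (rt c y) (\<lambda>t. qval Ls ((r c - 1) # w') (t # y))"
    proof (rule ssum_cong)
      show "rt b y \<le> rt c y" unfolding le_rt
        using ord[of b c] rbc bM cM floor_rho[of b y] unfolding \<rho>_def by (metis le_floor_iff order.trans order_refl)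
      fix t assume t: "rt b y < t" "t \<le> rt c y"
      then have t: "\<rho> b < of_int t" "of_int t \<le> \<rho> c" using le_rt by (auto simp flip: not_le)
      \<comment> \<open>A lattice point in the half-open interval shows that the two roots differ
        above \<open>y\<close>, hence above \<open>w'\<close>. Distinct even integers leave room for
        \<open>r c - 1\<close> strictly between them.\<close>
      then have "r b < r c" using ord[of c b] bM cM by force
      then have gap: "r b + 1 < r c" using r(2)[OF bM(1,2)] r(2)[OF cM(1,2)] by presburger
      have convex: "incone P (x # w')" if x: "r b \<le> x" "x \<le> r c" for x
        unfolding incone_def
      proof
        fix p assume p: "p \<in> set P"
        have 0: "0 \<le> ldot p (r b # w')" "0 \<le> ldot p (r c # w')" using bM cM p by (auto simp: incone_def)
        have pM: "p \<in> set M" using p PM by auto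
        show "0 \<le> ldot p (x # w')"
        proof (cases "hdd p = 0")
          case True
          then show ?thesis using flat(1)[OF pM] 0 by simp
        next
          case False
          then show ?thesis using 0 x unfolding formw[OF pM False] zero_le_mult_iff by auto
        qed
      qed
      show "F t = qval Ls ((r c - 1) # w') (t # y)"
      proof (rule F)
        show "incone P ((r c - 1) # w')" by (rule convex) (use gap in auto)
        show "incell M ((r c - 1) # w') (t # y)" unfolding incell_def
        proof
          fix e assume e: "e \<in> set M"
          show "(0 \<le> ldot e ((r c - 1) # w') \<longrightarrow> 0 \<le> ldot e (t # y)) \<and>
              (ldot e ((r c - 1) # w') \<le> 0 \<longrightarrow> ldot e (t # y) \<le> 0)"
          proof (cases "hdd e = 0")
            case True
            then show ?thesis using flat[OF e] cell' by (simp add: incell_def)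
          next
            case False
            \<comment> \<open>A root strictly between would lie in the fibre by convexity, hence
              belong to \<open>R\<close>, where \<open>b\<close> and \<open>c\<close> are
              neighbours.\<close>
            have "r e \<le> r b \<or> r c \<le> r e"
            proof (cases "e \<in> set R")
              case True
              then show ?thesis using sorted_zip_tl[OF _ bc, of r e] sorted Ra by simp
            next
              case False
              then have "\<not> incone P (r e # w')" using e \<open>hdd e \<noteq> 0\<close> by (auto simp: R)
              then show ?thesis using convex[of "r e"] by force
            qed
            \<comment> \<open>Roots up to that of \<open>b\<close> are strictly below
              \<open>t\<close> because the interval excludes its lower end. Roots from that of
              \<open>c\<close> on may coincide with \<open>t\<close>, which the closed cell
              permits.\<close>
            then have "r e < r c - 1 \<and> \<rho> e < of_int t \<or> r c - 1 < r e \<and> of_int t \<le> \<rho> e"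
              using ord[of e b] ord[of c e] gap t e False bM cM by force
            then have "(0 \<le> hdd e * (r c - 1 - r e) \<longrightarrow> 0 \<le> real_of_int (ldot e (t # y))) \<and>
                (hdd e * (r c - 1 - r e) \<le> 0 \<longrightarrow> real_of_int (ldot e (t # y)) \<le> 0)"
              unfolding formy[OF e False] zero_le_mult_iff mult_le_0_iff using False by auto
            then show ?thesis unfolding formw[OF e False] by simp
          qed
        qed
      qed (use lw in simp)
    qed
  qed
  also have "ssum lo (rt a y) (\<lambda>t. qval Ls (r a # w') (t # y)) + \<dots> = qval ((P, M) # Ls) w y"
    using Ra by (simp add: qval_Cons[OF w'_def] R_def lo_def r_def)
  finally show "(\<Sum>t | incone P (t # y). F t) = qval ((P, M) # Ls) w y" .
qed

text \<open>Induction on the number of unknowns, one fibre at a time: the summand \<open>F\<close>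
  of \<open>fiber_sum\<close> is the number of solutions above \<open>t # y\<close>.\<close>

lemma card_sols:
  assumes D: "\<forall>a\<in>set D. length a = d + n"
    and bd: "\<And>xs. xs \<in> sols D d (replicate n 0) \<Longrightarrow> set xs \<subseteq> {0}"
    and "j + m = d + n" "j \<le> d" "length w = m" "length y = m"
    and "incone (fst (level D j)) w" "incell (snd (level D j)) w y"
  shows "finite (sols D j y) \<and> int (card (sols D j y)) = qval (levels D j) w y"
  using assms(3-)
proof (induction j arbitrary: m w y)
  case 0
  then have "incone D y" by (auto simp: incone_def incell_def)
  then have "sols D 0 y = {[]}" by (auto simp: sols_def)
  then show ?case by simp
next
  case (Suc j)
  define P M where "P = fst (level D j)" and "M = snd (level D j)"
  have DL: "\<forall>a\<in>set D. length a = j + Suc m" using D Suc.prems by simp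
  have M: "\<forall>a\<in>set M. length a = Suc m" unfolding M_def by (rule level_length[OF DL])
  have PM: "set P \<subseteq> set M" unfolding P_def M_def by (rule level_subset)
  have sided: "\<exists>a\<in>set P. 0 < hdd a" "\<exists>a\<in>set P. hdd a < 0"
    using two_sided[OF D _ bd, of j 1] two_sided[OF D _ bd, of j "-1"] Suc.prems by (auto simp: P_def)
  have IH: "finite (sols D j (t # y)) \<and> int (card (sols D j (t # y))) = qval (levels D j) u (t # y)"
    if "length u = Suc m" "incone P u" "incell M u (t # y)" for u t
    using Suc.IH[of "Suc m" u "t # y"] Suc.prems that by (simp add: P_def M_def)
  have empty: "sols D j (t # y) = {}" if "\<not> incone P (t # y)" for t
    using sols_level[of D j "t # y"] DL Suc.prems(4) that by (auto simp: P_def)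
  let ?F = "\<lambda>t. int (card (sols D j (t # y)))"
  have conew: "incone (fm P) w" and cell: "incell (proj M) w y"
    using Suc.prems(5,6) by (simp_all add: level_Suc P_def M_def)
  have fin: "finite {t. incone P (t # y)}"
    and sum: "(\<Sum>t | incone P (t # y). ?F t) = qval ((P, M) # levels D j) w y"
    by (rule fiber_sum[OF M PM sided Suc.prems(3,4) conew cell, of ?F]; use IH empty in simp)+
  \<comment> \<open>The point \<open>t # y\<close> serves as its own sample.\<close>
  have finj: "finite (sols D j (t # y))" for t
  proof (cases "incone P (t # y)")
    case True
    then show ?thesis using IH[of "t # y" t] Suc.prems(4) by (simp add: incell_def)
  qed (simp add: empty)
  have U: "sols D (Suc j) y = (\<Union>t\<in>{t. incone P (t # y)}. (\<lambda>xs. xs @ [t]) ` sols D j (t # y))"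
    unfolding sols_Suc using empty by blast
  have "card ((\<lambda>xs. xs @ [t]) ` sols D j (t # y)) = card (sols D j (t # y))" for t
    by (rule card_image) (auto simp: inj_on_def)
  moreover have "card (sols D (Suc j) y) =
      (\<Sum>t | incone P (t # y). card ((\<lambda>xs. xs @ [t]) ` sols D j (t # y)))"
    unfolding U by (rule card_UN_disjoint) (use fin finj in auto)
  moreover have "finite (sols D (Suc j) y)" unfolding U using fin finj by blast
  ultimately show ?case using sum by (simp add: levels_Suc P_def M_def)
qed

subsection \<open>The fan of cells\<close>

definition cellrows :: "int list list \<Rightarrow> int list \<Rightarrow> int list list" where
  "cellrows M w = concat (map (\<lambda>a. (if 0 \<le> ldot a w then [a] else []) @
     (if ldot a w \<le> 0 then [map uminus a] else [])) M)"

definition cell :: "nat \<Rightarrow> int list list \<Rightarrow> int list \<Rightarrow> real vec set" where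
  "cell n M w = {x \<in> carrier_vec n. incell M w (list_of_vec x)}"

lemma length_list_of_vec: "x \<in> carrier_vec n \<Longrightarrow> length (list_of_vec x) = n"
  by (simp add: list_of_vec_map)

lemma list_of_vec_map_vec: "list_of_vec (map_vec f v) = map f (list_of_vec v)"
  by (simp add: list_of_vec_map)

lemma ldot_sum: "length a = length v \<Longrightarrow> ldot a v = (\<Sum>j<length v. of_int (a ! j) * v ! j)"
proof (induction a v rule: list_induct2)
  case (Cons x a t v)
  then show ?case by (simp add: sum.lessThan_Suc_shift del: sum.lessThan_Suc)
qed simp

lemma ldot_vec: "length a = n \<Longrightarrow> x \<in> carrier_vec n \<Longrightarrow>
    ldot a (list_of_vec x) = (real_vec (vec_of_list a)) \<bullet> x"
  by (subst ldot_sum) (auto simp: length_list_of_vec scalar_prod_def lessThan_atLeast0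
      vec_of_list_index list_of_vec_index intro!: sum.cong)

lemma form_carrier: "length a = n \<Longrightarrow> real_vec (vec_of_list a) \<in> carrier_vec n"
  by (simp add: carrier_vecI)

lemma ldot_vec_add: "length a = n \<Longrightarrow> x \<in> carrier_vec n \<Longrightarrow> y \<in> carrier_vec n \<Longrightarrow>
    ldot a (list_of_vec (x + y)) = ldot a (list_of_vec x) + ldot a (list_of_vec (y :: real vec))"
  using scalar_prod_add_distrib[OF form_carrier, of a n x y] by (simp add: ldot_vec[of a n])

lemma ldot_vec_smult: "length a = n \<Longrightarrow> x \<in> carrier_vec n \<Longrightarrow>
    ldot a (list_of_vec (t \<cdot>\<^sub>v x)) = t * ldot a (list_of_vec (x :: real vec))"
  using scalar_prod_smult_distrib[OF form_carrier, of a n x t] by (simp add: ldot_vec[of a n])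

lemma rational_cone_rows:
  assumes "\<forall>a\<in>set rs. length a = n"
  shows "rational_cone (mat_of_rows_list n rs) = {x \<in> carrier_vec n. incone rs (list_of_vec x)}"
proof -
  have "(real_mat (mat_of_rows_list n rs) *\<^sub>v x) $ i = ldot (rs ! i) (list_of_vec x)"
    if "i < length rs" "x \<in> carrier_vec n" for i and x :: "real vec"
    using that assms by (subst ldot_sum) (auto simp: length_list_of_vec mat_of_rows_list_def
        scalar_prod_def lessThan_atLeast0 list_of_vec_index intro!: sum.cong)
  then show ?thesis
    by (auto simp: rational_cone_def incone_def less_eq_vec_def mat_of_rows_list_def
        all_set_conv_all_nth)
qed

lemma length_cellrows: "\<forall>a\<in>set M. length a = n \<Longrightarrow> \<forall>a\<in>set (cellrows M w). length a = n"
  by (auto simp: cellrows_def split: if_splits)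

lemma incone_cellrows: "incone (cellrows M w) y \<longleftrightarrow> incell M w y"
  by (auto simp: incone_def cellrows_def incell_def)

lemma rational_cone_cell: "\<forall>a\<in>set M. length a = n \<Longrightarrow>
    rational_cone (mat_of_rows_list n (cellrows M w)) = cell n M w"
  using rational_cone_rows[OF length_cellrows] by (simp add: incone_cellrows cell_def)

lemma real_vec_cell:
  "y \<in> carrier_vec n \<Longrightarrow> real_vec y \<in> cell n M w \<longleftrightarrow> incell M w (list_of_vec y)"
  by (simp add: cell_def list_of_vec_map_vec)

lemma incell_refl: "incell M w w"
  by (simp add: incell_def)

lemma cell_subset_iff:
  assumes "length w = n"
  shows "cell n M w \<subseteq> cell n M w' \<longleftrightarrow> incell M w' w"
proof
  assume "cell n M w \<subseteq> cell n M w'"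
  moreover have "vec_of_list w \<in> carrier_vec n" using assms by (simp add: carrier_vecI)
  ultimately show "incell M w' w"
    using real_vec_cell[of "vec_of_list w" n M] incell_refl[of M w] by (auto simp: list_vec)
qed (auto simp: cell_def incell_def)

lemma form_combination:
  assumes "\<forall>a\<in>set L. length a = n"
  shows "\<exists>u\<in>carrier_vec n. \<forall>x\<in>carrier_vec n. u \<bullet> x = (\<Sum>a\<leftarrow>L. s a * ldot a (list_of_vec (x :: real vec)))"
  using assms
proof (induction L)
  case Nil
  then show ?case by (intro bexI[of _ "0\<^sub>v n"]) auto
next
  case (Cons a L)
  then obtain u where u: "u \<in> carrier_vec n"
      "\<forall>x\<in>carrier_vec n. u \<bullet> x = (\<Sum>a\<leftarrow>L. s a * ldot a (list_of_vec x))" by auto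
  have a: "real_vec (vec_of_list a) \<in> carrier_vec n" by (rule form_carrier) (use Cons.prems in simp)
  then have sa: "s a \<cdot>\<^sub>v real_vec (vec_of_list a) \<in> carrier_vec n" by simp
  have "(s a \<cdot>\<^sub>v real_vec (vec_of_list a) + u) \<bullet> x = (\<Sum>a\<leftarrow>a # L. s a * ldot a (list_of_vec x))"
    if x: "x \<in> carrier_vec n" for x
    using add_scalar_prod_distrib[OF sa u(1) x]
      smult_scalar_prod_distrib[OF a x, of "s a"] u(2) x Cons.prems by (simp add: ldot_vec[of a n])
  moreover have "s a \<cdot>\<^sub>v real_vec (vec_of_list a) + u \<in> carrier_vec n"
    by (rule add_carrier_vec[OF sa u(1)])
  ultimately show ?case by blast
qed

lemma sign_agreement:
  fixes x :: real and p q :: int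
  assumes "0 \<le> p \<Longrightarrow> 0 \<le> x" "p \<le> 0 \<Longrightarrow> x \<le> 0"
  shows "(0 \<le> q \<longrightarrow> 0 \<le> x) \<and> (q \<le> 0 \<longrightarrow> x \<le> 0) \<longleftrightarrow>
    (sgn p \<noteq> sgn q \<longrightarrow> real_of_int (sgn p) * x = 0)"
proof (cases "p = 0")
  case True
  then show ?thesis using assms by simp
next
  case False
  then show ?thesis using assms by (cases "0 < p"; cases q "0 :: int" rule: linorder_cases) auto
qed

text \<open>The supporting functional is the sum of the forms whose signs at \<open>w\<close> and
  \<open>w'\<close> differ, each multiplied by its sign at \<open>w\<close>. The summands are
  nonnegative on the cell of \<open>w\<close>, and they all vanish exactly on the part that lies in
  the cell of \<open>w'\<close>.\<close>

lemma cell_inter_face: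
  assumes M: "\<forall>a\<in>set M. length a = n"
  shows "is_face n (cell n M w \<inter> cell n M w') (cell n M w)"
proof -
  define L where "L = filter (\<lambda>a. sgn (ldot a w) \<noteq> sgn (ldot a w')) M"
  define g where "g a x = real_of_int (sgn (ldot a w)) * ldot a (list_of_vec x)" for a x
  have "\<forall>a\<in>set L. length a = n" using M by (simp add: L_def)
  from form_combination[OF this, of "\<lambda>a. real_of_int (sgn (ldot a w))"]
  obtain u where u: "u \<in> carrier_vec n"
    and ux: "\<And>x. x \<in> carrier_vec n \<Longrightarrow> u \<bullet> x = (\<Sum>a\<leftarrow>L. g a x)"
    unfolding g_def by blast
  have nn: "0 \<le> g a x" if "a \<in> set M" "x \<in> cell n M w" for a x
    using that unfolding g_def by (cases "ldot a w" "0::int" rule: linorder_cases)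
      (simp_all add: cell_def incell_def)
  have nnL: "\<forall>y\<in>set (map (\<lambda>a. g a x) L). 0 \<le> y" if "x \<in> cell n M w" for x
    using nn[OF _ that] by (simp add: L_def)
  have carr: "x \<in> carrier_vec n" if "x \<in> cell n M w" for x using that by (simp add: cell_def)
  have "x \<in> cell n M w' \<longleftrightarrow> u \<bullet> x = 0" if x: "x \<in> cell n M w" for x
  proof -
    have "u \<bullet> x = 0 \<longleftrightarrow> (\<forall>a\<in>set L. g a x = 0)"
      unfolding ux[OF carr[OF x]]
      using sum_list_nonneg_eq_0_iff[of "map (\<lambda>a. g a x) L"] nnL[OF x] by simp
    also have "\<dots> \<longleftrightarrow> (\<forall>a\<in>set M. sgn (ldot a w) \<noteq> sgn (ldot a w') \<longrightarrow> g a x = 0)"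
      unfolding L_def by auto
    also have "\<dots> \<longleftrightarrow> (\<forall>a\<in>set M. (0 \<le> ldot a w' \<longrightarrow> 0 \<le> ldot a (list_of_vec x)) \<and>
        (ldot a w' \<le> 0 \<longrightarrow> ldot a (list_of_vec x) \<le> 0))"
      unfolding g_def
    proof (rule ball_cong[OF refl])
      fix a assume "a \<in> set M"
      then have "0 \<le> ldot a w \<Longrightarrow> 0 \<le> ldot a (list_of_vec x)" "ldot a w \<le> 0 \<Longrightarrow> ldot a (list_of_vec x) \<le> 0"
        using x by (simp_all add: cell_def incell_def)
      from sign_agreement[of "ldot a w", OF this, of "ldot a w'"]
      show "(sgn (ldot a w) \<noteq> sgn (ldot a w') \<longrightarrow> real_of_int (sgn (ldot a w)) * ldot a (list_of_vec x) = 0)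
        \<longleftrightarrow> (0 \<le> ldot a w' \<longrightarrow> 0 \<le> ldot a (list_of_vec x)) \<and> (ldot a w' \<le> 0 \<longrightarrow> ldot a (list_of_vec x) \<le> 0)"
        by (rule sym)
    qed
    finally show ?thesis using carr[OF x] by (simp add: cell_def incell_def)
  qed
  then have "cell n M w \<inter> cell n M w' = {x \<in> cell n M w. u \<bullet> x = 0}" by auto
  moreover have "\<forall>x\<in>cell n M w. 0 \<le> u \<bullet> x"
  proof
    fix x assume x: "x \<in> cell n M w"
    show "0 \<le> u \<bullet> x"
      unfolding ux[OF carr[OF x]] by (rule sum_list_nonneg) (rule bspec[OF nnL[OF x]])
  qed
  ultimately have "(\<forall>x\<in>cell n M w. 0 \<le> u \<bullet> x) \<and>
      cell n M w \<inter> cell n M w' = {x \<in> cell n M w. u \<bullet> x = 0}" by (rule conjI[rotated])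
  then show ?thesis unfolding is_face_def by (rule bexI[OF _ u])
qed

text \<open>A face is the cell of a point \<open>z\<close> in its relative interior: moving from \<open>z\<close> slightly away from
  any other point of that cell stays in the big cell, so the supporting functional vanishes there.\<close>

lemma face_cell:
  assumes M: "\<forall>a\<in>set M. length a = n" and face: "is_face n d (cell n M w)"
  shows "\<exists>z\<in>cell n M w. \<forall>w'. same_signs M w' (list_of_vec z) \<longrightarrow> d = cell n M w'"
proof -
  obtain u where u: "u \<in> carrier_vec n" "\<And>x. x \<in> cell n M w \<Longrightarrow> 0 \<le> u \<bullet> x"
    and d: "d = {x \<in> cell n M w. u \<bullet> x = 0}" using face by (auto simp: is_face_def)
  have carr: "x \<in> carrier_vec n" if "x \<in> cell n M w" for x using that by (simp add: cell_def)
  let ?f = "\<lambda>a (x :: real vec). ldot a (list_of_vec x)"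
  have add: "x + y \<in> cell n M w" if "x \<in> cell n M w" "y \<in> cell n M w" for x y
    using that M by (auto simp: cell_def incell_def ldot_vec_add[of _ n]
        intro: add_nonneg_nonneg add_nonpos_nonpos)
  have zero: "0\<^sub>v n \<in> d" using u(1) by (auto simp: d cell_def incell_def)
  \<comment> \<open>For each form that is not identically zero on \<open>d\<close>, a point of
    \<open>d\<close> where it does not vanish is added. Nothing cancels, since every form has a
    constant weak sign on the cell.\<close>
  have "\<exists>z\<in>d. \<forall>a\<in>set L. ?f a z = 0 \<longrightarrow> (\<forall>x\<in>d. ?f a x = 0)" if "set L \<subseteq> set M" for L
    using that
  proof (induction L)
    case Nil
    then show ?case using zero by auto
  next
    case (Cons a L)
    then obtain z where z: "z \<in> d" "\<forall>a\<in>set L. ?f a z = 0 \<longrightarrow> (\<forall>x\<in>d. ?f a x = 0)" by auto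
    show ?case
    proof (cases "?f a z = 0 \<and> (\<exists>x\<in>d. ?f a x \<noteq> 0)")
      case False
      then show ?thesis using z by auto
    next
      case True
      then obtain x where x: "x \<in> d" "?f a x \<noteq> 0" by auto
      have zx: "z \<in> cell n M w" "x \<in> cell n M w" using z x by (auto simp: d)
      have "z + x \<in> d" using z x add u(1) carr zx by (auto simp: d scalar_prod_add_distrib[of _ n])
      moreover have "\<forall>x\<in>d. ?f b x = 0" if b: "b \<in> set (a # L)" "?f b (z + x) = 0" for b
      proof -
        have bM: "b \<in> set M" using b Cons.prems by auto
        have s: "?f b z + ?f b x = 0" using b(2) ldot_vec_add[of b n z x] M bM carr zx by simp
        have "0 \<le> ldot b w \<and> 0 \<le> ?f b z \<and> 0 \<le> ?f b x \<or> ldot b w \<le> 0 \<and> ?f b z \<le> 0 \<and> ?f b x \<le> 0"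
          using zx bM by (auto simp: cell_def incell_def)
        then have "?f b z = 0" "?f b x = 0" using s by linarith+
        then show ?thesis using b(1) x(2) z(2) by auto
      qed
      ultimately show ?thesis by blast
    qed
  qed
  from this[of M] obtain z where z: "z \<in> d" and zM: "\<And>a x. a \<in> set M \<Longrightarrow> ?f a z = 0 \<Longrightarrow> x \<in> d \<Longrightarrow> ?f a x = 0"
    by blast
  have zc: "z \<in> cell n M w" "u \<bullet> z = 0" using z by (auto simp: d)
  have "d = cell n M w'" if w': "same_signs M w' (list_of_vec z)" for w'
  proof
    show "d \<subseteq> cell n M w'"
    proof
      fix x assume x: "x \<in> d"
      then have xc: "x \<in> cell n M w" by (simp add: d)
      have "(0 \<le> ldot a w' \<longrightarrow> 0 \<le> ?f a x) \<and> (ldot a w' \<le> 0 \<longrightarrow> ?f a x \<le> 0)" if a: "a \<in> set M" for a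
      proof -
        have 1: "(0 < ldot a w') = (0 < ?f a z)" "(ldot a w' < 0) = (?f a z < 0)"
          using w' a by (auto simp: same_signs_def)
        have 2: "0 \<le> ldot a w \<longrightarrow> 0 \<le> ?f a z" "ldot a w \<le> 0 \<longrightarrow> ?f a z \<le> 0"
            "0 \<le> ldot a w \<longrightarrow> 0 \<le> ?f a x" "ldot a w \<le> 0 \<longrightarrow> ?f a x \<le> 0"
          using zc xc a by (auto simp: cell_def incell_def)
        show ?thesis using 1 2 zM[OF a _ x] by (cases "?f a z" "0::real" rule: linorder_cases) auto
      qed
      then show "x \<in> cell n M w'" using carr[OF xc] by (auto simp: cell_def incell_def)
    qed
  next
    show "cell n M w' \<subseteq> d"
    proof
      fix x assume xw': "x \<in> cell n M w'"
      then have x: "x \<in> carrier_vec n" by (simp add: cell_def)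
      have signs: "(0 \<le> ?f a z \<longrightarrow> 0 \<le> ?f a x) \<and> (?f a z \<le> 0 \<longrightarrow> ?f a x \<le> 0)" if "a \<in> set M" for a
        using xw' w' that by (auto simp: cell_def incell_def same_signs_def simp flip: not_less)
      have xc: "x \<in> cell n M w"
        using signs zc x by (auto simp: cell_def incell_def)
      have "\<exists>t>0. \<forall>a\<in>set L. ?f a z \<noteq> 0 \<longrightarrow> t * \<bar>?f a x\<bar> \<le> \<bar>?f a z\<bar>" for L
      proof (induction L)
        case (Cons a L)
        then obtain t where t: "0 < t" "\<forall>a\<in>set L. ?f a z \<noteq> 0 \<longrightarrow> t * \<bar>?f a x\<bar> \<le> \<bar>?f a z\<bar>" by blast
        \<comment> \<open>The summand \<open>1\<close> keeps the denominator positive where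
          \<open>?f a x\<close> vanishes.\<close>
        define t' where "t' = (if ?f a z = 0 then t else min t (\<bar>?f a z\<bar> / (\<bar>?f a x\<bar> + 1)))"
        have t': "0 < t'" "t' \<le> t" using t(1) by (auto simp: t'_def divide_pos_pos)
        have "t' * \<bar>?f a x\<bar> \<le> \<bar>?f a z\<bar>" if "?f a z \<noteq> 0"
        proof -
          have "t' * \<bar>?f a x\<bar> \<le> t' * (\<bar>?f a x\<bar> + 1)" using t' by simp
          also have "\<dots> \<le> \<bar>?f a z\<bar> / (\<bar>?f a x\<bar> + 1) * (\<bar>?f a x\<bar> + 1)"
            using that by (intro mult_right_mono) (auto simp: t'_def)
          also have "\<dots> = \<bar>?f a z\<bar>" by (simp add: add_nonneg_eq_0_iff)
          finally show ?thesis .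
        qed
        moreover have "t' * \<bar>?f b x\<bar> \<le> \<bar>?f b z\<bar>" if "b \<in> set L" "?f b z \<noteq> 0" for b
          using t(2) that mult_right_mono[OF t'(2), of "\<bar>?f b x\<bar>"] by force
        ultimately show ?case using t' by (intro exI[of _ t']) auto
      qed (auto intro: exI[of _ 1])
      from this[of M] obtain t where t: "0 < t" "\<And>a. a \<in> set M \<Longrightarrow> ?f a z \<noteq> 0 \<Longrightarrow> t * \<bar>?f a x\<bar> \<le> \<bar>?f a z\<bar>"
        by blast
      let ?y = "z + (- t) \<cdot>\<^sub>v x"
      have fy: "?f a ?y = ?f a z - t * ?f a x" if "a \<in> set M" for a
        using M that x carr[OF zc(1)] by (simp add: ldot_vec_add[of _ n] ldot_vec_smult[of _ n])
      have "(0 \<le> ldot a w \<longrightarrow> 0 \<le> ?f a ?y) \<and> (ldot a w \<le> 0 \<longrightarrow> ?f a ?y \<le> 0)" if a: "a \<in> set M" for a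
      proof (cases "?f a z = 0")
        case True
        then show ?thesis using signs[OF a] fy[OF a] by auto
      next
        case False
        have "t * ?f a x \<le> t * \<bar>?f a x\<bar>" "- (t * ?f a x) \<le> t * \<bar>?f a x\<bar>"
          using t(1) abs_le_D1 by (auto simp: abs_if mult_less_0_iff)
        moreover have "0 \<le> ldot a w \<longrightarrow> 0 \<le> ?f a z" "ldot a w \<le> 0 \<longrightarrow> ?f a z \<le> 0"
          using zc a by (auto simp: cell_def incell_def)
        ultimately show ?thesis unfolding fy[OF a] using t(2)[OF a False] by linarith
      qed
      then have "?y \<in> cell n M w" using x carr[OF zc(1)] by (auto simp: cell_def incell_def)
      from u(2)[OF this] have "0 \<le> - (t * (u \<bullet> x))"
        using u(1) x carr[OF zc(1)] zc(2) by (simp add: scalar_prod_add_distrib[of _ n])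
      then have "u \<bullet> x \<le> 0" using t(1) by (simp add: mult_le_0_iff)
      then show "x \<in> d" using u(2)[OF xc] xc by (simp add: d)
    qed
  qed
  then show ?thesis using zc(1) by blast
qed

text \<open>A cell may be represented several times; only the set of cells matters for the fan. If
  \<open>P\<close> is contained in \<open>M\<close>, a cell lies in the projected cone as soon as
  its sample does.\<close>

definition reps :: "nat \<Rightarrow> int list list \<Rightarrow> int list list \<Rightarrow> int list list" where
  "reps n P M = filter (incone P) (samples n M)"

definition maxreps :: "int list list \<Rightarrow> int list list \<Rightarrow> int list list" where
  "maxreps M Ws = filter (\<lambda>w. \<forall>w'\<in>set Ws. incell M w' w \<longrightarrow> incell M w w') Ws"

lemma reps_complete:
  fixes v :: "real list"
  assumes M: "\<forall>a\<in>set M. length a = n" and PM: "set P \<subseteq> set M" and "length v = n" "incone P v"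
  shows "\<exists>w\<in>set (reps n P M). same_signs M w v"
proof -
  obtain w where w: "w \<in> set (samples n M)" "same_signs M w v"
    using samples_complete[OF M assms(3)] by blast
  have "incone P w" using w(2) assms(4) PM by (force simp: incone_def same_signs_def simp flip: not_less)
  then show ?thesis using w by (auto simp: reps_def)
qed

lemma fan_reps:
  assumes M: "\<forall>a\<in>set M. length a = n" and PM: "set P \<subseteq> set M"
  shows "fan n (cell n M ` set (reps n P M))"
  unfolding fan_def
proof (intro conjI ballI allI impI)
  fix c assume "c \<in> cell n M ` set (reps n P M)"
  then obtain w where "c = cell n M w" by blast
  then have "c = rational_cone (mat_of_rows_list n (cellrows M w))" by (simp add: rational_cone_cell[OF M])
  moreover have "dim_col (mat_of_rows_list n (cellrows M w)) = n" by (simp add: mat_of_rows_list_def)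
  ultimately show "is_rational_cone n c" unfolding is_rational_cone_def by blast
next
  fix c d assume "c \<in> cell n M ` set (reps n P M)" and face: "is_face n d c"
  then obtain w where w: "w \<in> set (reps n P M)" "c = cell n M w" by auto
  obtain z where z: "z \<in> cell n M w" "\<forall>w'. same_signs M w' (list_of_vec z) \<longrightarrow> d = cell n M w'"
    using face_cell[OF M face[unfolded w(2)]] by blast
  have len: "length (list_of_vec z) = n" using z(1) by (simp add: cell_def length_list_of_vec)
  have "incone P (list_of_vec z)"
    using w(1) z(1) PM by (auto simp: reps_def incone_def cell_def incell_def)
  from reps_complete[OF M PM len this] obtain w' where
    "w' \<in> set (reps n P M)" "same_signs M w' (list_of_vec z)" by blast
  then show "d \<in> cell n M ` set (reps n P M)" using z(2) by blast
next
  fix c d assume "c \<in> cell n M ` set (reps n P M)" "d \<in> cell n M ` set (reps n P M)"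
  then obtain w w' where "c = cell n M w" "d = cell n M w'" by blast
  then show "is_face n (c \<inter> d) c" "is_face n (c \<inter> d) d"
    using cell_inter_face[OF M, of w w'] cell_inter_face[OF M, of w' w] by (simp_all add: Int_commute)
qed

text \<open>By \<open>cell_subset_iff\<close> a cell is contained in another one iff its sample is,
  so maximality becomes a finite computation with integers.\<close>

lemma maximal_cones_reps:
  "maximal_cones (cell n M ` set (reps n P M)) = cell n M ` set (maxreps M (reps n P M))"
proof -
  have len: "length w = n" if "w \<in> set (reps n P M)" for w
    using that length_samples by (auto simp: reps_def)
  have "(cell n M w \<subseteq> cell n M w' \<longrightarrow> cell n M w' = cell n M w) \<longleftrightarrow> (incell M w' w \<longrightarrow> incell M w w')"
    if w: "w \<in> set (reps n P M)" "w' \<in> set (reps n P M)" for w w'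
    unfolding set_eq_subset cell_subset_iff[OF len[OF w(1)]] cell_subset_iff[OF len[OF w(2)]] by blast
  then have "(\<forall>w'\<in>set (reps n P M). cell n M w \<subseteq> cell n M w' \<longrightarrow> cell n M w' = cell n M w) \<longleftrightarrow>
      (\<forall>w'\<in>set (reps n P M). incell M w' w \<longrightarrow> incell M w w')" if w: "w \<in> set (reps n P M)" for w
    using w by (intro ball_cong refl) simp
  then show ?thesis unfolding maximal_cones_def maxreps_def by auto
qed

subsection \<open>The algorithm\<close>

text \<open>In the list coded by \<open>code_mat\<close>, position \<open>2\<close> holds the code
  of the rows and positions \<open>0\<close> and \<open>1\<close> hold the dimensions.\<close>

definition rows_of :: "nat \<Rightarrow> int list list" where
  "rows_of c = dec (nthd (dec c) 2)"

definition num_rows :: "nat \<Rightarrow> nat" where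
  "num_rows c = nthd (dec c) 0"

definition num_cols :: "nat \<Rightarrow> nat" where
  "num_cols c = nthd (dec c) 1"

definition unit_row :: "nat \<Rightarrow> nat \<Rightarrow> int \<Rightarrow> int list" where
  "unit_row n i s = map (\<lambda>j. if j = i then s else 0) [0..<n]"

text \<open>The inequalities of the cone of all \<open>(x, \<lambda>, \<beta>)\<close> with \<open>x\<close> in the sliced cone.\<close>

definition cone_forms :: "int list list \<Rightarrow> int list list \<Rightarrow> int list list \<Rightarrow> int list list \<Rightarrow>
    nat \<Rightarrow> nat \<Rightarrow> int list list" where
  "cone_forms p q r s nL nQ =
     map (\<lambda>a. a @ replicate (nL + nQ) 0) r @
     map (\<lambda>(a, b). map uminus a @ b @ replicate nQ 0) (zip p s) @
     map (\<lambda>(a, i). a @ replicate nL 0 @ unit_row nQ i (-1)) (zip q [0..<nQ]) @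
     map (\<lambda>(a, i). map uminus a @ replicate nL 0 @ unit_row nQ i 1) (zip q [0..<nQ])"

definition input_forms :: "nat list \<Rightarrow> int list list" where
  "input_forms c = cone_forms (rows_of (nthd c 0)) (rows_of (nthd c 1)) (rows_of (nthd c 2))
     (rows_of (nthd c 3)) (num_cols (nthd c 3)) (num_rows (nthd c 1))"

section \<open>Candidate tables of the search and their verification\<close>

type_synonym raw_table = "(int list \<times> ((int \<times> int) \<times> nat list) list) list"

text \<open>Candidate coefficients are pairs of integers, which are coded bijectively. Lowest terms
  and a positive denominator make such a pair the \<open>quotient_of\<close> of a rational number,
  so that its code is the one prescribed for the output.\<close>

definition reduced :: "int \<times> int \<Rightarrow> bool" where
  "reduced a \<longleftrightarrow> 0 < snd a \<and> (\<forall>k\<in>set [2..snd a]. \<not> (k dvd fst a \<and> k dvd snd a))"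

definition lookup :: "raw_table \<Rightarrow> int list \<Rightarrow> ((int \<times> int) \<times> nat list) list" where
  "lookup tab z = (case filter (\<lambda>e. fst e = z) tab of [] \<Rightarrow> [] | e # es \<Rightarrow> snd e)"

text \<open>The denominator is the product of all denominators and nothing is cancelled, so values
  are compared by integer multiplication.\<close>

definition eval_fraction :: "((int \<times> int) \<times> nat list) list \<Rightarrow> int list \<Rightarrow> int \<times> int" where
  "eval_fraction P y = foldr (\<lambda>t f.
     (fst f * snd (fst t) + fst (fst t) * prod_list (map2 (\<lambda>t e. t ^ e) y (snd t)) * snd f,
      snd f * snd (fst t))) P (0, 1)"

definition degree_bound :: "raw_table \<Rightarrow> nat" where
  "degree_bound tab = sum_list (map (\<lambda>e. sum_list (map (\<lambda>t. Suc (sum_list (snd t))) (snd e))) tab)"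

definition box :: "nat \<Rightarrow> int \<Rightarrow> int list list" where
  "box n b = ((\<lambda>acc. concat (map (\<lambda>v. map (\<lambda>t. t # v) [0..b - 1]) acc)) ^^ n) [[]]"

text \<open>The side of the box depends on the candidate. The extrapolation has degree below
  \<open>Suc (length Ls)\<close> and the table degree below \<open>degree_bound tab\<close>, so both
  have degree below the sum, and \<open>vpol_unique\<close> turns agreement on the box into
  agreement everywhere.\<close>

definition fits :: "nat \<Rightarrow> (int list list \<times> int list list) list \<Rightarrow> int list \<Rightarrow> raw_table \<Rightarrow> bool" where
  "fits n Ls w tab \<longleftrightarrow> (\<forall>e\<in>set tab. \<forall>t\<in>set (snd e). reduced (fst t)) \<and>
     (\<forall>y\<in>set (box n (period Ls * int (Suc (length Ls) + degree_bound tab))).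
        let f = eval_fraction (lookup tab (map (\<lambda>t. t mod period Ls) y)) y
        in fst f = qval Ls w y * snd f)"

definition code_rows :: "nat \<Rightarrow> int list list \<Rightarrow> nat" where
  "code_rows n rs = enc [length rs, n, enc rs]"

definition input_data :: "nat list \<Rightarrow>
    nat \<times> int list list \<times> (int list list \<times> int list list) list \<times> int list list" where
  "input_data c = (let D = input_forms c; d = num_cols (nthd c 2);
     n = num_cols (nthd c 3) + num_rows (nthd c 1); L = level D d
     in (n, snd L, levels D d, reps n (fst L) (snd L)))"

definition accepts :: "nat list \<Rightarrow> raw_table list \<Rightarrow> bool" where
  "accepts c tabs \<longleftrightarrow> (case input_data c of (n, M, Ls, Ws) \<Rightarrow>
     length tabs = length (maxreps M Ws) \<and>
     (\<forall>x\<in>set (zip (maxreps M Ws) tabs). fits n Ls (fst x) (snd x)))"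

definition alg_output :: "nat list \<Rightarrow> raw_table list \<Rightarrow> nat list \<times> (nat \<times> nat \<times> raw_table) list" where
  "alg_output c tabs = (case input_data c of (n, M, Ls, Ws) \<Rightarrow>
     (map (\<lambda>w. code_rows n (cellrows M w)) Ws,
      map (\<lambda>x. (code_rows n (cellrows M (fst x)), nat (period Ls), snd x)) (zip (maxreps M Ws) tabs)))"

subsection \<open>Computability of the algorithm\<close>

lemma ldot_int: "ldot a (v :: int list) = sum_list (map2 (*) a v)"
  by (simp add: ldot_def)

lemma cmp_ldot [cmpI]: "cmp f \<Longrightarrow> cmp g \<Longrightarrow> cmp (\<lambda>x. ldot (f x) (g x) :: int)"
  unfolding ldot_int by (intro cmpI)

text \<open>Under a binder the context is a pair, and the assumptions are needed for a component of
  it; \<open>assms[THEN cmp_app]\<close> provides them composed with any computable map. Most rules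
  below follow this pattern.\<close>

lemma cmpp_incone [cmpI]:
  assumes "cmp f" "cmp g"
  shows "cmpp (\<lambda>x. incone (f x) (g x :: int list))"
  unfolding incone_def by (intro cmpI assms assms[THEN cmp_app])

lemma cmpp_incell [cmpI]:
  assumes "cmp M" "cmp f" "cmp g"
  shows "cmpp (\<lambda>x. incell (M x) (f x) (g x :: int list))"
  unfolding incell_def by (intro cmpI assms assms[THEN cmp_app])

lemma cmp_vscale [cmpI]: 
  assumes "cmp f" "cmp g"
  shows "cmp (\<lambda>x. vscale (f x) (g x))"
  unfolding vscale_def by (intro cmpI assms assms[THEN cmp_app])

lemma cmp_comb [cmpI]:
  assumes "cmp f" "cmp g"
  shows "cmp (\<lambda>x. comb (f x) (g x))"
  unfolding comb_def by (intro cmpI assms assms[THEN cmp_app])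

lemma cmp_proj [cmpI]:
  assumes "cmp f"
  shows "cmp (\<lambda>x. proj (f x))"
  unfolding proj_def by (intro cmpI assms assms[THEN cmp_app])

lemma cmp_fm [cmpI]:
  assumes "cmp f"
  shows "cmp (\<lambda>x. fm (f x))"
  unfolding fm_def by (intro cmpI assms assms[THEN cmp_app])

lemma cmp_kscale [cmpI]:
  assumes "cmp f"
  shows "cmp (\<lambda>x. kscale (f x))"
  unfolding kscale_def by (intro cmpI assms assms[THEN cmp_app])

lemma cmp_rt [cmpI]:
  assumes "cmp f" "cmp g"
  shows "cmp (\<lambda>x. rt (f x) (g x))"
  unfolding rt_def by (intro cmpI assms)

lemma cmp_lifts [cmpI]:
  assumes "cmp f" "cmp g"
  shows "cmp (\<lambda>x. lifts (f x) (g x))"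
  unfolding lifts_def by (intro cmpI assms assms[THEN cmp_app])

lemma cmp_samples [cmpI]:
  assumes "cmp f" "cmp g"
  shows "cmp (\<lambda>x. samples (f x) (g x))"
  unfolding samples_def by (intro cmpI assms assms[THEN cmp_app])

lemma cmp_reps [cmpI]:
  assumes "cmp f" "cmp g" "cmp h"
  shows "cmp (\<lambda>x. reps (f x) (g x) (h x))"
  unfolding reps_def by (intro cmpI assms assms[THEN cmp_app])

lemma cmp_maxreps [cmpI]:
  assumes "cmp f" "cmp g"
  shows "cmp (\<lambda>x. maxreps (f x) (g x))"
  unfolding maxreps_def by (intro cmpI assms assms[THEN cmp_app])

lemma cmp_roots [cmpI]:
  assumes "cmp f" "cmp g" "cmp h"
  shows "cmp (\<lambda>x. roots (f x) (g x) (h x))"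
  unfolding roots_def sort_by_def insert_by_def[abs_def] by (intro cmpI assms assms[THEN cmp_app])

lemma cmp_seg [cmpI]:
  assumes "cmp a" "cmp b" "cmp c" "cmp d" "cmp e"
  shows "cmp (\<lambda>x. seg (a x) (b x) (c x) (d x) (e x))"
  unfolding seg_def by (intro cmpI assms assms[THEN cmp_app])

lemma cmp_expand [cmpI]:
  assumes "cmp f" "cmp g"
  shows "cmp (\<lambda>x. expand (f x) (g x))"
  unfolding expand_def by (intro cmpI assms assms[THEN cmp_app])

lemma cmp_qval [cmpI]:
  assumes "cmp f" "cmp g" "cmp h"
  shows "cmp (\<lambda>x. qval (f x) (g x) (h x))"
  unfolding qval_def by (intro cmpI assms assms[THEN cmp_app])

lemma cmp_period [cmpI]:
  assumes "cmp f"
  shows "cmp (\<lambda>x. period (f x))"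
  unfolding period_def by (intro cmpI assms)

lemma cmp_level [cmpI]:
  assumes "cmp f" "cmp g"
  shows "cmp (\<lambda>x. level (f x) (g x))"
  unfolding level_def by (intro cmpI assms)

lemma cmp_levels [cmpI]:
  assumes "cmp f" "cmp g"
  shows "cmp (\<lambda>x. levels (f x) (g x))"
  unfolding levels_def by (intro cmpI assms assms[THEN cmp_app])

lemma cmp_cellrows [cmpI]:
  assumes "cmp f" "cmp g"
  shows "cmp (\<lambda>x. cellrows (f x) (g x))"
  unfolding cellrows_def by (intro cmpI assms assms[THEN cmp_app])

lemma cmp_input_forms [cmpI]:
  assumes "cmp f"
  shows "cmp (\<lambda>x. input_forms (f x))"
  unfolding input_forms_def cone_forms_def unit_row_def rows_of_def num_cols_def num_rows_def
  by (intro cmpI assms assms[THEN cmp_app])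

lemma cmp_input_data [cmpI]:
  assumes "cmp f"
  shows "cmp (\<lambda>x. input_data (f x))"
  unfolding input_data_def num_cols_def num_rows_def by (intro cmpI assms assms[THEN cmp_app])

lemma cmpp_reduced [cmpI]:
  assumes "cmp f"
  shows "cmpp (\<lambda>x. reduced (f x))"
  unfolding reduced_def by (intro cmpI assms assms[THEN cmp_app])

lemma cmp_lookup [cmpI]:
  assumes "cmp f" "cmp g"
  shows "cmp (\<lambda>x. lookup (f x) (g x))"
  unfolding lookup_def by (intro cmpI assms assms[THEN cmp_app])

lemma cmp_eval_fraction [cmpI]:
  assumes "cmp f" "cmp g"
  shows "cmp (\<lambda>x. eval_fraction (f x) (g x))"
  unfolding eval_fraction_def by (intro cmpI assms assms[THEN cmp_app])

lemma cmp_degree_bound [cmpI]: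
  assumes "cmp f"
  shows "cmp (\<lambda>x. degree_bound (f x))"
  unfolding degree_bound_def by (intro cmpI assms)

lemma cmp_box [cmpI]:
  assumes "cmp f" "cmp g"
  shows "cmp (\<lambda>x. box (f x) (g x))"
  unfolding box_def by (intro cmpI assms assms[THEN cmp_app])

lemma cmpp_fits [cmpI]:
  assumes "cmp n" "cmp Ls" "cmp w" "cmp tab"
  shows "cmpp (\<lambda>x. fits (n x) (Ls x) (w x) (tab x))"
  unfolding fits_def by (intro cmpI assms assms[THEN cmp_app])

lemma cmpp_accepts [cmpI]:
  assumes "cmp f" "cmp g"
  shows "cmpp (\<lambda>x. accepts (f x) (g x))"
  unfolding accepts_def by (intro cmpI assms assms[THEN cmp_app])

lemma cmp_alg_output [cmpI]:
  assumes "cmp f" "cmp g"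
  shows "cmp (\<lambda>x. alg_output (f x) (g x))"
  unfolding alg_output_def code_rows_def by (intro cmpI assms assms[THEN cmp_app])

lemma algorithm_exists:
  "\<exists>alg. \<forall>c. (\<exists>tabs. accepts c tabs) \<longrightarrow>
     (\<exists>tabs. accepts c tabs \<and> computes alg [enc c] (enc (alg_output c tabs)))"
  by (rule computes_search) (intro cmpI)+

subsection \<open>Correctness of the search\<close>

definition rat_terms :: "((int \<times> int) \<times> nat list) list \<Rightarrow> rat mpoly_list" where
  "rat_terms P = map (\<lambda>t. (of_int (fst (fst t)) / of_int (snd (fst t)), snd t)) P"

definition rat_table :: "raw_table \<Rightarrow> (int list \<times> rat mpoly_list) list" where
  "rat_table tab = map (\<lambda>e. (fst e, rat_terms (snd e))) tab"

lemma reduced_iff: "reduced a \<longleftrightarrow> 0 < snd a \<and> coprime (fst a) (snd a)"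
proof -
  have "coprime (fst a) (snd a)" if "0 < snd a" "\<forall>k\<in>{2..snd a}. \<not> (k dvd fst a \<and> k dvd snd a)"
  proof (rule ccontr)
    assume "\<not> coprime (fst a) (snd a)"
    then obtain k where k: "k dvd fst a" "k dvd snd a" "\<not> is_unit k" by (auto simp: coprime_def)
    then have "\<bar>k\<bar> dvd fst a" "\<bar>k\<bar> dvd snd a" "\<bar>k\<bar> \<noteq> 1" by simp_all
    moreover have "\<bar>k\<bar> \<le> snd a" using k(2) that(1) by (simp add: zdvd_imp_le)
    moreover have "k \<noteq> 0" using k(2) that(1) by auto
    ultimately show False using that(2) by (metis abs_ge_zero abs_eq_0 atLeastAtMost_iff
        int_one_le_iff_zero_less less_le one_add_one zless_imp_add1_zle)
  qed
  moreover have "\<not> (k dvd fst a \<and> k dvd snd a)" if "coprime (fst a) (snd a)" "2 \<le> k" for k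
    using that coprime_common_divisor[of "fst a" "snd a" k] by auto
  ultimately show ?thesis by (auto simp: reduced_def)
qed

lemma reduced_quotient_of: "reduced (quotient_of a)"
  by (simp add: reduced_iff quotient_of_denom_pos' quotient_of_coprime[of a "fst (quotient_of a)"])

lemma quotient_of_reduced: "reduced a \<Longrightarrow> quotient_of (of_int (fst a) / of_int (snd a)) = a"
  using quotient_of_Fract[of "fst a" "snd a"] normalize_stable[of "snd a" "fst a"]
  by (simp add: reduced_iff Rat.Fract_of_int_quotient)

lemma fraction_quotient_of: "of_int (fst (quotient_of a)) / of_int (snd (quotient_of a)) = a"
  using quotient_of_div[of a "fst (quotient_of a)" "snd (quotient_of a)"] by simp

lemma eval_fraction:
  assumes "\<forall>t\<in>set P. reduced (fst t)"
  shows "0 < snd (eval_fraction P y)"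
    and "of_int (fst (eval_fraction P y)) = leval (rat_terms P) y * of_int (snd (eval_fraction P y))"
proof -
  have "0 < snd (eval_fraction P y) \<and>
      of_int (fst (eval_fraction P y)) = leval (rat_terms P) y * of_int (snd (eval_fraction P y))"
    using assms
  proof (induction P)
    case Nil
    then show ?case by (simp add: eval_fraction_def rat_terms_def)
  next
    case (Cons t P)
    obtain p d es where t: "t = ((p, d), es)" by (metis prod.collapse)
    let ?f = "eval_fraction P y"
    let ?m = "prod_list (map2 (\<lambda>t e. t ^ e) y es)"
    have f: "eval_fraction (t # P) y = (fst ?f * d + p * ?m * snd ?f, snd ?f * d)"
      by (simp add: eval_fraction_def t)
    have m: "of_int ?m = (prod_list (map2 (\<lambda>t e. of_int t ^ e) y es) :: rat)"
      by (induction y es rule: list_induct2') simp_all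
    have d: "0 < d" using Cons.prems by (simp add: t reduced_iff)
    have IH: "0 < snd ?f" "of_int (fst ?f) = leval (rat_terms P) y * of_int (snd ?f)"
      using Cons by auto
    have l: "leval (rat_terms (t # P)) y = (of_int p / of_int d) * of_int ?m + leval (rat_terms P) y"
      unfolding m by (simp add: rat_terms_def t)
    show ?case unfolding f l using IH d by (simp add: field_simps)
  qed
  then show "0 < snd (eval_fraction P y)"
    "of_int (fst (eval_fraction P y)) = leval (rat_terms P) y * of_int (snd (eval_fraction P y))" by auto
qed

lemma set_box: "set (box n b) = {v. length v = n \<and> (\<forall>x\<in>set v. 0 \<le> x \<and> x < b)}"
proof (induction n)
  case (Suc n)
  have "box (Suc n) b = concat (map (\<lambda>v. map (\<lambda>t. t # v) [0..b - 1]) (box n b))" by (simp add: box_def)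
  then show ?case using Suc by (auto simp: length_Suc_conv)
qed (auto simp: box_def)

lemma lookup_mem: "lookup tab z \<noteq> [] \<Longrightarrow> (z, lookup tab z) \<in> set tab"
proof -
  assume "lookup tab z \<noteq> []"
  then obtain e es where "filter (\<lambda>e. fst e = z) tab = e # es" "lookup tab z = snd e"
    by (auto simp: lookup_def split: list.splits)
  then have "e \<in> set (filter (\<lambda>e. fst e = z) tab)" by simp
  then have "e \<in> set tab" "fst e = z" by auto
  then show ?thesis using \<open>lookup tab z = snd e\<close> by (metis prod.collapse)
qed

lemma lookup_degree: "t \<in> set (lookup tab z) \<Longrightarrow> sum_list (snd t) < degree_bound tab"
proof -
  assume t: "t \<in> set (lookup tab z)"
  then have "lookup tab z \<noteq> []" by auto
  note mem = lookup_mem[OF this]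
  have "Suc (sum_list (snd t)) \<le> (\<Sum>t\<leftarrow>lookup tab z. Suc (sum_list (snd t)))"
    using t by (intro member_le_sum_list) auto
  also have "\<dots> \<le> degree_bound tab" unfolding degree_bound_def
    by (rule member_le_sum_list) (use mem in \<open>force | simp\<close>)+
  finally show ?thesis by simp
qed

lemma fits_sound:
  assumes ok: "levels_ok n Ls" and fits: "fits n Ls w tab" and y: "length y = n"
  shows "leval (rat_terms (lookup tab (map (\<lambda>t. t mod period Ls) y))) y = of_int (qval Ls w y)"
proof -
  let ?N = "period Ls" and ?e = "Suc (length Ls) + degree_bound tab"
  let ?g = "\<lambda>y. leval (rat_terms (lookup tab (map (\<lambda>t. t mod ?N) y))) y"
  have "vpol ?N n ?e (leval (rat_terms (lookup tab z)))" for z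
    by (rule vpol_leval) (use lookup_degree[of _ tab z] in \<open>fastforce simp: rat_terms_def\<close>)
  then have g: "vpol ?N n ?e ?g" by (rule vpol_residues)
  have q: "vpol ?N n ?e (\<lambda>y. of_int (qval Ls w y) :: rat)"
    by (rule dpol_of_int, rule dpol_mono[OF acts_shifts qval_vpol[OF ok]]) simp
  have "?g y - of_int (qval Ls w y) = 0"
  proof (rule vpol_unique[OF dpol_diff[OF g q] period_pos order_refl _ _ y])
    fix v assume v: "length v = n" "\<forall>x\<in>set v. 0 \<le> x \<and> x < ?N * int ?e"
    let ?P = "lookup tab (map (\<lambda>t. t mod ?N) v)"
    have red: "\<forall>t\<in>set ?P. reduced (fst t)"
    proof (cases "?P = []")
      case False
      then show ?thesis using lookup_mem[OF False] fits unfolding fits_def by fastforce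
    qed simp
    have "v \<in> set (box n (?N * int ?e))" using v by (simp add: set_box)
    then have "fst (eval_fraction ?P v) = qval Ls w v * snd (eval_fraction ?P v)"
      using fits by (simp add: fits_def Let_def)
    then have "leval (rat_terms ?P) v * of_int (snd (eval_fraction ?P v)) =
        of_int (qval Ls w v) * (of_int (snd (eval_fraction ?P v)) :: rat)"
      unfolding eval_fraction(2)[OF red, symmetric] by simp
    then show "?g v - of_int (qval Ls w v) = 0" using eval_fraction(1)[OF red, of v] by simp
  qed simp
  then show ?thesis by simp
qed

text \<open>Interpolation gives a polynomial for each residue vector, and \<open>box n ?N\<close>
  lists all residue vectors. This existence is what makes the search stop.\<close>

lemma fits_complete:
  assumes ok: "levels_ok n Ls"
  shows "\<exists>tab. fits n Ls w tab"
proof -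
  let ?N = "period Ls"
  let ?res = "\<lambda>y. map (\<lambda>t. t mod ?N) y"
  have "\<forall>z. \<exists>P. \<forall>y. length y = n \<longrightarrow> ?res y = z \<longrightarrow> of_int (qval Ls w y) = leval P y"
    by (intro allI vpol_interpolation[OF dpol_of_int[OF qval_vpol[OF ok]] period_pos])
  from choice[OF this] obtain P where
    P: "\<And>z y. length y = n \<Longrightarrow> ?res y = z \<Longrightarrow> of_int (qval Ls w y) = leval (P z) y" by blast
  define raw where "raw z = map (\<lambda>t. (quotient_of (fst t), snd t)) (P z)" for z
  define tab where "tab = map (\<lambda>z. (z, raw z)) (box n ?N)"
  have red: "\<forall>t\<in>set (raw z). reduced (fst t)" for z by (simp add: raw_def reduced_quotient_of)
  have rat: "rat_terms (raw z) = P z" for z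
    by (simp add: raw_def rat_terms_def o_def fraction_quotient_of)
  have look: "lookup tab z = raw z" if "z \<in> set (box n ?N)" for z
  proof -
    have "filter (\<lambda>e. fst e = z) tab \<noteq> []" using that by (auto simp: tab_def filter_empty_conv)
    then obtain e es where e: "filter (\<lambda>e. fst e = z) tab = e # es" by (auto simp: neq_Nil_conv)
    then have "e \<in> set (filter (\<lambda>e. fst e = z) tab)" by simp
    then show ?thesis using e by (auto simp: lookup_def tab_def)
  qed
  have "fst (eval_fraction (lookup tab (?res y)) y) = qval Ls w y * snd (eval_fraction (lookup tab (?res y)) y)"
    if y: "y \<in> set (box n b)" for y b
  proof -
    have ly: "length y = n" using y by (simp add: set_box)
    have "?res y \<in> set (box n ?N)" using ly period_pos[of Ls] by (auto simp: set_box)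
    note l = look[OF this]
    have "of_int (fst (eval_fraction (raw (?res y)) y)) =
        (of_int (qval Ls w y * snd (eval_fraction (raw (?res y)) y)) :: rat)"
      using eval_fraction(2)[OF red, of "?res y" y] P[OF ly refl] by (simp add: rat)
    then show ?thesis unfolding l by (simp only: of_int_eq_iff)
  qed
  moreover have "\<forall>e\<in>set tab. \<forall>t\<in>set (snd e). reduced (fst t)" using red by (auto simp: tab_def)
  ultimately show ?thesis unfolding fits_def Let_def by blast
qed

lemma mpoly_eval_leval: "mpoly_eval P y = leval P (list_of_vec y)"
  by (simp add: mpoly_eval_def leval_def)

lemma qpoly_eval_table:
  assumes "0 < N"
  shows "qpoly_eval (nat N, rat_table tab) y =
    leval (rat_terms (lookup tab (map (\<lambda>t. t mod N) (list_of_vec y)))) (list_of_vec y)"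
proof -
  have "map_of (rat_table tab) z = (case filter (\<lambda>e. fst e = z) tab of [] \<Rightarrow> None
      | e # es \<Rightarrow> Some (rat_terms (snd e)))" for z
    by (induction tab) (auto simp: rat_table_def)
  then show ?thesis using assms
    by (auto simp: lookup_def mpoly_eval_leval rat_terms_def split: list.split)
qed

subsection \<open>Coding\<close>

lemma enc_nat_list: "enc (xs :: nat list) = list_encode xs"
  by (simp add: enc_list_def enc_nat_def[abs_def])

lemma enc_int_lists: "enc rs = list_encode (map (list_encode \<circ> map int_encode) rs)"
  by (simp add: enc_list_def[abs_def] enc_int_def[abs_def] comp_def)

lemma code_mat_enc: "code_mat A = enc [dim_row A, dim_col A, enc (mat_to_list A)]"
  by (simp add: code_mat_def enc_nat_list enc_int_lists)

lemma mat_to_list_rows: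
  assumes "\<forall>a\<in>set rs. length a = n"
  shows "mat_to_list (mat_of_rows_list n rs) = rs"
  by (rule nth_equalityI) (use assms in \<open>auto simp: mat_to_list_def mat_of_rows_list_def intro!: nth_equalityI\<close>)

lemma code_rows: "\<forall>a\<in>set rs. length a = n \<Longrightarrow> code_rows n rs = code_mat (mat_of_rows_list n rs)"
  by (simp add: code_rows_def code_mat_enc mat_to_list_rows) (simp add: mat_of_rows_list_def)

lemma parse_mat:
  "rows_of (code_mat A) = mat_to_list A" "num_rows (code_mat A) = dim_row A" "num_cols (code_mat A) = dim_col A"
  by (simp_all add: rows_of_def num_rows_def num_cols_def code_mat_enc nthd_nth)

lemma code_input_enc: "code_input p q r s = enc [code_mat p, code_mat q, code_mat r, code_mat s]"
  by (simp add: code_input_def enc_nat_list)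

text \<open>With reduced coefficients the code of the raw list is literally the code required of the
  output, and no conversion has to be computed.\<close>

lemma code_mpoly_rat_terms:
  assumes "\<forall>t\<in>set P. reduced (fst t)"
  shows "code_mpoly (rat_terms P) = enc P"
  using assms
  by (auto simp: code_mpoly_def rat_terms_def enc_list_def enc_prod_def code_rat_def quotient_of_reduced
      enc_int_def enc_nat_def[abs_def] intro!: arg_cong[of _ _ list_encode])

lemma code_qpoly_rat_table:
  assumes "\<forall>e\<in>set tab. \<forall>t\<in>set (snd e). reduced (fst t)"
  shows "code_qpoly (N, rat_table tab) = enc (N, tab)"
  using assms
  by (auto simp: rat_table_def enc_Pair enc_nat_def enc_list_def[of tab] enc_prod_def code_mpoly_rat_terms
      enc_list_def[of "fst _"] enc_int_def[abs_def] intro!: arg_cong[of _ _ list_encode])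

subsection \<open>The cone of solutions\<close>

lemma ldot_row:
  assumes "i < dim_row A" "x \<in> carrier_vec (dim_col A)"
  shows "ldot (mat_to_list A ! i) (list_of_vec x) = (A *\<^sub>v x) $ i"
  using assms by (subst ldot_sum)
    (auto simp: mat_to_list_def length_list_of_vec scalar_prod_def lessThan_atLeast0 list_of_vec_index intro!: sum.cong)

lemma length_mat_to_list [simp]: "length (mat_to_list A) = dim_row A"
  by (simp add: mat_to_list_def)

lemma length_mat_row: "i < dim_row A \<Longrightarrow> length (mat_to_list A ! i) = dim_col A"
  by (simp add: mat_to_list_def)

lemma ldot_unit: "i < length v \<Longrightarrow> ldot (unit_row (length v) i s) v = s * v ! i"
proof -
  assume i: "i < length v"
  have "(if j = i then s else 0) * v ! j = (if j = i then s * v ! j else 0)" for j by simp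
  then show ?thesis using i by (subst ldot_sum) (simp_all add: unit_row_def)
qed

lemma incone_append: "incone (P @ Q) v \<longleftrightarrow> incone P v \<and> incone Q v"
  by (auto simp: incone_def)

lemma incone_map: "incone (map f xs) v \<longleftrightarrow> (\<forall>i<length xs. 0 \<le> ldot (f (xs ! i)) v)"
  by (auto simp: incone_def all_set_conv_all_nth)

abbreviation mat_forms :: "int mat \<Rightarrow> int mat \<Rightarrow> int mat \<Rightarrow> int mat \<Rightarrow> nat \<Rightarrow> nat \<Rightarrow> int list list" where
  "mat_forms p q r s \<equiv> cone_forms (mat_to_list p) (mat_to_list q) (mat_to_list r) (mat_to_list s)"

text \<open>The equation for \<open>q\<close> enters as two opposite inequalities.\<close>

lemma incone_cone_forms:
  assumes "p \<in> carrier_mat nT nK" "q \<in> carrier_mat nQ nK" "r \<in> carrier_mat nR nK" "s \<in> carrier_mat nT nL"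
    and x: "x \<in> carrier_vec nK" and l: "l \<in> carrier_vec nL" and b: "b \<in> carrier_vec nQ"
  shows "incone (mat_forms p q r s nL nQ)
      (list_of_vec x @ list_of_vec l @ list_of_vec b) \<longleftrightarrow>
    0\<^sub>v nR \<le> r *\<^sub>v x \<and> p *\<^sub>v x \<le> s *\<^sub>v l \<and> q *\<^sub>v x = b"
proof -
  have lens: "length (list_of_vec x) = nK" "length (list_of_vec l) = nL" "length (list_of_vec b) = nQ"
    using x l b by (simp_all add: length_list_of_vec)
  have unit: "length (unit_row nQ i c) = nQ" for i c by (simp add: unit_row_def)
  have dims: "dim_row p = nT" "dim_row q = nQ" "dim_row r = nR" "dim_row s = nT"
    "dim_col p = nK" "dim_col q = nK" "dim_col r = nK" "dim_col s = nL" using assms by auto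
  have 1: "ldot (mat_to_list r ! i @ replicate (nL + nQ) 0) (list_of_vec x @ list_of_vec l @ list_of_vec b) =
      (r *\<^sub>v x) $ i" if "i < nR" for i
    using that x dims lens ldot_row[of i r x] length_mat_row[of i r] by (simp add: ldot_append)
  have 2: "ldot (map uminus (mat_to_list p ! i) @ mat_to_list s ! i @ replicate nQ 0)
      (list_of_vec x @ list_of_vec l @ list_of_vec b) = (s *\<^sub>v l) $ i - (p *\<^sub>v x) $ i" if "i < nT" for i
    using that x l dims lens ldot_row[of i p x] ldot_row[of i s l] length_mat_row[of i p] length_mat_row[of i s]
    by (simp add: ldot_append)
  have 3: "ldot (mat_to_list q ! i @ replicate nL 0 @ unit_row nQ i (-1))
      (list_of_vec x @ list_of_vec l @ list_of_vec b) = (q *\<^sub>v x) $ i - b $ i" if "i < nQ" for i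
    using that x dims lens ldot_row[of i q x] length_mat_row[of i q] ldot_unit[of i "list_of_vec b" "-1"] unit
    by (simp add: ldot_append list_of_vec_index)
  have 4: "ldot (map uminus (mat_to_list q ! i) @ replicate nL 0 @ unit_row nQ i 1)
      (list_of_vec x @ list_of_vec l @ list_of_vec b) = b $ i - (q *\<^sub>v x) $ i" if "i < nQ" for i
    using that x dims lens ldot_row[of i q x] length_mat_row[of i q] ldot_unit[of i "list_of_vec b" 1] unit
    by (simp add: ldot_append list_of_vec_index)
  let ?v = "list_of_vec x @ list_of_vec l @ list_of_vec b"
  have "incone (map (\<lambda>a. a @ replicate (nL + nQ) 0) (mat_to_list r)) ?v \<longleftrightarrow> 0\<^sub>v nR \<le> r *\<^sub>v x"
    unfolding incone_map using 1 dims by (simp add: less_eq_vec_def)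
  moreover have "incone (map (\<lambda>(a, b). map uminus a @ b @ replicate nQ 0) (zip (mat_to_list p) (mat_to_list s))) ?v
      \<longleftrightarrow> p *\<^sub>v x \<le> s *\<^sub>v l"
    unfolding incone_map using 2 dims by (simp add: less_eq_vec_def)
  moreover have "incone (map (\<lambda>(a, i). a @ replicate nL 0 @ unit_row nQ i (-1)) (zip (mat_to_list q) [0..<nQ])) ?v
      \<longleftrightarrow> (\<forall>i<nQ. b $ i \<le> (q *\<^sub>v x) $ i)"
    unfolding incone_map using 3 dims by simp
  moreover have "incone (map (\<lambda>(a, i). map uminus a @ replicate nL 0 @ unit_row nQ i 1) (zip (mat_to_list q) [0..<nQ])) ?v
      \<longleftrightarrow> (\<forall>i<nQ. (q *\<^sub>v x) $ i \<le> b $ i)"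
    unfolding incone_map using 4 dims by simp
  moreover have "q *\<^sub>v x = b \<longleftrightarrow> (\<forall>i<nQ. b $ i \<le> (q *\<^sub>v x) $ i) \<and> (\<forall>i<nQ. (q *\<^sub>v x) $ i \<le> b $ i)"
    unfolding vec_eq_iff using dims b by (auto intro: order.antisym)
  ultimately show ?thesis unfolding cone_forms_def incone_append by blast
qed

lemma real_mat_mult_vec: "x \<in> carrier_vec (dim_col A) \<Longrightarrow> real_mat A *\<^sub>v real_vec x = real_vec (A *\<^sub>v x)"
  by (simp add: of_int_hom.mult_mat_vec_hom[of A "dim_row A" "dim_col A"])

lemma real_vec_le: "real_vec u \<le> real_vec v \<longleftrightarrow> u \<le> v"
  by (auto simp: less_eq_vec_def)

lemma real_vec_nonneg: "0\<^sub>v n \<le> real_vec v \<longleftrightarrow> 0\<^sub>v n \<le> v"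
  by (auto simp: less_eq_vec_def)

lemma real_vec_inject: "real_vec u = real_vec v \<longleftrightarrow> u = v"
  by (auto simp: vec_eq_iff)

lemma sliced_cone_int:
  assumes "p \<in> carrier_mat nT nK" "q \<in> carrier_mat nQ nK" "r \<in> carrier_mat nR nK"
    and x: "x \<in> carrier_vec nK"
  shows "real_vec x \<in> sliced_cone p q r s l b \<longleftrightarrow>
    0\<^sub>v nR \<le> r *\<^sub>v x \<and> p *\<^sub>v x \<le> s *\<^sub>v l \<and> q *\<^sub>v x = b"
  using assms
  by (auto simp: sliced_cone_def chopped_cone_def unchopped_cone_def real_mat_mult_vec real_vec_le
      real_vec_inject real_vec_nonneg)

lemma num_points_eq:
  assumes "r \<in> carrier_mat nR nK"
  shows "num_points p q r s l b = card {x \<in> carrier_vec nK. real_vec x \<in> sliced_cone p q r s l b}"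
proof -
  have "sliced_cone p q r s l b \<inter> lattice_points (dim_col r) =
      real_vec ` {x \<in> carrier_vec nK. real_vec x \<in> sliced_cone p q r s l b}"
    using assms by (auto simp: lattice_points_def)
  moreover have "inj_on real_vec X" for X by (rule inj_onI) (simp add: real_vec_inject)
  ultimately show ?thesis by (simp add: num_points_def card_image)
qed

lemma num_points_sols:
  assumes "p \<in> carrier_mat nT nK" "q \<in> carrier_mat nQ nK" "r \<in> carrier_mat nR nK" "s \<in> carrier_mat nT nL"
    and l: "l \<in> carrier_vec nL" and b: "b \<in> carrier_vec nQ"
  shows "num_points p q r s l b =
    card (sols (mat_forms p q r s nL nQ) nK
      (list_of_vec (l @\<^sub>v b)))"
proof -
  let ?S = "{x \<in> carrier_vec nK. real_vec x \<in> sliced_cone p q r s l b}"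
  let ?D = "mat_forms p q r s nL nQ"
  have iff: "real_vec x \<in> sliced_cone p q r s l b \<longleftrightarrow> incone ?D (list_of_vec x @ list_of_vec l @ list_of_vec b)"
    if "x \<in> carrier_vec nK" for x
    using sliced_cone_int[OF assms(1-3) that] incone_cone_forms[OF assms(1-4) that l b] by simp
  have "list_of_vec ` ?S = sols ?D nK (list_of_vec (l @\<^sub>v b))"
  proof (intro equalityI subsetI)
    fix xs assume xs: "xs \<in> sols ?D nK (list_of_vec (l @\<^sub>v b))"
    then have "vec_of_list xs \<in> carrier_vec nK" by (simp add: sols_def carrier_vecI)
    then have "vec_of_list xs \<in> ?S" using xs iff[of "vec_of_list xs"] by (simp add: sols_def list_vec)
    then have "list_of_vec (vec_of_list xs) \<in> list_of_vec ` ?S" by (rule imageI)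
    then show "xs \<in> list_of_vec ` ?S" by (simp only: list_vec)
  qed (auto simp: sols_def iff length_list_of_vec)
  moreover have "inj_on list_of_vec ?S" by (rule inj_on_inverseI[of _ vec_of_list]) (rule vec_list)
  ultimately show ?thesis unfolding num_points_eq[OF assms(3)] using card_image by fastforce
qed

text \<open>Over the zero parameters the solutions are closed under positive multiples, whereas the
  chopped cone at \<open>0\<close> is bounded.\<close>

lemma sols_bounded:
  assumes "chopped_and_sliced_cone nK nL nQ nT nR p q r s"
    and xs: "xs \<in> sols (mat_forms p q r s nL nQ) nK
      (replicate (nL + nQ) 0)"
  shows "set xs \<subseteq> {0}"
proof
  have c: "p \<in> carrier_mat nT nK" "q \<in> carrier_mat nQ nK" "r \<in> carrier_mat nR nK" "s \<in> carrier_mat nT nL"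
    and bd: "bounded_vecs (chopped_cone p r s (0\<^sub>v nL))"
    using assms(1) by (auto simp: chopped_and_sliced_cone_def)
  let ?D = "mat_forms p q r s nL nQ"
  obtain B where B: "\<And>x i. x \<in> chopped_cone p r s (0\<^sub>v nL) \<Longrightarrow> i < dim_vec x \<Longrightarrow> \<bar>x $ i\<bar> \<le> B"
    using bd by (auto simp: bounded_vecs_def)
  have len: "length xs = nK" using xs by (simp add: sols_def)
  fix t assume "t \<in> set xs"
  then obtain i where i: "i < nK" "xs ! i = t" using len by (auto simp: in_set_conv_nth)
  have bound: "\<bar>real k * real_of_int t\<bar> \<le> B" if k: "0 < k" for k :: nat
  proof -
    let ?x = "vec_of_list (vscale (int k) xs)"
    have x: "?x \<in> carrier_vec nK" using len by (simp add: carrier_vecI)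
    have "incone ?D (vscale (int k) (xs @ replicate (nL + nQ) 0))"
      using xs k by (auto simp: sols_def incone_def)
    moreover have "vscale (int k) (xs @ replicate (nL + nQ) 0) =
        list_of_vec ?x @ list_of_vec (0\<^sub>v nL) @ list_of_vec (0\<^sub>v nQ)"
      by (simp add: list_vec list_of_vec_map_vec vscale_def map_replicate_const replicate_add)
    ultimately have "incone ?D (list_of_vec ?x @ list_of_vec (0\<^sub>v nL) @ list_of_vec (0\<^sub>v nQ))" by simp
    then have "real_vec ?x \<in> sliced_cone p q r s (0\<^sub>v nL) (0\<^sub>v nQ)"
      using incone_cone_forms[OF c x, of "0\<^sub>v nL" "0\<^sub>v nQ"] sliced_cone_int[OF c(1-3) x] by simp
    then have "real_vec ?x \<in> chopped_cone p r s (0\<^sub>v nL)" by (simp add: sliced_cone_def)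
    from B[OF this, of i] show ?thesis using i len
      by (simp add: vec_of_list_index vscale_def)
  qed
  show "t \<in> {0}"
  proof (rule ccontr)
    assume "t \<notin> {0}"
    then have t: "1 \<le> \<bar>real_of_int t\<bar>" by auto
    obtain k :: nat where k: "max B 0 < real k" using reals_Archimedean2 by blast
    have "real k * 1 \<le> \<bar>real k * real_of_int t\<bar>" unfolding abs_mult using t by (intro mult_mono) auto
    then show False using bound[of k] k by auto
  qed
qed

lemma cone_forms_length:
  assumes "p \<in> carrier_mat nT nK" "q \<in> carrier_mat nQ nK" "r \<in> carrier_mat nR nK" "s \<in> carrier_mat nT nL"
  shows "\<forall>a\<in>set (mat_forms p q r s nL nQ).
    length a = nK + (nL + nQ)"
proof -
  have row: "length a = dim_col A" if "a \<in> set (mat_to_list A)" for a :: "int list" and A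
    using that by (auto simp: mat_to_list_def)
  show ?thesis
  proof
    fix a assume "a \<in> set (mat_forms p q r s nL nQ)"
    then consider b where "b \<in> set (mat_to_list r)" "a = b @ replicate (nL + nQ) 0"
      | b c where "(b, c) \<in> set (zip (mat_to_list p) (mat_to_list s))" "a = map uminus b @ c @ replicate nQ 0"
      | b i where "(b, i) \<in> set (zip (mat_to_list q) [0..<nQ])" "a = b @ replicate nL 0 @ unit_row nQ i (-1)"
      | b i where "(b, i) \<in> set (zip (mat_to_list q) [0..<nQ])" "a = map uminus b @ replicate nL 0 @ unit_row nQ i 1"
      by (auto simp: cone_forms_def)
    then show "length a = nK + (nL + nQ)"
    proof cases
      case 1
      then show ?thesis using row[OF 1(1)] assms by simp
    next
      case 2
      then show ?thesis using row[OF set_zip_leftD[OF 2(1)]] row[OF set_zip_rightD[OF 2(1)]] assms by simp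
    next
      case 3
      then show ?thesis using row[OF set_zip_leftD[OF 3(1)]] assms by (simp add: unit_row_def)
    next
      case 4
      then show ?thesis using row[OF set_zip_leftD[OF 4(1)]] assms by (simp add: unit_row_def)
    qed
  qed
qed

subsection \<open>Quasi-polynomials given by tables\<close>

definition residues_of :: "nat \<Rightarrow> int vec \<Rightarrow> int list" where
  "residues_of N y = map (\<lambda>t. t mod int N) (list_of_vec y)"

lemma residues_of_eq_iff:
  assumes "x \<in> carrier_vec n" "y \<in> carrier_vec n"
  shows "residues_of N x = residues_of N y \<longleftrightarrow> (\<forall>i<n. int N dvd x $ i - y $ i)"
  using assms by (auto simp: residues_of_def list_eq_iff_nth_eq length_list_of_vec list_of_vec_index
      mod_eq_dvd_iff)

text \<open>The subgroup consists of the vectors divisible by \<open>N\<close>. Its cosets are the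
  residue classes, and the finite \<open>box n (int N)\<close> contains all residue vectors.\<close>

lemma quasi_polynomial_on_table:
  assumes N: "0 < N"
    and f: "\<And>y. y \<in> carrier_vec n \<Longrightarrow> real_vec y \<in> c \<Longrightarrow> of_nat (f y) = qpoly_eval (N, tab) y"
  shows "quasi_polynomial_on_cone n c (\<lambda>y. real (f y))"
proof -
  let ?G = "monoid_vec TYPE(int) n"
  let ?Z = "{y \<in> carrier_vec n. \<forall>i<n. int N dvd y $ i}"
  interpret G: comm_group ?G by (rule comm_group_vec)
  have sub: "subgroup ?Z ?G"
  proof
    fix x assume x: "x \<in> ?Z"
    have "inv\<^bsub>?G\<^esub> x = - x" using x by (intro G.inv_equality) (auto simp: monoid_vec_simps)
    then show "inv\<^bsub>?G\<^esub> x \<in> ?Z" using x by auto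
  qed (auto simp: monoid_vec_simps)
  have coset: "?Z #>\<^bsub>?G\<^esub> y = {x \<in> carrier_vec n. residues_of N x = residues_of N y}"
    if y: "y \<in> carrier_vec n" for y
  proof (intro equalityI subsetI)
    fix x assume "x \<in> ?Z #>\<^bsub>?G\<^esub> y"
    then obtain h where "h \<in> ?Z" "x = h + y" by (auto simp: r_coset_def monoid_vec_def)
    then show "x \<in> {x \<in> carrier_vec n. residues_of N x = residues_of N y}"
      using y by (auto simp: residues_of_eq_iff[of _ n])
  next
    fix x assume x: "x \<in> {x \<in> carrier_vec n. residues_of N x = residues_of N y}"
    then have "x - y \<in> ?Z" using y by (auto simp: residues_of_eq_iff[of _ n])
    moreover have "x = (x - y) + y" using x y by auto
    ultimately show "x \<in> ?Z #>\<^bsub>?G\<^esub> y" by (auto simp: r_coset_def monoid_vec_def)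
  qed
  have "rcosets\<^bsub>?G\<^esub> ?Z \<subseteq> (\<lambda>z. {x \<in> carrier_vec n. residues_of N x = z}) ` set (box n (int N))"
  proof
    fix C assume "C \<in> rcosets\<^bsub>?G\<^esub> ?Z"
    then obtain y where y: "y \<in> carrier_vec n" "C = ?Z #>\<^bsub>?G\<^esub> y"
      by (auto simp: RCOSETS_def monoid_vec_def)
    moreover have "residues_of N y \<in> set (box n (int N))"
      using y N by (auto simp: residues_of_def set_box length_list_of_vec)
    ultimately show "C \<in> (\<lambda>z. {x \<in> carrier_vec n. residues_of N x = z}) ` set (box n (int N))"
      using coset by blast
  qed
  then have fin: "finite (rcosets\<^bsub>?G\<^esub> ?Z)" by (rule finite_subset) simp
  define P where "P z = (case map_of tab z of None \<Rightarrow> [] | Some P \<Rightarrow> P)" for z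
  \<comment> \<open>A coset knows its residue vector only through its elements, so one is chosen;
    all of them have the same residues.\<close>
  define g where "g C y = real_of_rat (mpoly_eval (P (residues_of N (SOME x. x \<in> C))) y)" for C y
  have "polynomial_fun n (g C)" for C
  proof -
    have "real_of_rat (leval Q v) = (\<Sum>(a, es)\<leftarrow>map (\<lambda>(a, es). (real_of_rat a, es)) Q.
        a * prod_list (map2 (\<lambda>t e. of_int t ^ e) v es))" for Q v
    proof (induction Q)
      case (Cons m Q)
      have "real_of_rat (prod_list (map2 (\<lambda>t e. of_int t ^ e) v es)) =
          prod_list (map2 (\<lambda>t e. of_int t ^ e) v es)" for es
        by (induction v es rule: list_induct2') (simp_all add: of_rat_mult of_rat_power)
      then show ?case using Cons by (cases m) (simp add: of_rat_add of_rat_mult)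
    qed simp
    then show ?thesis unfolding polynomial_fun_def g_def mpoly_eval_leval
      by (intro exI[of _ "map (\<lambda>(a, es). (real_of_rat a, es)) (P (residues_of N (SOME x. x \<in> C)))"])
        (simp add: mpoly_eval_def)
  qed
  moreover have "real (f y) = g (?Z #>\<^bsub>?G\<^esub> y) y" if y: "y \<in> carrier_vec n" "real_vec y \<in> c" for y
  proof -
    have "y \<in> ?Z #>\<^bsub>?G\<^esub> y" using y by (simp add: coset)
    then have "(SOME x. x \<in> ?Z #>\<^bsub>?G\<^esub> y) \<in> ?Z #>\<^bsub>?G\<^esub> y" by (rule someI)
    then have r: "residues_of N (SOME x. x \<in> ?Z #>\<^bsub>?G\<^esub> y) = residues_of N y" using y by (simp add: coset)
    have "real (f y) = real_of_rat (of_nat (f y))" by simp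
    also have "\<dots> = real_of_rat (mpoly_eval (P (residues_of N y)) y)"
      unfolding f[OF y] by (simp add: P_def residues_of_def mpoly_eval_leval split: option.split)
    finally show ?thesis unfolding g_def r .
  qed
  ultimately show ?thesis unfolding quasi_polynomial_on_cone_def quasi_polynomial_on_def
    using sub fin by (intro exI[of _ ?Z] exI[of _ g]) auto
qed

subsection \<open>Reduction to vector partition functions\<close>

definition hcat :: "int mat \<Rightarrow> int mat \<Rightarrow> int mat" where
  "hcat A B = mat (dim_row A) (dim_col A + dim_col B)
     (\<lambda>(i, j). if j < dim_col A then A $$ (i, j) else B $$ (i, j - dim_col A))"

lemma hcat_carrier [simp]:
  "A \<in> carrier_mat m n \<Longrightarrow> B \<in> carrier_mat m k \<Longrightarrow> hcat A B \<in> carrier_mat m (n + k)"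
  by (auto simp: hcat_def)

lemma hcat_mult:
  assumes "A \<in> carrier_mat m n" "B \<in> carrier_mat m k" "u \<in> carrier_vec n" "v \<in> carrier_vec k"
  shows "hcat A B *\<^sub>v (u @\<^sub>v v) = A *\<^sub>v u + B *\<^sub>v v"
proof (rule eq_vecI)
  fix i assume "i < dim_vec (A *\<^sub>v u + B *\<^sub>v v)"
  then have i: "i < m" using assms by simp
  have row: "row (hcat A B) i = row A i @\<^sub>v row B i"
    using i assms by (intro eq_vecI) (auto simp: hcat_def)
  have "row A i \<in> carrier_vec n" "row B i \<in> carrier_vec k" using assms by auto
  from scalar_prod_append[OF this assms(3,4)]
  show "(hcat A B *\<^sub>v (u @\<^sub>v v)) $ i = (A *\<^sub>v u + B *\<^sub>v v) $ i"
    using i assms row by (simp add: hcat_def)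
qed (use assms in \<open>simp add: hcat_def\<close>)

text \<open>For an integral \<open>v\<close> killed by the Gram matrix of \<open>r\<close>, the
  scalar product of \<open>r v\<close> with itself is \<open>0\<close>, so \<open>r v = 0\<close>
  and the cone contains the line through \<open>v\<close>.\<close>

lemma pointed_det:
  assumes r: "r \<in> carrier_mat nR nK" and "pointed nK (unchopped_cone r)"
  shows "det (transpose_mat r * r) \<noteq> 0"
proof
  let ?G = "transpose_mat r * r"
  have G: "?G \<in> carrier_mat nK nK" using r by auto
  assume "det ?G = 0"
  then obtain v where v: "v \<in> carrier_vec nK" "v \<noteq> 0\<^sub>v nK" "?G *\<^sub>v v = 0\<^sub>v nK"
    using det_0_iff_vec_prod_zero[OF G] by auto
  have rv: "r *\<^sub>v v \<in> carrier_vec nR" using r v by simp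
  have "?G *\<^sub>v v = transpose_mat r *\<^sub>v (r *\<^sub>v v)"
    by (rule assoc_mult_mat_vec[of _ nK nR _ nK]) (use r v in auto)
  then have "transpose_mat r *\<^sub>v (r *\<^sub>v v) = 0\<^sub>v nK" using v(3) by simp
  then have "(r *\<^sub>v v) \<bullet> (r *\<^sub>v v) = 0"
    using transpose_vec_mult_scalar[OF r v(1) rv] v(1) by simp
  then have "(\<Sum>i\<in>{0..<nR}. ((r *\<^sub>v v) $ i) * ((r *\<^sub>v v) $ i)) = 0"
    unfolding scalar_prod_def carrier_vecD[OF rv] .
  then have "\<forall>i\<in>{0..<nR}. ((r *\<^sub>v v) $ i) * ((r *\<^sub>v v) $ i) = 0"
    by (subst (asm) sum_nonneg_eq_0_iff) auto
  then have zero: "r *\<^sub>v v = 0\<^sub>v nR" using r by (intro eq_vecI) auto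
  have "t \<cdot>\<^sub>v real_vec v \<in> unchopped_cone r" for t
  proof -
    have "real_mat r *\<^sub>v (t \<cdot>\<^sub>v real_vec v) = t \<cdot>\<^sub>v (real_mat r *\<^sub>v real_vec v)"
      using r v by (intro mult_mat_vec[of _ nR nK]) auto
    also have "\<dots> = t \<cdot>\<^sub>v real_vec (r *\<^sub>v v)" using r v by (simp add: real_mat_mult_vec)
    also have "\<dots> = 0\<^sub>v nR" unfolding zero by auto
    finally show ?thesis using r v by (simp add: unchopped_cone_def)
  qed
  moreover have "real_vec v \<noteq> 0\<^sub>v nK" using v by (auto simp: vec_eq_iff)
  moreover have "real_vec v \<in> carrier_vec nK" using v by simp
  ultimately show False using assms(2) unfolding pointed_def by blast
qed

text \<open>The adjugate of the Gram matrix gives an integral matrix \<open>L\<close> with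
  \<open>L (r x)\<close> equal to the determinant times \<open>x\<close>. The determinant is a
  nonzero integer, so it has absolute value at least \<open>1\<close> and each entry of
  \<open>x\<close> is bounded by that of \<open>L (r x)\<close>. The constant \<open>c\<close> is
  the sum of the absolute values of all entries of \<open>L\<close>, hence an integer.\<close>

lemma pointed_bound:
  assumes r: "r \<in> carrier_mat nR nK" and "pointed nK (unchopped_cone r)"
  shows "\<exists>c\<ge>0. \<forall>x\<in>carrier_vec nK. \<forall>i<nK. \<bar>x $ i\<bar> \<le> c * (\<Sum>j<nR. \<bar>(r *\<^sub>v x) $ j\<bar>)"
proof -
  let ?G = "transpose_mat r * r"
  have G: "?G \<in> carrier_mat nK nK" using r by auto
  define L where "L = adj_mat ?G * transpose_mat r"
  have L: "L \<in> carrier_mat nK nR" unfolding L_def using adj_mat(1)[OF G] r by auto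
  have Lr: "L *\<^sub>v (r *\<^sub>v x) = det ?G \<cdot>\<^sub>v x" if x: "x \<in> carrier_vec nK" for x
  proof -
    have "L *\<^sub>v (r *\<^sub>v x) = (L * r) *\<^sub>v x" using L r x by (simp add: assoc_mult_mat_vec[of _ nK nR])
    also have "L * r = adj_mat ?G * ?G"
      unfolding L_def using adj_mat(1)[OF G] r by (intro assoc_mult_mat[of _ nK nK _ nR _ nK]) auto
    also have "\<dots> = det ?G \<cdot>\<^sub>m 1\<^sub>m nK" by (rule adj_mat(3)[OF G])
    finally show ?thesis using x by auto
  qed
  define c where "c = (\<Sum>i<nK. \<Sum>j<nR. \<bar>L $$ (i, j)\<bar>)"
  have c: "\<bar>L $$ (i, j)\<bar> \<le> c" if "i < nK" "j < nR" for i j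
  proof -
    have "\<bar>L $$ (i, j)\<bar> \<le> (\<Sum>j<nR. \<bar>L $$ (i, j)\<bar>)" using that by (intro member_le_sum) auto
    also have "\<dots> \<le> c" unfolding c_def
      using that by (intro member_le_sum[of i "{..<nK}" "\<lambda>i. \<Sum>j<nR. \<bar>L $$ (i, j)\<bar>"]) (auto intro: sum_nonneg)
    finally show ?thesis .
  qed
  have "\<bar>x $ i\<bar> \<le> c * (\<Sum>j<nR. \<bar>(r *\<^sub>v x) $ j\<bar>)" if x: "x \<in> carrier_vec nK" and i: "i < nK" for x i
  proof -
    have "\<bar>x $ i\<bar> * 1 \<le> \<bar>x $ i\<bar> * \<bar>det ?G\<bar>"
      using pointed_det[OF assms] by (intro mult_left_mono) auto
    then have "\<bar>x $ i\<bar> \<le> \<bar>(L *\<^sub>v (r *\<^sub>v x)) $ i\<bar>" using x i by (simp add: Lr abs_mult mult.commute)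
    also have "(L *\<^sub>v (r *\<^sub>v x)) $ i = (\<Sum>j<nR. L $$ (i, j) * (r *\<^sub>v x) $ j)"
      using L r i by (auto simp: scalar_prod_def lessThan_atLeast0 intro!: sum.cong)
    also have "\<bar>\<dots>\<bar> \<le> (\<Sum>j<nR. \<bar>L $$ (i, j) * (r *\<^sub>v x) $ j\<bar>)" by (rule sum_abs)
    also have "\<dots> \<le> (\<Sum>j<nR. c * \<bar>(r *\<^sub>v x) $ j\<bar>)"
      using c[OF i] by (intro sum_mono) (auto simp: abs_mult intro: mult_right_mono)
    finally show ?thesis by (simp add: sum_distrib_left)
  qed
  moreover have "0 \<le> c" unfolding c_def by (intro sum_nonneg) auto
  ultimately show ?thesis by blast
qed

lemma split_vec: "X \<in> carrier_vec (n + m) \<Longrightarrow> \<exists>u\<in>carrier_vec n. \<exists>v\<in>carrier_vec m. X = u @\<^sub>v v"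
  by (rule bexI[of _ "vec_first X n"], rule bexI[of _ "vec_last X m"]) simp_all

lemma vec_diff_eq_0_iff:
  "a \<in> carrier_vec n \<Longrightarrow> b \<in> carrier_vec n \<Longrightarrow> a - b = 0\<^sub>v n \<longleftrightarrow> b = (a :: int vec)"
  by (auto simp: vec_eq_iff)

lemma vec_add_eq_iff:
  assumes "a \<in> carrier_vec n" "b \<in> carrier_vec n" "c \<in> carrier_vec n"
  shows "a + b = c \<longleftrightarrow> b = c - (a :: int vec)"
  using assms by (auto simp: vec_eq_iff)

lemma nonneg_vecI:
  "v \<in> carrier_vec n \<Longrightarrow> (\<And>i. i < n \<Longrightarrow> 0 \<le> v $ i) \<Longrightarrow> 0\<^sub>v n \<le> (v :: int vec)"
  by (simp add: less_eq_vec_def)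

lemma append_vec_nonneg:
  assumes "u \<in> carrier_vec n" "v \<in> carrier_vec m"
  shows "0\<^sub>v (n + m) \<le> u @\<^sub>v v \<longleftrightarrow> 0\<^sub>v n \<le> u \<and> 0\<^sub>v m \<le> (v :: int vec)"
proof
  assume l: "0\<^sub>v (n + m) \<le> u @\<^sub>v v"
  have "0 \<le> u $ i" if "i < n" for i using l that assms by (auto simp: less_eq_vec_def dest!: spec[of _ i])
  moreover have "0 \<le> v $ i" if "i < m" for i
    using l that assms by (auto simp: less_eq_vec_def dest!: spec[of _ "n + i"])
  ultimately show "0\<^sub>v n \<le> u \<and> 0\<^sub>v m \<le> v" using assms by (simp add: less_eq_vec_def)
qed (use assms in \<open>auto simp: less_eq_vec_def\<close>)

text \<open>The pair of slack variables \<open>u = r x\<close> and \<open>z = s \<lambda> - p x\<close> determines \<open>x\<close>, but its values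
  need not fill a saturated sublattice; so the translate \<open>w = x + C u\<close>, which pointedness makes
  nonnegative, is kept as a third variable.\<close>

lemma vector_partition:
  assumes cone: "chopped_and_sliced_cone nK nL nQ nT nR p q r s"
    and "pointed nK (unchopped_cone r)"
  shows "\<exists>nX nY E B. E \<in> carrier_mat nY nX \<and> mat_kernel E \<inter> {x. 0\<^sub>v nX \<le> x} = {0\<^sub>v nX} \<and>
    B \<in> carrier_mat nY (nL + nQ) \<and>
    (\<forall>lam\<in>carrier_vec nL. \<forall>bet\<in>carrier_vec nQ.
      num_points p q r s lam bet = vector_partition_fun E (B *\<^sub>v (lam @\<^sub>v bet)))"
proof -
  have p: "p \<in> carrier_mat nT nK" and q: "q \<in> carrier_mat nQ nK" and r: "r \<in> carrier_mat nR nK"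
    and s: "s \<in> carrier_mat nT nL" using cone by (auto simp: chopped_and_sliced_cone_def)
  obtain c where c: "0 \<le> c" "\<And>x i. x \<in> carrier_vec nK \<Longrightarrow> i < nK \<Longrightarrow>
      \<bar>x $ i\<bar> \<le> c * (\<Sum>j<nR. \<bar>(r *\<^sub>v x) $ j\<bar>)"
    using pointed_bound[OF r assms(2)] by blast
  \<comment> \<open>All entries are \<open>c\<close>, so each coordinate of \<open>C u\<close> is
    \<open>c\<close> times the sum of the entries of \<open>u\<close>.\<close>
  define C where "C = mat nK nR (\<lambda>_. c)"
  have C: "C \<in> carrier_mat nK nR" by (simp add: C_def)
  let ?nX = "nK + (nR + nT)" and ?nY = "nR + (nT + nQ)"
  \<comment> \<open>In terms of \<open>x = w - C u\<close> the three blocks are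
    \<open>r x - u\<close>, \<open>p x + z\<close> and \<open>q x\<close>. Prescribing the values
    \<open>0\<close>, \<open>s \<lambda>\<close> and \<open>\<beta>\<close> for them makes
    \<open>u\<close> and \<open>z\<close> the slack variables.\<close>
  let ?E1 = "hcat r (hcat (- (r * C) - 1\<^sub>m nR) (0\<^sub>m nR nT))"
  let ?E2 = "hcat p (hcat (- (p * C)) (1\<^sub>m nT))"
  let ?E3 = "hcat q (hcat (- (q * C)) (0\<^sub>m nQ nT))"
  define E where "E = ?E1 @\<^sub>r
      (?E2 @\<^sub>r ?E3)"
  define B where "B = 0\<^sub>m nR (nL + nQ) @\<^sub>r (hcat s (0\<^sub>m nT nQ) @\<^sub>r hcat (0\<^sub>m nQ nL) (1\<^sub>m nQ))"
  have blocks: "?E1 \<in> carrier_mat nR ?nX"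
    "?E2 \<in> carrier_mat nT ?nX"
    "?E3 \<in> carrier_mat nQ ?nX"
    "hcat s (0\<^sub>m nT nQ) \<in> carrier_mat nT (nL + nQ)" "hcat (0\<^sub>m nQ nL) (1\<^sub>m nQ) \<in> carrier_mat nQ (nL + nQ)"
    "0\<^sub>m nR (nL + nQ) \<in> carrier_mat nR (nL + nQ)"
    using p q r s C by (auto intro!: hcat_carrier)
  have E: "E \<in> carrier_mat ?nY ?nX" and B: "B \<in> carrier_mat ?nY (nL + nQ)"
    unfolding E_def B_def using blocks by (auto intro!: carrier_append_rows)
  have shift: "A *\<^sub>v w + - (A * C) *\<^sub>v u = A *\<^sub>v (w - C *\<^sub>v u)"
    if "A \<in> carrier_mat m nK" "w \<in> carrier_vec nK" "u \<in> carrier_vec nR" for A :: "int mat" and m w u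
  proof -
    have "- (A * C) *\<^sub>v u = - ((A * C) *\<^sub>v u)" using that C by auto
    also have "(A * C) *\<^sub>v u = A *\<^sub>v (C *\<^sub>v u)" using that C by (intro assoc_mult_mat_vec[of _ m nK _ nR]) auto
    finally show ?thesis using that C by (subst mult_minus_distrib_mat_vec[of _ m nK]) auto
  qed
  have EX: "E *\<^sub>v (w @\<^sub>v (u @\<^sub>v z)) =
      (r *\<^sub>v (w - C *\<^sub>v u) - u) @\<^sub>v ((p *\<^sub>v (w - C *\<^sub>v u) + z) @\<^sub>v (q *\<^sub>v (w - C *\<^sub>v u)))"
    if w: "w \<in> carrier_vec nK" and u: "u \<in> carrier_vec nR" and z: "z \<in> carrier_vec nT" for w u z
  proof -
    have X: "w @\<^sub>v (u @\<^sub>v z) \<in> carrier_vec ?nX" using w u z by auto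
    have "?E1 *\<^sub>v (w @\<^sub>v (u @\<^sub>v z)) =
        r *\<^sub>v w + ((- (r * C) - 1\<^sub>m nR) *\<^sub>v u + 0\<^sub>m nR nT *\<^sub>v z)"
      using r C w u z by (subst hcat_mult[of _ nR nK _ "nR + nT"], auto intro!: hcat_carrier)
        (subst hcat_mult[of _ nR nR _ nT], auto)
    also have "(- (r * C) - 1\<^sub>m nR) *\<^sub>v u = - (r * C) *\<^sub>v u - u"
      using r C u by (subst minus_mult_distrib_mat_vec[of _ nR nR]) auto
    also have "r *\<^sub>v w + (- (r * C) *\<^sub>v u - u + 0\<^sub>m nR nT *\<^sub>v z) = (r *\<^sub>v w + - (r * C) *\<^sub>v u) - u"
      using r C w u z by (intro eq_vecI) auto
    also have "\<dots> = r *\<^sub>v (w - C *\<^sub>v u) - u" using shift[OF r w u] by simp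
    finally have 1: "?E1 *\<^sub>v (w @\<^sub>v (u @\<^sub>v z)) =
        r *\<^sub>v (w - C *\<^sub>v u) - u" .
    have "?E2 *\<^sub>v (w @\<^sub>v (u @\<^sub>v z)) =
        p *\<^sub>v w + (- (p * C) *\<^sub>v u + 1\<^sub>m nT *\<^sub>v z)"
      using p C w u z by (subst hcat_mult[of _ nT nK _ "nR + nT"], auto intro!: hcat_carrier)
        (subst hcat_mult[of _ nT nR _ nT], auto)
    also have "\<dots> = (p *\<^sub>v w + - (p * C) *\<^sub>v u) + z"
      using p C w u z by (intro eq_vecI) auto
    also have "\<dots> = p *\<^sub>v (w - C *\<^sub>v u) + z" using shift[OF p w u] by simp
    finally have 2: "?E2 *\<^sub>v (w @\<^sub>v (u @\<^sub>v z)) = p *\<^sub>v (w - C *\<^sub>v u) + z" .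
    have "?E3 *\<^sub>v (w @\<^sub>v (u @\<^sub>v z)) =
        q *\<^sub>v w + (- (q * C) *\<^sub>v u + 0\<^sub>m nQ nT *\<^sub>v z)"
      using q C w u z by (subst hcat_mult[of _ nQ nK _ "nR + nT"], auto intro!: hcat_carrier)
        (subst hcat_mult[of _ nQ nR _ nT], auto)
    also have "\<dots> = q *\<^sub>v w + - (q * C) *\<^sub>v u"
      using q C w u z by (intro eq_vecI) auto
    also have "\<dots> = q *\<^sub>v (w - C *\<^sub>v u)" using shift[OF q w u] by simp
    finally have 3: "?E3 *\<^sub>v (w @\<^sub>v (u @\<^sub>v z)) = q *\<^sub>v (w - C *\<^sub>v u)" .
    show ?thesis unfolding E_def
      by (subst mat_mult_append[OF blocks(1) carrier_append_rows[OF blocks(2,3)] X],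
          subst mat_mult_append[OF blocks(2,3) X]) (simp only: 1 2 3)
  qed
  have BY: "B *\<^sub>v (l @\<^sub>v b) = 0\<^sub>v nR @\<^sub>v ((s *\<^sub>v l) @\<^sub>v b)"
    if l: "l \<in> carrier_vec nL" and b: "b \<in> carrier_vec nQ" for l b
  proof -
    have X: "l @\<^sub>v b \<in> carrier_vec (nL + nQ)" using l b by auto
    have "hcat s (0\<^sub>m nT nQ) *\<^sub>v (l @\<^sub>v b) = s *\<^sub>v l" "hcat (0\<^sub>m nQ nL) (1\<^sub>m nQ) *\<^sub>v (l @\<^sub>v b) = b"
      using s l b by (subst hcat_mult[of _ nT nL _ nQ] hcat_mult[of _ nQ nL _ nQ], auto)+
    moreover have "0\<^sub>m nR (nL + nQ) *\<^sub>v (l @\<^sub>v b) = 0\<^sub>v nR" using X by auto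
    ultimately show ?thesis unfolding B_def
      by (subst mat_mult_append[OF blocks(6) carrier_append_rows[OF blocks(4,5)] X],
          subst mat_mult_append[OF blocks(4,5) X]) (simp only:)
  qed
  have EB: "E *\<^sub>v (w @\<^sub>v (u @\<^sub>v z)) = B *\<^sub>v (l @\<^sub>v b) \<longleftrightarrow>
      u = r *\<^sub>v (w - C *\<^sub>v u) \<and> z = s *\<^sub>v l - p *\<^sub>v (w - C *\<^sub>v u) \<and> q *\<^sub>v (w - C *\<^sub>v u) = b"
    if car: "w \<in> carrier_vec nK" "u \<in> carrier_vec nR" "z \<in> carrier_vec nT" "l \<in> carrier_vec nL" "b \<in> carrier_vec nQ"
    for w u z l b
  proof -
    define \<xi> where "\<xi> = w - C *\<^sub>v u"
    have x: "\<xi> \<in> carrier_vec nK" "r *\<^sub>v \<xi> \<in> carrier_vec nR" "p *\<^sub>v \<xi> \<in> carrier_vec nT" "q *\<^sub>v \<xi> \<in> carrier_vec nQ"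
      "s *\<^sub>v l \<in> carrier_vec nT"
      using car C p q r s by (auto simp: \<xi>_def)
    have "E *\<^sub>v (w @\<^sub>v (u @\<^sub>v z)) = B *\<^sub>v (l @\<^sub>v b) \<longleftrightarrow>
        r *\<^sub>v \<xi> - u = 0\<^sub>v nR \<and> p *\<^sub>v \<xi> + z = s *\<^sub>v l \<and> q *\<^sub>v \<xi> = b"
      unfolding EX[OF car(1-3)] BY[OF car(4,5)] \<xi>_def[symmetric] using x car
      by (subst append_vec_eq[of _ nR], auto) (subst (asm) append_vec_eq[of _ nT], auto)+
    also have "r *\<^sub>v \<xi> - u = 0\<^sub>v nR \<longleftrightarrow> u = r *\<^sub>v \<xi>" by (rule vec_diff_eq_0_iff[OF x(2) car(2)])
    also have "p *\<^sub>v \<xi> + z = s *\<^sub>v l \<longleftrightarrow> z = s *\<^sub>v l - p *\<^sub>v \<xi>"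
      by (rule vec_add_eq_iff[OF x(3) car(3) x(5)])
    finally show ?thesis by (simp add: \<xi>_def)
  qed
  define S where "S l b = {x \<in> carrier_vec nK. 0\<^sub>v nR \<le> r *\<^sub>v x \<and> p *\<^sub>v x \<le> s *\<^sub>v l \<and> q *\<^sub>v x = b}" for l b
  define T where "T l b = {X \<in> carrier_vec ?nX. 0\<^sub>v ?nX \<le> X \<and> E *\<^sub>v X = B *\<^sub>v (l @\<^sub>v b)}" for l b
  define lift where "lift l x = (x + C *\<^sub>v (r *\<^sub>v x)) @\<^sub>v ((r *\<^sub>v x) @\<^sub>v (s *\<^sub>v l - p *\<^sub>v x))" for l x
  have T_eq: "T l b = lift l ` S l b" if l: "l \<in> carrier_vec nL" and b: "b \<in> carrier_vec nQ" for l b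
  proof (intro equalityI subsetI)
    fix X assume X: "X \<in> T l b"
    obtain w uz where w: "w \<in> carrier_vec nK" "uz \<in> carrier_vec (nR + nT)" "X = w @\<^sub>v uz"
      using split_vec[of X nK "nR + nT"] X by (auto simp: T_def)
    obtain u z where u: "u \<in> carrier_vec nR" "z \<in> carrier_vec nT" "uz = u @\<^sub>v z"
      using split_vec[OF w(2)] by auto
    define x where "x = w - C *\<^sub>v u"
    have x: "x \<in> carrier_vec nK" using w u C by (auto simp: x_def)
    have eq: "u = r *\<^sub>v x" "z = s *\<^sub>v l - p *\<^sub>v x" "q *\<^sub>v x = b"
      using X EB[OF w(1) u(1,2) l b] by (auto simp: T_def w(3) u(3) x_def)
    have nn: "0\<^sub>v nR \<le> u" "0\<^sub>v nT \<le> z"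
      using X w u by (auto simp: T_def append_vec_nonneg)
    have "x \<in> S l b" using x eq nn p s l by (auto simp: S_def less_eq_vec_def)
    moreover have "w = x + C *\<^sub>v u" using w u C by (auto simp: x_def vec_eq_iff)
    ultimately show "X \<in> lift l ` S l b" using w u eq by (auto simp: lift_def)
  next
    fix X assume "X \<in> lift l ` S l b"
    then obtain x where X: "X = lift l x" and x: "x \<in> carrier_vec nK" "0\<^sub>v nR \<le> r *\<^sub>v x"
      "p *\<^sub>v x \<le> s *\<^sub>v l" "q *\<^sub>v x = b" by (auto simp: S_def)
    let ?u = "r *\<^sub>v x" and ?z = "s *\<^sub>v l - p *\<^sub>v x"
    let ?w = "x + C *\<^sub>v ?u"
    have car: "?w \<in> carrier_vec nK" "?u \<in> carrier_vec nR" "?z \<in> carrier_vec nT"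
      using x C r p s l by auto
    have restore: "?w - C *\<^sub>v ?u = x" using x C r by (auto simp: vec_eq_iff)
    have "0 \<le> ?w $ i" if i: "i < nK" for i
    proof -
      have "(C *\<^sub>v ?u) $ i = c * (\<Sum>j<nR. ?u $ j)"
        using i r by (simp add: C_def scalar_prod_def sum_distrib_left lessThan_atLeast0)
      also have "(\<Sum>j<nR. ?u $ j) = (\<Sum>j<nR. \<bar>?u $ j\<bar>)"
        using x(2) r by (intro sum.cong) (auto simp: less_eq_vec_def)
      finally show ?thesis using c(2)[OF x(1) i] i x C by simp
    qed
    then have "0\<^sub>v nK \<le> ?w" by (intro nonneg_vecI car)
    moreover have "0\<^sub>v nT \<le> ?z" using x(3) p s by (auto simp: less_eq_vec_def)
    ultimately have "0\<^sub>v ?nX \<le> X" unfolding X lift_def using x(2) car by (simp add: append_vec_nonneg)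
    moreover have "E *\<^sub>v X = B *\<^sub>v (l @\<^sub>v b)" unfolding X lift_def EB[OF car l b] restore using x by simp
    ultimately show "X \<in> T l b" unfolding T_def X lift_def using car by auto
  qed
  have inj: "inj_on (lift l) (S l b)" for l b
  proof (rule inj_onI)
    fix x y assume xy: "x \<in> S l b" "y \<in> S l b" "lift l x = lift l y"
    have car: "x \<in> carrier_vec nK" "y \<in> carrier_vec nK" using xy by (auto simp: S_def)
    have "x + C *\<^sub>v (r *\<^sub>v x) = y + C *\<^sub>v (r *\<^sub>v y) \<and> (r *\<^sub>v x) @\<^sub>v (s *\<^sub>v l - p *\<^sub>v x) = (r *\<^sub>v y) @\<^sub>v (s *\<^sub>v l - p *\<^sub>v y)"
      using xy(3) car C r unfolding lift_def by (subst (asm) append_vec_eq[of _ nK]) auto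
    then have 1: "x + C *\<^sub>v (r *\<^sub>v x) = y + C *\<^sub>v (r *\<^sub>v y)" and "r *\<^sub>v x = r *\<^sub>v y"
      using car r by (auto simp: append_vec_eq[of _ nR])
    then have 2: "x + C *\<^sub>v (r *\<^sub>v x) = y + C *\<^sub>v (r *\<^sub>v x)" by simp
    show "x = y"
    proof (rule eq_vecI)
      fix i assume i: "i < dim_vec y"
      from arg_cong[OF 2, of "\<lambda>v. v $ i"] show "x $ i = y $ i" using i car C by simp
    qed (use car in simp)
  qed
  have count: "num_points p q r s l b = vector_partition_fun E (B *\<^sub>v (l @\<^sub>v b))"
    if l: "l \<in> carrier_vec nL" and b: "b \<in> carrier_vec nQ" for l b
  proof -
    have "num_points p q r s l b = card (S l b)"
      unfolding num_points_eq[OF r] S_def using sliced_cone_int[OF p q r]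
      by (intro arg_cong[of _ _ card]) auto
    also have "\<dots> = card (T l b)" unfolding T_eq[OF l b] using inj by (simp add: card_image)
    also have "T l b = {x \<in> carrier_vec (dim_col E). 0\<^sub>v (dim_col E) \<le> x \<and> E *\<^sub>v x = B *\<^sub>v (l @\<^sub>v b)}"
      using E by (simp add: T_def)
    finally show ?thesis by (simp add: vector_partition_fun_def)
  qed
  \<comment> \<open>For the kernel condition: a nonnegative vector in the kernel of \<open>E\<close>
    is a lifted solution over the zero parameters, and boundedness leaves only
    \<open>0\<close>.\<close>
  have zero: "S (0\<^sub>v nL) (0\<^sub>v nQ) \<subseteq> {0\<^sub>v nK}"
  proof
    fix x assume x: "x \<in> S (0\<^sub>v nL) (0\<^sub>v nQ)"
    then have car: "x \<in> carrier_vec nK" by (simp add: S_def)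
    have "list_of_vec x \<in> sols (mat_forms p q r s nL nQ) nK
        (replicate (nL + nQ) 0)"
      using incone_cone_forms[OF p q r s car, of "0\<^sub>v nL" "0\<^sub>v nQ"] x car
      by (simp add: sols_def S_def length_list_of_vec replicate_add)
    from sols_bounded[OF cone this] have "\<forall>i<nK. x $ i = 0"
      using car length_list_of_vec[OF car] by (metis list_of_vec_index nth_mem singletonD subsetD)
    then show "x \<in> {0\<^sub>v nK}" using car by (auto simp: vec_eq_iff)
  qed
  have Bzero: "B *\<^sub>v (0\<^sub>v nL @\<^sub>v 0\<^sub>v nQ) = 0\<^sub>v ?nY"
    using BY[of "0\<^sub>v nL" "0\<^sub>v nQ"] s by auto
  have mult_0: "A *\<^sub>v 0\<^sub>v n = 0\<^sub>v m" if "A \<in> carrier_mat m n" for A :: "int mat" and m n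
    using that by (intro eq_vecI) auto
  have lift0: "lift (0\<^sub>v nL) (0\<^sub>v nK) = 0\<^sub>v ?nX"
    unfolding lift_def mult_0[OF r] mult_0[OF s] mult_0[OF p] mult_0[OF C] by auto
  have ker: "mat_kernel E \<inter> {x. 0\<^sub>v ?nX \<le> x} = T (0\<^sub>v nL) (0\<^sub>v nQ)"
    using E unfolding T_def Bzero by (auto simp: mat_kernel_def)
  have "T (0\<^sub>v nL) (0\<^sub>v nQ) \<subseteq> {0\<^sub>v ?nX}" unfolding T_eq[OF zero_carrier_vec zero_carrier_vec]
    using zero lift0 by auto
  moreover have "0\<^sub>v ?nX \<in> T (0\<^sub>v nL) (0\<^sub>v nQ)" unfolding T_def Bzero using E by auto
  ultimately have "mat_kernel E \<inter> {x. 0\<^sub>v ?nX \<le> x} = {0\<^sub>v ?nX}" unfolding ker by blast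
  with E B count show ?thesis by blast
qed

subsection \<open>The main theorem\<close>

lemma accepts_exists:
  assumes "levels_ok (fst (input_data c)) (fst (snd (snd (input_data c))))"
  shows "\<exists>tabs. accepts c tabs"
proof -
  obtain n M Ls Ws where id: "input_data c = (n, M, Ls, Ws)" by (metis prod.collapse)
  have "\<forall>w. \<exists>tab. fits n Ls w tab" using assms fits_complete by (simp add: id)
  from choice[OF this] obtain T where T: "\<And>w. fits n Ls w (T w)" by blast
  have "accepts c (map T (maxreps M Ws))"
    using T by (auto simp: accepts_def id in_set_zip)
  then show ?thesis by blast
qed

lemma maxreps_subset: "set (maxreps M Ws) \<subseteq> set Ws"
  by (auto simp: maxreps_def)

lemma zip_images:
  assumes "length xs = length ys"
  shows "fst ` set (zip xs ys) = set xs"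
  using assms by (metis map_fst_zip set_map)

theorem theorem2:
  shows "\<exists>alg. \<forall>nK nL nQ nT nR p q r s.
    chopped_and_sliced_cone nK nL nQ nT nR p q r s \<and> pointed nK (unchopped_cone r) \<longrightarrow>
      (\<exists>nX nY E B.
         E \<in> carrier_mat nY nX \<and> mat_kernel E \<inter> {x. 0\<^sub>v nX \<le> x} = {0\<^sub>v nX} \<and>
         B \<in> carrier_mat nY (nL + nQ) \<and>
         (\<forall>lam\<in>carrier_vec nL. \<forall>bet\<in>carrier_vec nQ.
            num_points p q r s lam bet = vector_partition_fun E (B *\<^sub>v (lam @\<^sub>v bet)))) \<and>
      (\<exists>F. fan (nL + nQ) F \<and>
         (\<forall>c\<in>maximal_cones F. quasi_polynomial_on_cone (nL + nQ) c
            (\<lambda>y. real (num_points p q r s (vec_first y nL) (vec_last y nQ)))) \<and>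
         (\<forall>lam\<in>carrier_vec nL. \<forall>bet\<in>carrier_vec nQ.
            real_vec (lam @\<^sub>v bet) \<notin> \<Union>F \<longrightarrow> num_points p q r s lam bet = 0) \<and>
         (\<exists>cones pieces.
            computes alg [code_input p q r s] (code_output cones pieces) \<and>
            describes (nL + nQ) cones pieces F
              (\<lambda>y. num_points p q r s (vec_first y nL) (vec_last y nQ))))"
proof -
  \<comment> \<open>The program is obtained before any data are fixed, so one program serves all
    inputs.\<close>
  obtain alg where alg: "\<And>c. \<exists>tabs. accepts c tabs \<Longrightarrow>
      \<exists>tabs. accepts c tabs \<and> computes alg [enc c] (enc (alg_output c tabs))"
    using algorithm_exists by blast
  show ?thesis
  proof (intro exI[of _ alg] allI impI, elim conjE, rule conjI)
    fix nK nL nQ nT nR p q r s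
    assume cone: "chopped_and_sliced_cone nK nL nQ nT nR p q r s"
      and "pointed nK (unchopped_cone r)"
    then show "\<exists>nX nY E B.
         E \<in> carrier_mat nY nX \<and> mat_kernel E \<inter> {x. 0\<^sub>v nX \<le> x} = {0\<^sub>v nX} \<and>
         B \<in> carrier_mat nY (nL + nQ) \<and>
         (\<forall>lam\<in>carrier_vec nL. \<forall>bet\<in>carrier_vec nQ.
            num_points p q r s lam bet = vector_partition_fun E (B *\<^sub>v (lam @\<^sub>v bet)))"
      by (rule vector_partition)
    have p: "p \<in> carrier_mat nT nK" and q: "q \<in> carrier_mat nQ nK" and r: "r \<in> carrier_mat nR nK"
      and s: "s \<in> carrier_mat nT nL" using cone by (auto simp: chopped_and_sliced_cone_def)
    define n where "n = nL + nQ"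
    define c where "c = [code_mat p, code_mat q, code_mat r, code_mat s]"
    define D where "D = mat_forms p q r s nL nQ"
    define P where "P = fst (level D nK)"
    define M where "M = snd (level D nK)"
    define Ls where "Ls = levels D nK"
    define Ws where "Ws = reps n P M"
    define F where "F = cell n M ` set Ws"
    define f where "f y = num_points p q r s (vec_first y nL) (vec_last y nQ)" for y
    have idata: "input_data c = (n, M, Ls, Ws)"
      using p q r s by (simp add: input_data_def input_forms_def c_def nthd_nth parse_mat Let_def
          n_def D_def[symmetric] P_def M_def Ls_def Ws_def)
    have lenD: "\<forall>a\<in>set D. length a = nK + n" unfolding D_def n_def by (rule cone_forms_length[OF p q r s])
    have lenM: "\<forall>a\<in>set M. length a = n" unfolding M_def by (rule level_length[OF lenD])
    have PM: "set P \<subseteq> set M" unfolding P_def M_def by (rule level_subset)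
    have levels: "levels_ok n Ls" unfolding Ls_def by (rule levels_ok_levels[OF lenD])
    have f_sols: "f y = card (sols D nK (list_of_vec y))" if y: "y \<in> carrier_vec n" for y
      using num_points_sols[OF p q r s vec_first_carrier vec_last_carrier, of y y] y
      unfolding f_def D_def n_def by (simp only: vec_first_last_append)
    have lenW: "length w = n" and coneW: "incone P w" if "w \<in> set Ws" for w
      using that length_samples by (auto simp: Ws_def reps_def)
    have count: "int (f y) = qval Ls w (list_of_vec y)"
      if w: "w \<in> set Ws" and y: "y \<in> carrier_vec n" "real_vec y \<in> cell n M w" for w y
      using card_sols[OF lenD _ refl order_refl lenW[OF w] length_list_of_vec[OF y(1)]]
        sols_bounded[OF cone] coneW[OF w] y real_vec_cell[OF y(1), of M w]
      by (simp add: f_sols D_def n_def P_def M_def Ls_def)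
    have "\<exists>tabs. accepts c tabs" by (rule accepts_exists) (simp add: idata levels)
    from alg[OF this] obtain tabs where acc: "accepts c tabs"
      and comp: "computes alg [enc c] (enc (alg_output c tabs))" by blast
    define Z where "Z = zip (maxreps M Ws) tabs"
    have len: "length (maxreps M Ws) = length tabs" and fits: "\<And>x. x \<in> set Z \<Longrightarrow> fits n Ls (fst x) (snd x)"
      using acc by (auto simp: accepts_def idata Z_def)
    have Z: "fst ` set Z = set (maxreps M Ws)" unfolding Z_def by (rule zip_images[OF len])
    define N where "N = nat (period Ls)"
    have N: "0 < N" using period_pos[of Ls] by (simp add: N_def)
    define A where "A w = mat_of_rows_list n (cellrows M w)" for w
    have A: "rational_cone (A w) = cell n M w" "dim_col (A w) = n" for w
      unfolding A_def by (rule rational_cone_cell[OF lenM]) (simp add: mat_of_rows_list_def)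
    have codeA: "code_rows n (cellrows M w) = code_mat (A w)" for w
      unfolding A_def by (rule code_rows[OF length_cellrows[OF lenM]])
    have piece: "of_nat (f y) = qpoly_eval (N, rat_table (snd x)) y"
      if x: "x \<in> set Z" and y: "y \<in> carrier_vec n" "real_vec y \<in> cell n M (fst x)" for x y
    proof -
      have "fst x \<in> set (maxreps M Ws)" using x Z by blast
      then have w: "fst x \<in> set Ws" using maxreps_subset by blast
      have "qpoly_eval (N, rat_table (snd x)) y = of_int (qval Ls (fst x) (list_of_vec y))"
        unfolding N_def qpoly_eval_table[OF period_pos]
        by (rule fits_sound[OF levels fits[OF x] length_list_of_vec[OF y(1)]])
      also have "qval Ls (fst x) (list_of_vec y) = int (f y)" using count[OF w y] by simp
      finally show ?thesis by simp
    qed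
    define cones where "cones = map A Ws"
    define pieces where "pieces = map (\<lambda>x. (A (fst x), (N, rat_table (snd x)))) Z"
    have Fmax: "maximal_cones F = cell n M ` set (maxreps M Ws)"
      unfolding F_def Ws_def by (rule maximal_cones_reps)
    \<comment> \<open>The raw tables found by the search have the same codes as the rational tables
      they stand for, because \<open>fits\<close> guarantees reduced coefficients.\<close>
    have out: "enc (alg_output c tabs) = code_output cones pieces"
    proof -
      have "alg_output c tabs = (map (\<lambda>w. code_mat (A w)) Ws,
          map (\<lambda>x. (code_mat (A (fst x)), N, snd x)) Z)"
        by (simp add: alg_output_def idata codeA N_def Z_def)
      moreover have "enc (N, snd x) = code_qpoly (N, rat_table (snd x))" if "x \<in> set Z" for x
        using fits[OF that] by (intro code_qpoly_rat_table[symmetric]) (simp add: fits_def)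
      then have "map enc (map (\<lambda>x. (code_mat (A (fst x)), N, snd x)) Z) =
          map (\<lambda>(A, qp). prod_encode (code_mat A, code_qpoly qp)) pieces"
        unfolding pieces_def by (simp add: enc_Pair[of "code_mat _"] enc_nat_def del: code_qpoly.simps)
      moreover have "map enc (map (\<lambda>w. code_mat (A w)) Ws) = map code_mat cones"
        by (simp add: cones_def enc_nat_def)
      ultimately show ?thesis by (simp only: code_output_def enc_Pair enc_list_def)
    qed
    show "\<exists>F. fan (nL + nQ) F \<and>
         (\<forall>c\<in>maximal_cones F. quasi_polynomial_on_cone (nL + nQ) c
            (\<lambda>y. real (num_points p q r s (vec_first y nL) (vec_last y nQ)))) \<and>
         (\<forall>lam\<in>carrier_vec nL. \<forall>bet\<in>carrier_vec nQ.
            real_vec (lam @\<^sub>v bet) \<notin> \<Union>F \<longrightarrow> num_points p q r s lam bet = 0) \<and>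
         (\<exists>cones pieces.
            computes alg [code_input p q r s] (code_output cones pieces) \<and>
            describes (nL + nQ) cones pieces F
              (\<lambda>y. num_points p q r s (vec_first y nL) (vec_last y nQ)))"
      unfolding n_def[symmetric] f_def[symmetric]
    proof (intro exI[of _ F] conjI exI[of _ cones] exI[of _ pieces])
      show "fan n F" unfolding F_def Ws_def by (rule fan_reps[OF lenM PM])
    next
      show "\<forall>c\<in>maximal_cones F. quasi_polynomial_on_cone n c (\<lambda>y. real (f y))"
      proof
        fix C assume "C \<in> maximal_cones F"
        then obtain x where x: "x \<in> set Z" "C = cell n M (fst x)" unfolding Fmax Z[symmetric] by blast
        show "quasi_polynomial_on_cone n C (\<lambda>y. real (f y))"
          by (rule quasi_polynomial_on_table[OF N]) (use piece[OF x(1)] x(2) in blast)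
      qed
    next
      show "\<forall>lam\<in>carrier_vec nL. \<forall>bet\<in>carrier_vec nQ.
          real_vec (lam @\<^sub>v bet) \<notin> \<Union>F \<longrightarrow> num_points p q r s lam bet = 0"
      proof (intro ballI impI)
        fix lam bet :: "int vec"
        assume lb: "lam \<in> carrier_vec nL" "bet \<in> carrier_vec nQ" and out: "real_vec (lam @\<^sub>v bet) \<notin> \<Union>F"
        let ?y = "lam @\<^sub>v bet"
        have y: "?y \<in> carrier_vec n" using lb by (simp add: n_def)
        \<comment> \<open>By \<open>reps_complete\<close> the cells of the fan cover the projected
          cone, so a point outside them violates a projected inequality and no solution lies above
          it.\<close>
        have "\<not> incone P (list_of_vec ?y)"
        proof
          assume "incone P (list_of_vec ?y)"
          then have "incone P (map real_of_int (list_of_vec ?y))"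
            by (simp only: incone_def ldot_of_int of_int_0_le_iff)
          from reps_complete[OF lenM PM _ this] length_list_of_vec[OF y]
          obtain w where w: "w \<in> set Ws" "same_signs M w (map real_of_int (list_of_vec ?y))"
            by (auto simp: Ws_def)
          then have "incell M w (list_of_vec ?y)" using same_signs_incell incell_of_int by blast
          then have "real_vec ?y \<in> cell n M w" using real_vec_cell[OF y] by blast
          then show False using out w(1) by (auto simp: F_def)
        qed
        then have "sols D nK (list_of_vec ?y) = {}"
          using sols_level[of D nK "list_of_vec ?y"] lenD length_list_of_vec[OF y] by (auto simp: P_def)
        then show "num_points p q r s lam bet = 0"
          using num_points_sols[OF p q r s lb] by (simp add: D_def)
      qed
    next
      show "computes alg [code_input p q r s] (code_output cones pieces)"
        using comp unfolding out by (simp add: c_def code_input_enc)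
    next
      have "F = rational_cone ` set cones" by (simp add: F_def cones_def image_image A)
      moreover have "\<forall>(A, qp)\<in>set pieces. dim_col A = n \<and> fst qp > 0 \<and>
          (\<forall>y\<in>carrier_vec n. real_vec y \<in> rational_cone A \<longrightarrow> of_nat (f y) = qpoly_eval qp y)"
        using piece N by (auto simp: pieces_def A simp del: qpoly_eval.simps)
      moreover have "maximal_cones F = rational_cone ` fst ` set pieces"
        unfolding Fmax Z[symmetric] by (simp add: pieces_def image_image A)
      ultimately show "describes n cones pieces F f"
        unfolding describes_def by (simp add: cones_def A)
    qed
  qed
qed

end
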